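(* (a) Let $f\in\mathbb{R}[x,y,z]$ be a psd quartic form with $f(0,0,1)=0$, and write $f=f_2(x,y)z^2+f_3(x,y)z+f_4(x,y)$ with $f_i\in\mathbb{R}[x,y]$ homogeneous of degree $i$. Assume $\mathrm{disc}_2(f_2)\neq 0$, $f_2\nmid f_3$, and $\mathrm{disc}_6(4f_2f_4-f_3^2)\neq0$. Then $f$ has precisely $4$ orthogonal equivalence classes of representations as a sum of three squares of quadratic forms. (b) Let $f=z^4+f_2z^2+f_3z+f_4\in\mathbb{R}[x,y,z]$ with $f_i\in\mathbb{R}[x,y]$ homogeneous of degree $i$ ($i=2,3,4$), such that $f$ is strictly positive definite and $f-z^4$ is psd. Assume that none of the following conditions $(E_1)$–$(E_{11})$ holds: $(E_1)$ $\mathrm{disc}_2(f_2)=0$; $(E_2)$ $f_2\mid f_3$; $(E_3)$ $\mathrm{disc}_6(4f_2f_4-f_3^2)=0$; $(E_4)$ $\mathrm{disc}_3(f_3)=0$; $(E_5)$ $\gcd(f_3,f_4)\ne1$; $(E_6)$ $\gcd(g_{23},g_{24})\neq1$; $(E_7)$ $\gcd(g_{24},g_{34})\ne1$; $(E_8)$ $\Phi_{3,4}(f_3,f_2^2,f_4)=0$; $(E_9)$ $\mathrm{disc}_8(g_{23}g_{34}-g_{24}^2)=0$; $(E_{10})$ $\Phi_{8,18}(P,Q,R^2)=0$; $(E_{11})$ $\gcd(f_3,4f_4-f_2^2)\ne 1$. Then $f$ has precisely $8$ orthogonal equivalence classes of representations as a sum of three squares of quadratic forms.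
   Context: A real form is psd if it takes only nonnegative values, strictly positive definite if it takes positive values at all nonzero real points. Two representations $f=\sum_{i=1}^3p_i^2=\sum_{i=1}^3p_i'^2$ with quadratic forms $p_i,p_i'\in\mathbb{R}[x,y,z]$ are (orthogonally) equivalent if there is $S=(s_{ij})\in O_3(\mathbb{R})$ with $p'_j=\sum_i s_{ij}p_i$ for $j=1,2,3$. For a univariate polynomial $F=a_0x^n+\dots+a_n$ over a field, $\mathrm{disc}_n(F)=a_0^{2n-2}\prod_{i<j}(\alpha_i-\alpha_j)^2$ ($\alpha_i$ the roots of $F$ in an algebraic closure) when $a_0\neq 0$; this is an integral polynomial in $a_0,\dots,a_n$, and $\mathrm{disc}_n(F)$ denotes this polynomial evaluated at the coefficients in general. For a binary form $F(x,y)$ of degree $n$, $\mathrm{disc}_n(F):=\mathrm{disc}_n(F(x,1))$. Divisibility and gcd conditions in $(E_2),(E_5),(E_{11})$ are for binary forms in $\mathbb{R}[x,y]$. For $(E_6)$–$(E_{10})$ and $(E_8)$, dehomogenize by setting $y=1$, so $f_2,f_3,f_4\in\mathbb{R}[x]$, and let $'$ denote $d/dx$. Put $g_{ij}:=if_if_j'-jf_jf_i'$ for $i,j\in\{2,3,4\}$, and $P:=g_{23}g_{34}-g_{24}^2$, $Q:=f_4^2g_{23}(2f_4g_{23}-f_3g_{24})$, $R:=(8f_2f_4-3f_3^2)g_{23}+2f_2f_3g_{24}$. For $m,n\ge2$ and $F=\sum_{i=0}^m a_ix^{m-i}$, $G,H$ of degree $\le n$, $\Phi_{m,n}(F,G,H)$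 is the integral polynomial in the coefficients of $F,G,H$ which, when $a_0\neq0$ and $\alpha_1,\dots,\alpha_m$ are the roots of $F$, equals $a_0^{(m-1)(n-1)}\prod_{1\le i<j\le m}\frac{G(\alpha_i)H(\alpha_j)-G(\alpha_j)H(\alpha_i)}{\alpha_i-\alpha_j}$ (this expression is such a polynomial). In $(E_8)$, $F=f_3$ is viewed with $m=3$ and $G=f_2^2,H=f_4$ with $n=4$; in $(E_{10})$, $P$ is viewed with $m=8$ and $Q,R^2$ with $n=18$. *)

theory Defs
  imports "HOL-Analysis.Analysis" "HOL-Computational_Algebra.Computational_Algebra"
begin

text \<open>We use R[x,y] = (R[y])[x], i.e. the type real poly poly (outer variable x,
inner variable y), and R[x,y,z] = ((R[y])[x])[z], i.e. real poly poly poly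
(outer variable z). Divisibility and gcd are the library notions in these rings.\<close>

type_synonym bipoly = "real poly poly"
type_synonym tripoly = "real poly poly poly"

definition bihom :: "nat \<Rightarrow> bipoly \<Rightarrow> bool" where
  "bihom n F \<longleftrightarrow> (\<forall>i j. coeff (coeff F i) j \<noteq> 0 \<longrightarrow> i + j = n)"

definition trihom :: "nat \<Rightarrow> tripoly \<Rightarrow> bool" where
  "trihom n p \<longleftrightarrow> (\<forall>k i j. coeff (coeff (coeff p k) i) j \<noteq> 0 \<longrightarrow> i + j + k = n)"

definition eval2 :: "bipoly \<Rightarrow> real \<Rightarrow> real \<Rightarrow> real" where
  "eval2 F x y = poly (poly F [:x:]) y"

definition eval3 :: "tripoly \<Rightarrow> real \<Rightarrow> real \<Rightarrow> real \<Rightarrow> real" where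
  "eval3 p x y z = eval2 (poly p [:[:z:]:]) x y"

definition dehom :: "bipoly \<Rightarrow> real poly" where
  "dehom F = map_poly (\<lambda>c. poly c 1) F"

definition const3 :: "real \<Rightarrow> tripoly" where
  "const3 s = [:[:[:s:]:]:]"

definition croots :: "complex poly \<Rightarrow> complex list" where
  "croots q = (SOME as. length as = degree q \<and>
                  q = smult (lead_coeff q) (\<Prod>a\<leftarrow>as. [:-a, 1:]))"

text \<open>Root formula for disc_n, valid when the coefficient a_0 of x^n is nonzero.\<close>
definition disc_formula :: "nat \<Rightarrow> real poly \<Rightarrow> real" where
  "disc_formula n F =
     (let q = map_poly complex_of_real F; as = croots q in
      Re (complex_of_real (coeff F n) ^ (2 * n - 2) *
          (\<Prod>i<n. \<Prod>j\<in>{i<..<n}. (as ! i - as ! j) ^ 2)))"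

text \<open>disc_n(F) for F = a_0 x^n + ... + a_n (degree at most n): the integral polynomial
in the coefficients given by the root formula when a_0 \<noteq> 0; for a_0 = 0 its value
is obtained (by continuity of polynomials) as the limit a_0 \<rightarrow> 0.\<close>
definition disc :: "nat \<Rightarrow> real poly \<Rightarrow> real" where
  "disc n F = (if coeff F n \<noteq> 0 then disc_formula n F
               else Lim (at 0) (\<lambda>t. disc_formula n (F + monom t n)))"

definition bidisc :: "nat \<Rightarrow> bipoly \<Rightarrow> real" where
  "bidisc n F = disc n (dehom F)"

text \<open>The polynomial (G(a)H(b) - G(b)H(a))/(a - b) in a, b, evaluated
(on the diagonal a = b its value is G'(a)H(a) - G(a)H'(a)).\<close>
definition divdiff :: "complex poly \<Rightarrow> complex poly \<Rightarrow> complex \<Rightarrow> complex \<Rightarrow> complex" where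
  "divdiff G H a b =
     (if a \<noteq> b then (poly G a * poly H b - poly G b * poly H a) / (a - b)
      else poly (pderiv G) a * poly H a - poly G a * poly (pderiv H) a)"

definition Phi_formula :: "nat \<Rightarrow> nat \<Rightarrow> real poly \<Rightarrow> real poly \<Rightarrow> real poly \<Rightarrow> real" where
  "Phi_formula m n F G H =
     (let as = croots (map_poly complex_of_real F);
          G' = map_poly complex_of_real G; H' = map_poly complex_of_real H in
      Re (complex_of_real (coeff F m) ^ ((m - 1) * (n - 1)) *
          (\<Prod>i<m. \<Prod>j\<in>{i<..<m}. divdiff G' H' (as ! i) (as ! j))))"

definition Phi :: "nat \<Rightarrow> nat \<Rightarrow> real poly \<Rightarrow> real poly \<Rightarrow> real poly \<Rightarrow> real" where
  "Phi m n F G H = (if coeff F m \<noteq> 0 then Phi_formula m n F G H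
                    else Lim (at 0) (\<lambda>t. Phi_formula m n (F + monom t m) G H))"

definition sos3_reps :: "tripoly \<Rightarrow> (tripoly ^ 3) set" where
  "sos3_reps f = {p. (\<forall>i. trihom 2 (p $ i)) \<and> f = (\<Sum>i\<in>UNIV. (p $ i) ^ 2)}"

definition orth_equiv :: "(tripoly ^ 3) rel" where
  "orth_equiv = {(p, p'). \<exists>S :: real ^ 3 ^ 3. orthogonal_matrix S \<and>
                     (\<forall>j. p' $ j = (\<Sum>i\<in>UNIV. const3 (S $ i $ j) * p $ i))}"

definition num_sos3_classes :: "tripoly \<Rightarrow> nat" where
  "num_sos3_classes f = card (sos3_reps f // (orth_equiv \<inter> (sos3_reps f \<times> sos3_reps f)))"

definition psd3 :: "tripoly \<Rightarrow> bool" where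
  "psd3 f \<longleftrightarrow> (\<forall>x y z. eval3 f x y z \<ge> 0)"

definition pd3 :: "tripoly \<Rightarrow> bool" where
  "pd3 f \<longleftrightarrow> (\<forall>x y z. (x, y, z) \<noteq> (0, 0, 0) \<longrightarrow> eval3 f x y z > 0)"

definition gfun :: "nat \<Rightarrow> nat \<Rightarrow> real poly \<Rightarrow> real poly \<Rightarrow> real poly" where
  "gfun i j fi fj = smult (real i) (fi * pderiv fj) - smult (real j) (fj * pderiv fi)"

end

theory Submission
  imports Defs
begin

text \<open>
  Put \<open>f\<^sub>s = s\<^sup>2 z\<^sup>4 + f\<^sub>2 z\<^sup>2 + f\<^sub>3 z + f\<^sub>4\<close> for \<open>0 \<le> s \<le> 1\<close>. An orthogonal transformation brings a
  representation of \<open>f\<^sub>s\<close> into the form \<open>(s z\<^sup>2 + a)\<^sup>2 + (l\<^sub>2 z + q\<^sub>2)\<^sup>2 + (l\<^sub>3 z + q\<^sub>3)\<^sup>2\<close>, unique up to the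
  group \<open>O(2)\<close> acting on the last two summands and, for \<open>s = 0\<close>, up to the sign of \<open>a\<close>. The 13 real
  coefficients satisfy 12 quadratic equations. They are bounded, and together with a
  slice condition for \<open>SO(2)\<close> their linearization is injective, so by invariance of domain the number of
  \<open>O(2)\<close>-orbits does not depend on \<open>s\<close>. For \<open>s > 0\<close> injectivity holds because the curve \<open>f\<^sub>s = 0\<close> has no complex
  singular point \<open>(\<alpha>, 1, \<zeta>)\<close>: for real \<open>\<alpha>\<close> also \<open>\<zeta>\<close> would be real, against positivity, and for nonreal \<open>\<alpha>\<close> a
  singular point would, with its conjugate, give two roots of \<open>P\<close> at which \<open>128 s\<^sup>2 Q = R\<^sup>2\<close>, so that \<open>\<Phi>(P, Q, R\<^sup>2)\<close> vanishes.

  For \<open>s = 0\<close>, one can fix \<open>l\<^sub>2, l\<^sub>3\<close> with \<open>l\<^sub>2\<^sup>2 + l\<^sub>3\<^sup>2 = f\<^sub>2\<close>. With \<open>e = l\<^sub>2 q\<^sub>3 - l\<^sub>3 q\<^sub>2\<close> one has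
  \<open>(2e)\<^sup>2 + f\<^sub>2 (2a)\<^sup>2 = 4 f\<^sub>2 f\<^sub>4 - f\<^sub>3\<^sup>2\<close>. This norm equation has \<open>2\<^sup>4\<close> solutions, since each of the three
  quadratic factors of the right-hand side doubles their number, and half of them come from a representation.
  Hence there are 8 orbits, forming 4 pairs under \<open>a \<mapsto> -a\<close>.
\<close>

section \<open>Vanishing of discriminants and resultant-like invariants\<close>

text \<open>The coefficient of z^4 is taken as s^2 so that s enters linearly beside
  \<open>a\<close>: the twelve remaining equations then have a right-hand side that does not depend
  on s. With s as a coordinate the unknowns have dimension 14, and the map to s, the slice condition
  and the twelve equations also lands in dimension 14, as invariance of domain requires. This map is
  quadratic, so its differences are given exactly by a bilinear form, and local injectivity follows
  from an injective linearization by compactness alone. The path stays in the right region by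
  convexity: f_s = s^2 f + (1 - s^2)(f - z^4). At a singular point Euler's relation removes s, two
  eliminations give g23 \<zeta> = - g24 and P = 0, and what remains is the relation between s^2, Q
  and R^2. Since s is real, conjugate roots satisfy the same relation. The obstacle in the
  hypotheses is that \<open>disc\<close> and \<open>Phi\<close> are limits when a leading
  coefficient vanishes. This is how points with y = 0 enter: a singular point there makes P lose two
  degrees, and the limit defining its discriminant has to be shown to be 0. Hence the estimates for
  roots that escape to infinity.\<close>

lemma exists_croots:
  fixes q :: "complex poly"
  shows "\<exists>as. length as = degree q \<and> q = smult (lead_coeff q) (\<Prod>a\<leftarrow>as. [:-a, 1:])"
proof (induction "degree q" arbitrary: q)
  case 0
  then obtain c where "q = [:c:]" by (metis degree_eq_zeroE)
  then show ?case by (intro exI[of _ "[]"]) auto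
next
  case (Suc n)
  then have "\<not> constant (poly q)"
    by (simp add: constant_degree)
  then obtain z where "poly q z = 0"
    using fundamental_theorem_of_algebra by blast
  then obtain r where r: "q = [:-z, 1:] * r"
    by (metis poly_eq_0_iff_dvd dvdE)
  have "q \<noteq> 0" using Suc.hyps(2) by auto
  then have "r \<noteq> 0" using r by auto
  then have d: "degree q = Suc (degree r)"
    unfolding r by (subst degree_mult_eq) auto
  then obtain as where as: "length as = degree r" "r = smult (lead_coeff r) (\<Prod>a\<leftarrow>as. [:-a, 1:])"
    using Suc by auto
  have "lead_coeff q = lead_coeff r" unfolding r by (subst lead_coeff_mult) auto
  moreover have "[:-z, 1:] * r = [:-z, 1:] * smult (lead_coeff r) (\<Prod>a\<leftarrow>as. [:-a, 1:])"
    by (rule arg_cong[OF as(2)])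
  ultimately have "q = smult (lead_coeff q) (\<Prod>a\<leftarrow>z # as. [:-a, 1:])"
    using r by (simp only: list.map prod_list.Cons mult_smult_right)
  then show ?case using as d by (intro exI[of _ "z # as"]) auto
qed

lemma
  shows length_croots: "length (croots q) = degree q"
    and croots_factorization: "q = smult (lead_coeff q) (\<Prod>a\<leftarrow>croots q. [:-a, 1:])"
  using someI_ex[OF exists_croots[of q]] unfolding croots_def by blast+

section \<open>Products over roots and over pairs of roots\<close>

lemma prod_list_map_nth:
  fixes f :: "'a \<Rightarrow> 'b::comm_monoid_mult"
  shows "prod_list (map f xs) = (\<Prod>i<length xs. f (xs ! i))"
proof (induction xs rule: rev_induct)
  case (snoc x xs)
  have "(\<Prod>i<length xs. f ((xs @ [x]) ! i)) = (\<Prod>i<length xs. f (xs ! i))"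
    by (rule prod.cong) (auto simp: nth_append)
  then show ?case using snoc by simp
qed simp

lemma poly_croots:
  "poly q x = lead_coeff q * (\<Prod>i<degree q. x - croots q ! i)"
proof -
  have "poly q x = lead_coeff q * poly (\<Prod>a\<leftarrow>croots q. [:-a, 1:]) x"
    by (subst croots_factorization[of q]) simp
  also have "poly (\<Prod>a\<leftarrow>as. [:-a, 1:]) x = (\<Prod>a\<leftarrow>as. x - a)" for as
    by (induction as) (auto simp: algebra_simps)
  finally show ?thesis by (simp add: prod_list_map_nth length_croots)
qed

lemma monic_prod_linear:
  fixes as :: "'a::idom list"
  shows "degree (\<Prod>a\<leftarrow>as. [:-a, 1:]) = length as"
    and "lead_coeff (\<Prod>a\<leftarrow>as. [:-a, 1:]) = 1"
proof -
  have "degree (\<Prod>a\<leftarrow>as. [:-a, 1:]) = length as \<and> lead_coeff (\<Prod>a\<leftarrow>as. [:-a, 1:]) = 1"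
  proof (induction as)
    case (Cons a as)
    then have "(\<Prod>a\<leftarrow>as. [:-a, 1:]) \<noteq> 0" by auto
    then have "degree (\<Prod>a\<leftarrow>a # as. [:-a, 1:]) = Suc (length as)"
      using Cons by (simp only: list.map prod_list.Cons, subst degree_mult_eq) auto
    moreover have "lead_coeff (\<Prod>a\<leftarrow>a # as. [:-a, 1:]) = 1"
      by (simp only: list.map prod_list.Cons lead_coeff_mult Cons.IH[THEN conjunct2]) simp
    ultimately show ?case by (simp only: list.size) simp
  qed simp
  then show "degree (\<Prod>a\<leftarrow>as. [:-a, 1:]) = length as" "lead_coeff (\<Prod>a\<leftarrow>as. [:-a, 1:]) = 1"
    by blast+
qed

lemma coeff_prod_linear:
  fixes as :: "'a::idom list"
  assumes "as \<noteq> []"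
  shows "coeff (\<Prod>a\<leftarrow>as. [:-a, 1:]) (length as - 1) = - sum_list as"
  using assms
proof (induction as)
  case (Cons a as)
  let ?p = "\<Prod>a\<leftarrow>as. [:-a, 1:]"
  have "coeff ?p (length as) = 1"
    using monic_prod_linear(2)[of as] unfolding monic_prod_linear(1) .
  moreover have "coeff ([:-a, 1:] * ?p) (length as) = - a * coeff ?p (length as) + (if as = [] then 0 else coeff ?p (length as - 1))"
    by (cases as) (auto simp: coeff_pCons)
  ultimately show ?case using Cons.IH by (cases "as = []") auto
qed simp

text \<open>Each index lies in exactly n - 1 pairs. This count is what matches the power of the
  leading coefficient in the root formulas.\<close>

lemma prod_pairs_mult:
  fixes x :: "nat \<Rightarrow> 'a::comm_monoid_mult"
  shows "(\<Prod>i<n. \<Prod>j\<in>{i<..<n}. x i * x j) = (\<Prod>i<n. x i) ^ (n - 1)"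
proof (induction n)
  case (Suc n)
  have "(\<Prod>i<n. \<Prod>j\<in>{i<..<Suc n}. x i * x j) = (\<Prod>i<n. (\<Prod>j\<in>{i<..<n}. x i * x j) * (x i * x n))"
  proof (rule prod.cong)
    fix i assume "i \<in> {..<n}"
    then have "{i<..<Suc n} = insert n {i<..<n}" by auto
    then show "(\<Prod>j\<in>{i<..<Suc n}. x i * x j) = (\<Prod>j\<in>{i<..<n}. x i * x j) * (x i * x n)"
      by (simp add: mult.commute)
  qed simp
  also have "\<dots> = (\<Prod>i<n. \<Prod>j\<in>{i<..<n}. x i * x j) * ((\<Prod>i<n. x i) * x n ^ n)"
    by (simp only: prod.distrib[of "\<lambda>i. \<Prod>j\<in>{i<..<n}. x i * x j"] prod.distrib[of x]) simp
  also have "\<dots> = (\<Prod>i<n. x i) ^ (n - 1) * ((\<Prod>i<n. x i) * x n ^ n)"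
    by (simp only: Suc.IH)
  also have "\<dots> = ((\<Prod>i<n. x i) * x n) ^ n"
    by (cases n) (auto simp: power_mult_distrib ac_simps)
  moreover have "{n<..<Suc n} = {}" by auto
  ultimately show ?case by simp
qed simp

text \<open>The weights \<open>m i\<close> will be max 1 |root| and are unbounded, so each factor is
  measured relative to its weight. All relative factors are at most B and one is at most \<epsilon>;
  since the weights multiply to a power of their total product, one small pair makes the whole
  product small.\<close>

lemma prod_pairs_le:
  fixes m :: "nat \<Rightarrow> real" and s :: "nat \<Rightarrow> nat \<Rightarrow> real"
  assumes m: "\<And>i. i < n \<Longrightarrow> m i \<ge> 1"
    and s0: "\<And>i j. i < j \<Longrightarrow> j < n \<Longrightarrow> 0 \<le> s i j"
    and s: "\<And>i j. i < j \<Longrightarrow> j < n \<Longrightarrow> s i j \<le> B * (m i * m j) ^ d"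
    and p: "i0 < j0" "j0 < n" "s i0 j0 \<le> \<epsilon> * (m i0 * m j0) ^ d" and B: "B \<ge> 1"
  shows "(\<Prod>i<n. \<Prod>j\<in>{i<..<n}. s i j) \<le> \<epsilon> * B ^ (n * n) * (\<Prod>i<n. m i) ^ ((n - 1) * d)"
proof -
  define P where "P = (SIGMA i:{..<n}. {i<..<n})"
  define r where "r = (\<lambda>(i,j). s i j / (m i * m j) ^ d)"
  have fin: "finite P" unfolding P_def by auto
  have pos: "m i * m j > 0" if "i < j" "j < n" for i j
    using m[of i] m[of j] that by (auto intro!: mult_pos_pos)
  have ppos: "(m i * m j) ^ d > 0" if "i < j" "j < n" for i j
    using pos[OF that] by simp
  have r0: "0 \<le> r z" and rB: "r z \<le> B" if z: "z \<in> P" for z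
  proof -
    obtain i j where ij: "z = (i,j)" "i < j" "j < n" using z unfolding P_def by auto
    show "0 \<le> r z" using s0[OF ij(2,3)] ppos[OF ij(2,3)] by (simp add: ij(1) r_def)
    show "r z \<le> B" using s[OF ij(2,3)] ppos[OF ij(2,3)] by (simp add: ij(1) r_def pos_divide_le_eq)
  qed
  have z0: "(i0, j0) \<in> P" using p unfolding P_def by auto
  have re: "r (i0,j0) \<le> \<epsilon>" using p(3) ppos[OF p(1,2)] by (simp add: r_def pos_divide_le_eq)
  have e0: "\<epsilon> \<ge> 0" using re r0[OF z0] by linarith
  have "card P \<le> card ({..<n} \<times> {..<n})" unfolding P_def by (rule card_mono) auto
  then have cP: "card P \<le> n * n" by simp
  have "prod r P = r (i0,j0) * prod r (P - {(i0,j0)})"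
    by (rule prod.remove[OF fin z0])
  also have "\<dots> \<le> \<epsilon> * B ^ card (P - {(i0,j0)})"
  proof (rule mult_mono)
    have "prod r (P - {(i0,j0)}) \<le> prod (\<lambda>_. B) (P - {(i0,j0)})"
      by (rule prod_mono) (use r0 rB in auto)
    then show "prod r (P - {(i0,j0)}) \<le> B ^ card (P - {(i0,j0)})" by simp
    show "0 \<le> prod r (P - {(i0,j0)})" by (rule prod_nonneg) (use r0 in auto)
  qed (use re e0 in auto)
  also have "\<dots> \<le> \<epsilon> * B ^ (n*n)"
  proof (rule mult_left_mono[OF power_increasing])
    show "card (P - {(i0, j0)}) \<le> n * n" using cP card_Diff1_le[of P "(i0,j0)"] by linarith
  qed (use e0 B in auto)
  finally have rr: "prod r P \<le> \<epsilon> * B ^ (n*n)" .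
  have "(\<Prod>i<n. \<Prod>j\<in>{i<..<n}. s i j) = (\<Prod>(i,j)\<in>P. s i j)"
    unfolding P_def by (rule prod.Sigma) auto
  also have "\<dots> = (\<Prod>z\<in>P. r z * (case z of (i,j) \<Rightarrow> (m i * m j) ^ d))"
  proof (rule prod.cong)
    fix z assume "z \<in> P"
    then obtain i j where ij: "z = (i,j)" "i < j" "j < n" unfolding P_def by auto
    show "(case z of (i,j) \<Rightarrow> s i j) = r z * (case z of (i,j) \<Rightarrow> (m i * m j) ^ d)"
    proof -
      have "x = x / X * X" if "X > 0" for x X :: real using that by simp
      from this[OF ppos[OF ij(2,3)]] show ?thesis unfolding ij(1) r_def case_prod_conv .
    qed
  qed simp
  also have "\<dots> = prod r P * (\<Prod>(i,j)\<in>P. (m i * m j) ^ d)" by (rule prod.distrib)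
  also have "(\<Prod>(i,j)\<in>P. (m i * m j) ^ d) = (\<Prod>i<n. \<Prod>j\<in>{i<..<n}. (m i * m j) ^ d)"
    unfolding P_def by (rule prod.Sigma[symmetric]) auto
  also have "\<dots> = (\<Prod>i<n. \<Prod>j\<in>{i<..<n}. m i * m j) ^ d"
    by (simp only: prod_power_distrib)
  also have "\<dots> = ((\<Prod>i<n. m i) ^ (n - 1)) ^ d"
    by (simp only: prod_pairs_mult)
  also have "\<dots> = (\<Prod>i<n. m i) ^ ((n - 1) * d)" by (simp add: power_mult)
  also have "prod r P * \<dots> \<le> (\<epsilon> * B ^ (n*n)) * (\<Prod>i<n. m i) ^ ((n - 1) * d)"
    by (rule mult_right_mono[OF rr]) (intro zero_le_power prod_nonneg, meson m lessThan_iff order.trans zero_le_one)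
  finally show ?thesis .
qed

text \<open>Dividing out a linear factor from the side on which it is dominated, the lowest coefficient
  if the root is large and the leading one if it is small, controls the quotient.\<close>
lemma coeff_linear_cofactor_le:
  fixes r :: "complex poly"
  assumes "degree r \<le> n"
  shows "max 1 (cmod a) * cmod (coeff r k) \<le> (\<Sum>i\<le>Suc n. cmod (coeff ([:-a, 1:] * r) i))"
proof -
  let ?q = "[:-a, 1:] * r"
  let ?S = "\<Sum>i\<le>Suc n. cmod (coeff ?q i)"
  have q0: "coeff ?q 0 = - a * coeff r 0" by simp
  have qS: "coeff ?q (Suc i) = coeff r i - a * coeff r (Suc i)" for i by simp
  have S0: "?S \<ge> 0" by (intro sum_nonneg) auto
  show ?thesis
  proof (cases "cmod a \<ge> 1")
    case True
    have *: "cmod a * cmod (coeff r k) \<le> (\<Sum>i\<le>k. cmod (coeff ?q i))" for k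
    proof (induction k)
      case 0
      then show ?case by (simp add: norm_mult)
    next
      case (Suc k)
      have "cmod (coeff r k) \<le> cmod a * cmod (coeff r k)"
        using True by (simp add: mult_le_cancel_right1)
      then have "cmod (coeff r k) \<le> (\<Sum>i\<le>k. cmod (coeff ?q i))" using Suc by linarith
      moreover have "cmod a * cmod (coeff r (Suc k)) = cmod (coeff r k - coeff ?q (Suc k))"
        unfolding qS by (simp add: norm_mult)
      moreover have "\<dots> \<le> cmod (coeff r k) + cmod (coeff ?q (Suc k))" by (rule norm_triangle_ineq4)
      ultimately show ?case by simp
    qed
    show ?thesis
    proof (cases "k \<le> n")
      case k: True
      have "(\<Sum>i\<le>k. cmod (coeff ?q i)) \<le> ?S"
        by (rule sum_mono2) (use k in auto)
      then show ?thesis using *[of k] True by (simp add: max_def)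
    next
      case False
      then have "coeff r k = 0" using assms by (intro coeff_eq_0) auto
      then show ?thesis using S0 by simp
    qed
  next
    case False
    have *: "cmod (coeff r k) \<le> (\<Sum>i\<in>{k<..Suc n}. cmod (coeff ?q i))" if "k \<le> Suc n" for k
      using that
    proof (induction k rule: inc_induct)
      case base
      have "coeff r (Suc n) = 0" using assms by (intro coeff_eq_0) auto
      then show ?case by simp
    next
      case (step k)
      have "cmod a * cmod (coeff r (Suc k)) \<le> cmod (coeff r (Suc k))"
        using False by (simp add: mult_le_cancel_right2)
      moreover have "cmod (coeff r k) = cmod (a * coeff r (Suc k) + coeff ?q (Suc k))"
        unfolding qS by simp
      moreover have "\<dots> \<le> cmod (a * coeff r (Suc k)) + cmod (coeff ?q (Suc k))" by (rule norm_triangle_ineq)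
      moreover have "{k<..Suc n} = insert (Suc k) {Suc k<..Suc n}" using step by auto
      ultimately show ?case using step.IH by (simp add: norm_mult)
    qed
    show ?thesis
    proof (cases "k \<le> Suc n")
      case k: True
      have "(\<Sum>i\<in>{k<..Suc n}. cmod (coeff ?q i)) \<le> ?S"
        by (rule sum_mono2) auto
      then show ?thesis using *[OF k] False by (simp add: max_def)
    next
      case k: False
      then have "coeff r k = 0" using assms by (intro coeff_eq_0) auto
      then show ?thesis using S0 by simp
    qed
  qed
qed

text \<open>The left side is the Mahler measure. Splitting off one root costs a factor bounded by
  the number of coefficients, so a factorial accumulates; only its independence of the roots
  matters.\<close>

lemma prod_max_roots_le:
  "(\<Prod>a\<leftarrow>as. max 1 (cmod a)) * cmod c
    \<le> real (fact (Suc (length as))) * (\<Sum>i\<le>length as. cmod (coeff (smult c (\<Prod>a\<leftarrow>as. [:-a, 1:])) i))"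
proof (induction as)
  case (Cons a as)
  let ?n = "length as"
  let ?r = "smult c (\<Prod>a\<leftarrow>as. [:-a, 1:])"
  let ?q = "smult c (\<Prod>a\<leftarrow>a # as. [:-a, 1:])"
  have q: "?q = [:-a, 1:] * ?r" by (simp only: list.map prod_list.Cons mult_smult_right)
  have "degree ?r \<le> ?n"
    by (rule order.trans[OF degree_smult_le]) (simp only: monic_prod_linear(1) order_refl)
  note b = coeff_linear_cofactor_le[OF this, of a, folded q]
  have "(\<Prod>a\<leftarrow>a # as. max 1 (cmod a)) * cmod c
      = max 1 (cmod a) * ((\<Prod>a\<leftarrow>as. max 1 (cmod a)) * cmod c)" by simp
  also have "\<dots> \<le> max 1 (cmod a) * (real (fact (Suc ?n)) * (\<Sum>i\<le>?n. cmod (coeff ?r i)))"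
    by (rule mult_left_mono[OF Cons.IH]) simp
  also have "\<dots> = real (fact (Suc ?n)) * (\<Sum>i\<le>?n. max 1 (cmod a) * cmod (coeff ?r i))"
    by (simp only: sum_distrib_left mult.left_commute)
  also have "\<dots> \<le> real (fact (Suc ?n)) * (\<Sum>i\<le>?n. (\<Sum>i\<le>Suc ?n. cmod (coeff ?q i)))"
    by (intro mult_left_mono sum_mono b) simp
  also have "\<dots> = real (fact (Suc ?n)) * (real (Suc ?n) * (\<Sum>i\<le>Suc ?n. cmod (coeff ?q i)))"
    by (simp only: sum_constant card_atMost)
  also have "\<dots> \<le> real (fact (Suc ?n)) * (real (Suc (Suc ?n)) * (\<Sum>i\<le>Suc ?n. cmod (coeff ?q i)))"
    by (intro mult_left_mono mult_right_mono sum_nonneg) auto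
  also have "\<dots> = real (fact (Suc (Suc ?n))) * (\<Sum>i\<le>Suc ?n. cmod (coeff ?q i))"
    by (simp only: fact_Suc of_nat_mult mult.assoc mult.left_commute of_nat_fact of_nat_id)
  finally show ?case by (simp only: list.size add_Suc_right add_0_right)
qed simp

text \<open>The converse estimate: each linear factor contributes at most |a| + 1, which is at most
  2 max 1 |a|.\<close>

lemma coeff_le_prod_max_roots:
  "cmod (coeff (\<Prod>a\<leftarrow>as. [:-a, 1:]) k) \<le> 2 ^ length as * (\<Prod>a\<leftarrow>as. max 1 (cmod a))"
proof (induction as arbitrary: k)
  case (Cons a as)
  let ?r = "\<Prod>a\<leftarrow>as. [:-a, 1:]"
  let ?B = "2 ^ length as * (\<Prod>a\<leftarrow>as. max 1 (cmod a))"
  have B0: "?B \<ge> 0" using Cons[of 0] norm_ge_zero order_trans by blast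
  have "coeff (\<Prod>a\<leftarrow>a # as. [:-a, 1:]) k = (if k = 0 then 0 else coeff ?r (k - 1)) - a * coeff ?r k"
    by (cases k) auto
  then have "cmod (coeff (\<Prod>a\<leftarrow>a # as. [:-a, 1:]) k) \<le> cmod (if k = 0 then 0 else coeff ?r (k - 1)) + cmod a * cmod (coeff ?r k)"
    using norm_triangle_ineq4[of "if k = 0 then 0 else coeff ?r (k - 1)" "a * coeff ?r k"] by (simp only: norm_mult)
  also have "\<dots> \<le> ?B + cmod a * ?B"
    by (intro add_mono mult_left_mono Cons.IH) (use Cons.IH B0 in auto)
  also have "\<dots> \<le> 2 * max 1 (cmod a) * ?B"
  proof -
    have "(1 + cmod a) * ?B \<le> (2 * max 1 (cmod a)) * ?B"
      by (rule mult_right_mono[OF _ B0]) (simp add: max_def)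
    then show ?thesis by (simp only: distrib_right mult_1_left)
  qed
  finally show ?case by (simp add: mult_ac)
qed (simp add: coeff_1)

section \<open>Roots of F + t x^n as t tends to 0\<close>

lemma degree_add_monom:
  fixes F :: "'a::comm_ring_1 poly"
  assumes "degree F < n" "t \<noteq> 0"
  shows "degree (F + monom t n) = n"
  using assms by (simp add: degree_add_eq_right degree_monom_eq)

lemma degree_of_real_poly: "degree (map_poly complex_of_real F) = degree F"
  by (rule degree_map_poly) simp

lemma coeff_of_real_poly: "coeff (map_poly complex_of_real F) i = complex_of_real (coeff F i)"
  by (simp add: coeff_map_poly)

context
  fixes F :: "real poly" and n :: nat and r :: "real \<Rightarrow> nat \<Rightarrow> complex"
  assumes degF: "degree F < n"
  defines "r \<equiv> \<lambda>t i. croots (map_poly complex_of_real (F + monom t n)) ! i"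
begin

lemma perturbed_props:
  assumes "t \<noteq> 0"
  defines "q \<equiv> map_poly complex_of_real (F + monom t n)"
  shows "degree q = n" "lead_coeff q = of_real t" "length (croots q) = n"
    "q = smult (of_real t) (\<Prod>a\<leftarrow>croots q. [:-a, 1:])"
    "coeff q i = of_real (coeff F i + (if i = n then t else 0))"
proof -
  show d: "degree q = n" unfolding q_def degree_of_real_poly
    using degree_add_monom[OF degF assms(1)] .
  show c: "coeff q i = of_real (coeff F i + (if i = n then t else 0))" for i
    unfolding q_def coeff_of_real_poly by simp
  show l: "lead_coeff q = of_real t" unfolding d c using degF by (simp add: coeff_eq_0)
  show "length (croots q) = n" using length_croots[of q] d by simp
  show "q = smult (of_real t) (\<Prod>a\<leftarrow>croots q. [:-a, 1:])"
    using croots_factorization[of q] unfolding l .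
qed

text \<open>The Mahler measure is controlled by the coefficients, which stay bounded for |t| at most
  1, although individual roots escape to infinity.\<close>

lemma perturbed_measure_le:
  "\<exists>C>0. \<forall>t. t \<noteq> 0 \<and> \<bar>t\<bar> \<le> 1 \<longrightarrow> \<bar>t\<bar> * (\<Prod>i<n. max 1 (cmod (r t i))) \<le> C"
proof (intro exI conjI allI impI)
  let ?C = "real (fact (Suc n)) * ((\<Sum>i\<le>n. \<bar>coeff F i\<bar>) + 1)"
  have "real (fact (Suc n)) > 0" by (simp only: of_nat_0_less_iff fact_gt_zero)
  then show "?C > 0" by (intro mult_pos_pos add_nonneg_pos sum_nonneg) auto
  fix t :: real assume t: "t \<noteq> 0 \<and> \<bar>t\<bar> \<le> 1"
  define q where "q = map_poly complex_of_real (F + monom t n)"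
  note p = perturbed_props[of t, folded q_def]
  have "(\<Prod>a\<leftarrow>croots q. max 1 (cmod a)) * cmod (of_real t)
      \<le> real (fact (Suc n)) * (\<Sum>i\<le>n. cmod (coeff q i))"
    using prod_max_roots_le[of "croots q" "of_real t"] p(3,4) t by metis
  also have "(\<Prod>a\<leftarrow>croots q. max 1 (cmod a)) = (\<Prod>i<n. max 1 (cmod (r t i)))"
    using p(3) t by (simp add: prod_list_map_nth r_def q_def)
  finally have 1: "\<bar>t\<bar> * (\<Prod>i<n. max 1 (cmod (r t i))) \<le> real (fact (Suc n)) * (\<Sum>i\<le>n. cmod (coeff q i))"
    by (simp only: norm_of_real mult.commute[of "\<bar>t\<bar>"])
  have "(\<Sum>i\<le>n. cmod (coeff q i)) \<le> (\<Sum>i\<le>n. \<bar>coeff F i\<bar> + (if i = n then 1 else 0))"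
  proof (rule sum_mono)
    fix i assume "i \<in> {..n}"
    have "cmod (coeff q i) = \<bar>coeff F i + (if i = n then t else 0)\<bar>"
      by (simp only: p(5)[OF conjunct1[OF t]] norm_of_real)
    also have "\<dots> \<le> \<bar>coeff F i\<bar> + (if i = n then 1 else 0)" using t by auto
    finally show "cmod (coeff q i) \<le> \<bar>coeff F i\<bar> + (if i = n then 1 else 0)" .
  qed
  also have "\<dots> = (\<Sum>i\<le>n. \<bar>coeff F i\<bar>) + 1" by (simp add: sum.distrib)
  finally show "\<bar>t\<bar> * (\<Prod>i<n. max 1 (cmod (r t i))) \<le> ?C"
    by (rule order.trans[OF 1 mult_left_mono]) simp
qed

text \<open>The leading coefficient of F survives the perturbation and is at most 2^n times the
  Mahler measure. Hence the product of the root weights must grow at least like 1/|t|.\<close>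

lemma perturbed_measure_ge:
  assumes "F \<noteq> 0"
  shows "\<exists>c>0. \<forall>t. t \<noteq> 0 \<longrightarrow> c \<le> \<bar>t\<bar> * (\<Prod>i<n. max 1 (cmod (r t i)))"
proof (intro exI conjI allI impI)
  let ?c = "\<bar>lead_coeff F\<bar> / 2 ^ n"
  show "?c > 0" using assms by simp
  fix t :: real assume t: "t \<noteq> 0"
  define q where "q = map_poly complex_of_real (F + monom t n)"
  note p = perturbed_props[OF t, folded q_def]
  let ?P = "\<Prod>a\<leftarrow>croots q. [:-a, 1:]"
  have "cmod (coeff q (degree F)) = \<bar>t\<bar> * cmod (coeff ?P (degree F))"
    by (subst p(4)) (simp add: norm_mult)
  also have "\<dots> \<le> \<bar>t\<bar> * (2 ^ n * (\<Prod>a\<leftarrow>croots q. max 1 (cmod a)))"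
    using coeff_le_prod_max_roots[of "croots q" "degree F"] p(3) by (intro mult_left_mono) auto
  also have "(\<Prod>a\<leftarrow>croots q. max 1 (cmod a)) = (\<Prod>i<n. max 1 (cmod (r t i)))"
    using p(3) by (simp add: prod_list_map_nth r_def q_def)
  also have "cmod (coeff q (degree F)) = \<bar>lead_coeff F\<bar>"
    unfolding p(5) using degF by (simp only: norm_of_real) simp
  finally show "?c \<le> \<bar>t\<bar> * (\<Prod>i<n. max 1 (cmod (r t i)))" by (simp add: field_simps)
qed

text \<open>In the product over pairs every root weight occurs with exponent (n - 1) d, which is
  exactly the exponent of t in front. The powers of t therefore combine with the weights to a power
  of the bounded Mahler measure, and one relatively small pair sends the whole expression to
  0.\<close>

lemma perturbed_formula_tendsto_0:
  fixes s :: "complex \<Rightarrow> complex \<Rightarrow> complex"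
  assumes sB: "\<And>a b. cmod (s a b) \<le> B * (max 1 (cmod a) * max 1 (cmod b)) ^ d"
    and sym: "\<And>a b. cmod (s a b) = cmod (s b a)"
    and close: "\<And>\<epsilon>. \<epsilon> > 0 \<Longrightarrow> \<exists>\<delta>>0. \<forall>t. t \<noteq> 0 \<and> \<bar>t\<bar> < \<delta> \<longrightarrow>
      (\<exists>i<n. \<exists>j<n. i \<noteq> j \<and> cmod (s (r t i) (r t j)) \<le> \<epsilon> * (max 1 (cmod (r t i)) * max 1 (cmod (r t j))) ^ d)"
  shows "((\<lambda>t. Re (complex_of_real t ^ ((n - 1) * d) * (\<Prod>i<n. \<Prod>j\<in>{i<..<n}. s (r t i) (r t j)))) \<longlongrightarrow> 0) (at 0)"
proof -
  define B' where "B' = max 1 B"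
  have sB': "cmod (s a b) \<le> B' * (max 1 (cmod a) * max 1 (cmod b)) ^ d" for a b
  proof -
    have "B * (max 1 (cmod a) * max 1 (cmod b)) ^ d \<le> B' * (max 1 (cmod a) * max 1 (cmod b)) ^ d"
      by (rule mult_right_mono) (simp_all add: B'_def)
    then show ?thesis using sB[of a b] by linarith
  qed
  obtain C where C: "C > 0" "\<And>t. t \<noteq> 0 \<Longrightarrow> \<bar>t\<bar> \<le> 1 \<Longrightarrow> \<bar>t\<bar> * (\<Prod>i<n. max 1 (cmod (r t i))) \<le> C"
    using perturbed_measure_le by blast
  define N where "N = (n - 1) * d"
  define K where "K = B' ^ (n * n) * C ^ N"
  have K: "K > 0" unfolding K_def B'_def using C by (intro mult_pos_pos zero_less_power) auto
  show ?thesis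
    unfolding N_def[symmetric]
  proof (rule LIM_I)
    fix e :: real assume e: "e > 0"
    define \<epsilon> where "\<epsilon> = e / (2 * K)"
    have \<epsilon>: "\<epsilon> > 0" using e K by (simp add: \<epsilon>_def)
    obtain \<delta> where \<delta>: "\<delta> > 0" "\<And>t. t \<noteq> 0 \<Longrightarrow> \<bar>t\<bar> < \<delta> \<Longrightarrow> \<exists>i<n. \<exists>j<n. i \<noteq> j \<and>
        cmod (s (r t i) (r t j)) \<le> \<epsilon> * (max 1 (cmod (r t i)) * max 1 (cmod (r t j))) ^ d"
      using close[OF \<epsilon>] by blast
    have main: "norm (Re (complex_of_real t ^ N * (\<Prod>i<n. \<Prod>j\<in>{i<..<n}. s (r t i) (r t j)))) < e"
      if t: "t \<noteq> 0" "\<bar>t\<bar> < min \<delta> 1" for t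
    proof -
      obtain i j where ij: "i < n" "j < n" "i \<noteq> j"
        "cmod (s (r t i) (r t j)) \<le> \<epsilon> * (max 1 (cmod (r t i)) * max 1 (cmod (r t j))) ^ d"
        using \<delta>(2)[of t] t by auto
      obtain i0 j0 where ij0: "i0 < j0" "j0 < n"
        "cmod (s (r t i0) (r t j0)) \<le> \<epsilon> * (max 1 (cmod (r t i0)) * max 1 (cmod (r t j0))) ^ d"
      proof (cases "i < j")
        case True
        then show ?thesis using that ij by blast
      next
        case False
        then have "j < i" using ij by auto
        then show ?thesis using that[of j i] ij sym[of "r t i" "r t j"] by (simp add: mult.commute)
      qed
      let ?M = "\<Prod>i<n. max 1 (cmod (r t i))"
      have M0: "?M \<ge> 0" by (intro prod_nonneg) auto
      have b: "(\<Prod>i<n. \<Prod>j\<in>{i<..<n}. cmod (s (r t i) (r t j))) \<le> \<epsilon> * B' ^ (n * n) * ?M ^ N"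
        unfolding N_def
        by (rule prod_pairs_le[where m = "\<lambda>i. max 1 (cmod (r t i))" and s = "\<lambda>i j. cmod (s (r t i) (r t j))", OF _ _ _ ij0])
          (use sB' in \<open>auto simp: B'_def\<close>)
      have "\<bar>Re (complex_of_real t ^ N * (\<Prod>i<n. \<Prod>j\<in>{i<..<n}. s (r t i) (r t j)))\<bar>
         \<le> cmod (complex_of_real t ^ N * (\<Prod>i<n. \<Prod>j\<in>{i<..<n}. s (r t i) (r t j)))"
        by (rule abs_Re_le_cmod)
      also have "\<dots> = \<bar>t\<bar> ^ N * (\<Prod>i<n. \<Prod>j\<in>{i<..<n}. cmod (s (r t i) (r t j)))"
        by (simp only: norm_mult norm_power norm_of_real prod_norm[symmetric])
      also have "\<dots> \<le> \<bar>t\<bar> ^ N * (\<epsilon> * B' ^ (n * n) * ?M ^ N)"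
        by (rule mult_left_mono[OF b]) simp
      also have "\<dots> = \<epsilon> * B' ^ (n * n) * (\<bar>t\<bar> * ?M) ^ N"
        by (simp only: power_mult_distrib mult.assoc mult.left_commute mult.commute)
      also have "\<dots> \<le> \<epsilon> * B' ^ (n * n) * C ^ N"
        by (intro mult_left_mono power_mono C) (use t \<epsilon> M0 in \<open>auto simp: B'_def\<close>)
      also have "\<dots> = \<epsilon> * K" by (simp only: K_def mult.assoc)
      also have "\<dots> = e / 2" using K by (simp add: \<epsilon>_def)
      also have "\<dots> < e" using e by simp
      finally show ?thesis by simp
    qed
    show "\<exists>s'>0. \<forall>t. t \<noteq> 0 \<and> norm (t - 0) < s' \<longrightarrow>
       norm (Re (complex_of_real t ^ N * (\<Prod>i<n. \<Prod>j\<in>{i<..<n}. s (r t i) (r t j))) - 0) < e"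
      by (rule exI[of _ "min \<delta> 1"]) (use main \<delta> in auto)
  qed
qed

text \<open>The vanishing coefficient of x^(n-1) makes the roots sum to 0, so a single large root
  cannot be balanced by small ones. If fewer than two roots reached K, all would be at most nK,
  against the lower bound for the Mahler measure.\<close>

lemma perturbed_two_large_roots:
  assumes "F \<noteq> 0" "coeff F (n - 1) = 0" "n \<ge> 2" "K \<ge> 1"
  shows "\<exists>\<delta>>0. \<forall>t. t \<noteq> 0 \<and> \<bar>t\<bar> < \<delta> \<longrightarrow>
    (\<exists>i<n. \<exists>j<n. i \<noteq> j \<and> K \<le> cmod (r t i) \<and> K \<le> cmod (r t j))"
proof -
  obtain c where c: "c > 0" "\<And>t. t \<noteq> 0 \<Longrightarrow> c \<le> \<bar>t\<bar> * (\<Prod>i<n. max 1 (cmod (r t i)))"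
    using perturbed_measure_ge[OF assms(1)] by blast
  let ?L = "real n * K"
  have L: "?L \<ge> 1" "?L \<ge> K" using assms(3,4) mult_mono[of 1 "real n" 1 K] mult_right_mono[of 1 "real n" K] by auto
  show ?thesis
  proof (rule exI[of _ "c / ?L ^ n"], intro conjI allI impI)
    show "c / ?L ^ n > 0" using c L by simp
    fix t assume t: "t \<noteq> 0 \<and> \<bar>t\<bar> < c / ?L ^ n"
    show "\<exists>i<n. \<exists>j<n. i \<noteq> j \<and> K \<le> cmod (r t i) \<and> K \<le> cmod (r t j)"
    proof (rule ccontr)
      assume no: "\<not> ?thesis"
      define q where "q = map_poly complex_of_real (F + monom t n)"
      have p: "length (croots q) = n" "q = smult (of_real t) (\<Prod>a\<leftarrow>croots q. [:-a, 1:])"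
        "coeff q (n - 1) = of_real (coeff F (n-1) + (if n - 1 = n then t else 0))"
        using perturbed_props[of t] t unfolding q_def by blast+
      have "coeff q (n - 1) = of_real t * coeff (\<Prod>a\<leftarrow>croots q. [:-a, 1:]) (n - 1)"
        by (subst p(2)) simp
      also have "coeff (\<Prod>a\<leftarrow>croots q. [:-a, 1:]) (n - 1) = - sum_list (croots q)"
      proof -
        have "croots q \<noteq> []" using p(1) assms(3) by auto
        from coeff_prod_linear[OF this] show ?thesis unfolding p(1) .
      qed
      finally have sq: "coeff q (n - 1) = of_real t * - sum_list (croots q)" .
      have "n - 1 \<noteq> n" using assms(3) by linarith
      then have "coeff q (n - 1) = 0" by (simp only: p(3) if_not_P assms(2)) simp
      then have "complex_of_real t * sum_list (croots q) = 0" unfolding sq by simp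
      then have "sum_list (croots q) = 0" using t by simp
      then have s0: "(\<Sum>i<n. r t i) = 0"
        using p(1) by (simp add: sum_list_sum_nth atLeast0LessThan r_def q_def)
      \<comment> \<open>A root that reaches K is minus the sum of the n - 1 others, each at most
        K.\<close>
      have le: "cmod (r t i) \<le> ?L" if i: "i < n" for i
      proof (cases "cmod (r t i) < K")
        case True
        then show ?thesis using L by linarith
      next
        case False
        then have *: "cmod (r t j) \<le> K" if "j < n" "j \<noteq> i" for j
          using no that i by (meson less_imp_le not_le)
        have "(\<Sum>i<n. r t i) = r t i + (\<Sum>j\<in>{..<n}-{i}. r t j)"
          by (rule sum.remove) (use i in auto)
        then have "r t i = - (\<Sum>j\<in>{..<n}-{i}. r t j)" using s0 by (simp add: eq_neg_iff_add_eq_0)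
        then have "cmod (r t i) = cmod (\<Sum>j\<in>{..<n}-{i}. r t j)" by simp
        also have "\<dots> \<le> (\<Sum>j\<in>{..<n}-{i}. K)"
          by (rule order.trans[OF norm_sum sum_mono]) (use * in auto)
        also have "\<dots> \<le> ?L" using i assms(4) by (simp add: mult_right_mono)
        finally show ?thesis .
      qed
      have "(\<Prod>i<n. max 1 (cmod (r t i))) \<le> (\<Prod>i<n. ?L)"
        by (rule prod_mono) (use le L in auto)
      then have "\<bar>t\<bar> * (\<Prod>i<n. max 1 (cmod (r t i))) \<le> \<bar>t\<bar> * ?L ^ n" by (intro mult_left_mono) auto
      also have "\<dots> < c" using t L by (simp add: pos_less_divide_eq)
      finally show False using c(2)[of t] t by auto
    qed
  qed
qed

text \<open>The perturbed polynomial takes the value t \<alpha>^n at \<alpha>, so the distances from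
  \<alpha> to the roots multiply to |\<alpha>|^n. If all of them were at least \<eta>, each root
  weight would be at most a constant times its distance and the Mahler measure would tend to 0 with
  t.\<close>

lemma perturbed_root_near:
  assumes "F \<noteq> 0" "poly (map_poly complex_of_real F) \<alpha> = 0" "\<eta> > 0"
  shows "\<exists>\<delta>>0. \<forall>t. t \<noteq> 0 \<and> \<bar>t\<bar> < \<delta> \<longrightarrow> (\<exists>i<n. cmod (r t i - \<alpha>) < \<eta>)"
proof -
  obtain c where c: "c > 0" "\<And>t. t \<noteq> 0 \<Longrightarrow> c \<le> \<bar>t\<bar> * (\<Prod>i<n. max 1 (cmod (r t i)))"
    using perturbed_measure_ge[OF assms(1)] by blast
  \<comment> \<open>Chosen so that 1 + |\<alpha>| + d is at most \<kappa> d for every distance d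
    \<ge> \<eta>. The summand 1 in \<open>L\<close> keeps it positive when \<alpha> = 0.\<close>
  define \<kappa> where "\<kappa> = (1 + cmod \<alpha>) / \<eta> + 1"
  define L where "L = (\<kappa> * (1 + cmod \<alpha>)) ^ n"
  have k: "\<kappa> > 0" unfolding \<kappa>_def using assms(3) by (intro add_nonneg_pos divide_nonneg_pos) auto
  have k1: "1 + cmod \<alpha> > 0" using norm_ge_zero[of \<alpha>] by linarith
  have L: "L > 0" unfolding L_def using k k1 by simp
  show ?thesis
  proof (rule exI[of _ "c / L"], intro conjI allI impI)
    show "c / L > 0" using c L by simp
    fix t assume t: "t \<noteq> 0 \<and> \<bar>t\<bar> < c / L"
    show "\<exists>i<n. cmod (r t i - \<alpha>) < \<eta>"
    proof (rule ccontr)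
      assume "\<not> ?thesis"
      then have ge: "cmod (\<alpha> - r t i) \<ge> \<eta>" if "i < n" for i
      proof -
        have "\<not> cmod (r t i - \<alpha>) < \<eta>" using \<open>\<not> (\<exists>i<n. cmod (r t i - \<alpha>) < \<eta>)\<close> that by blast
        then show ?thesis by (simp add: norm_minus_commute)
      qed
      define q where "q = map_poly complex_of_real (F + monom t n)"
      have p: "degree q = n" "lead_coeff q = of_real t"
        using perturbed_props[of t] t unfolding q_def by blast+
      have "q = map_poly complex_of_real F + monom (of_real t) n"
        unfolding q_def by (intro poly_eqI) (simp add: coeff_of_real_poly)
      then have "poly q \<alpha> = of_real t * \<alpha> ^ n" using assms(2) by (simp add: poly_monom)
      moreover have "poly q \<alpha> = of_real t * (\<Prod>i<n. \<alpha> - r t i)"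
        using poly_croots[of q \<alpha>] unfolding p(2) unfolding p(1) by (simp add: r_def q_def)
      ultimately have eq: "(\<Prod>i<n. cmod (\<alpha> - r t i)) = cmod \<alpha> ^ n"
        using t by (simp add: prod_norm norm_power)
      have "(\<Prod>i<n. max 1 (cmod (r t i))) \<le> (\<Prod>i<n. \<kappa> * cmod (\<alpha> - r t i))"
      proof (rule prod_mono)
        fix i assume i: "i \<in> {..<n}"
        have "cmod (r t i) \<le> cmod \<alpha> + cmod (\<alpha> - r t i)"
          using norm_triangle_ineq4[of \<alpha> "\<alpha> - r t i"] by simp
        then have "cmod (r t i) \<le> (1 + cmod \<alpha>) * 1 + cmod (\<alpha> - r t i)" by simp
        moreover have "1 \<le> (1 + cmod \<alpha>) * 1 + cmod (\<alpha> - r t i)" by simp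
        ultimately have "max 1 (cmod (r t i)) \<le> (1 + cmod \<alpha>) * 1 + cmod (\<alpha> - r t i)" by simp
        also have "\<dots> \<le> (1 + cmod \<alpha>) * (cmod (\<alpha> - r t i) / \<eta>) + cmod (\<alpha> - r t i)"
          by (intro add_mono mult_left_mono) (use ge i assms(3) k1 in \<open>auto simp: pos_le_divide_eq\<close>)
        also have "\<dots> = \<kappa> * cmod (\<alpha> - r t i)" by (simp add: \<kappa>_def algebra_simps)
        finally show "0 \<le> max 1 (cmod (r t i)) \<and> max 1 (cmod (r t i)) \<le> \<kappa> * cmod (\<alpha> - r t i)" by simp
      qed
      also have "\<dots> = \<kappa> ^ n * cmod \<alpha> ^ n" by (simp add: prod.distrib eq)
      also have "\<dots> \<le> L" unfolding L_def power_mult_distrib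
        by (intro mult_left_mono power_mono) (use k in auto)
      finally have "\<bar>t\<bar> * (\<Prod>i<n. max 1 (cmod (r t i))) \<le> \<bar>t\<bar> * L" by (intro mult_left_mono) auto
      also have "\<dots> < c" using t L by (simp add: pos_less_divide_eq)
      finally show False using c(2)[of t] t by auto
    qed
  qed
qed

end

text \<open>As a binary form F has a double root at infinity. Two roots a, b of the perturbed
  polynomial escape, and relative to their weights their difference is |1/a - 1/b|, which tends to
  0.\<close>

lemma disc_eq_0_degenerate:
  assumes "degree F \<le> n" "coeff F n = 0" "coeff F (n - 1) = 0" "n \<ge> 2"
  shows "disc n F = 0"
proof -
  have d: "degree F < n"
    using assms by (metis le_neq_implies_less leading_coeff_0_iff degree_0 not_numeral_le_zero)
  define r where "r = (\<lambda>t i. croots (map_poly complex_of_real (F + monom t n)) ! i)"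
  have "((\<lambda>t. Re (complex_of_real t ^ ((n - 1) * 2) * (\<Prod>i<n. \<Prod>j\<in>{i<..<n}. (r t i - r t j) ^ 2))) \<longlongrightarrow> 0) (at 0)"
    unfolding r_def
  proof (rule perturbed_formula_tendsto_0[OF d, where s = "\<lambda>a b. (a - b) ^ 2" and B = 4 and d = 2])
    fix a b :: complex
    have "cmod (a - b) \<le> cmod a + cmod b" by (rule norm_triangle_ineq4)
    also have "\<dots> \<le> max 1 (cmod a) * max 1 (cmod b) + max 1 (cmod a) * max 1 (cmod b)"
      using mult_mono[of "cmod a" "max 1 (cmod a)" 1 "max 1 (cmod b)"]
        mult_mono[of 1 "max 1 (cmod a)" "cmod b" "max 1 (cmod b)"] by (intro add_mono) auto
    finally have "cmod (a - b) ^ 2 \<le> (2 * (max 1 (cmod a) * max 1 (cmod b))) ^ 2"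
      by (intro power_mono) auto
    then show "cmod ((a - b) ^ 2) \<le> 4 * (max 1 (cmod a) * max 1 (cmod b)) ^ 2"
      by (simp only: norm_power power_mult_distrib) simp
    show "cmod ((a - b) ^ 2) = cmod ((b - a) ^ 2)" by (simp add: norm_power norm_minus_commute)
  next
    fix \<epsilon> :: real assume \<epsilon>: "\<epsilon> > 0"
    show "\<exists>\<delta>>0. \<forall>t. t \<noteq> 0 \<and> \<bar>t\<bar> < \<delta> \<longrightarrow>
      (\<exists>i<n. \<exists>j<n. i \<noteq> j \<and>
         cmod ((croots (map_poly complex_of_real (F + monom t n)) ! i - croots (map_poly complex_of_real (F + monom t n)) ! j)\<^sup>2)
         \<le> \<epsilon> * (max 1 (cmod (croots (map_poly complex_of_real (F + monom t n)) ! i)) *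
                max 1 (cmod (croots (map_poly complex_of_real (F + monom t n)) ! j)))\<^sup>2)"
    proof (cases "F = 0")
      \<comment> \<open>For F = 0 there is no lower bound on the Mahler measure, but the
        perturbation is t x^n and all its roots are 0.\<close>
      case True
      have z: "croots (map_poly complex_of_real (F + monom t n)) ! i = 0" if "t \<noteq> 0" "i < n" for t i
      proof -
        define q where "q = map_poly complex_of_real (F + monom t n)"
        have p: "degree q = n" "lead_coeff q = of_real t"
          using perturbed_props[OF d, of t] that unfolding q_def by blast+
        have "q = monom (of_real t) n" unfolding q_def True
          by (intro poly_eqI) (simp add: coeff_of_real_poly)
        then have "of_real t * (croots q ! i) ^ n = poly q (croots q ! i)" by (simp add: poly_monom)
        also have "\<dots> = 0" using poly_croots[of q "croots q ! i"] that p by auto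
        finally show ?thesis using that by (simp add: q_def)
      qed
      show ?thesis
      proof (rule exI[of _ 1], intro conjI allI impI)
        fix t :: real assume t: "t \<noteq> 0 \<and> \<bar>t\<bar> < 1"
        show "\<exists>i<n. \<exists>j<n. i \<noteq> j \<and>
         cmod ((croots (map_poly complex_of_real (F + monom t n)) ! i - croots (map_poly complex_of_real (F + monom t n)) ! j)\<^sup>2)
         \<le> \<epsilon> * (max 1 (cmod (croots (map_poly complex_of_real (F + monom t n)) ! i)) *
                max 1 (cmod (croots (map_poly complex_of_real (F + monom t n)) ! j)))\<^sup>2"
          using z[of t 0] z[of t 1] t assms(4) \<epsilon> by (intro exI[of _ 0] conjI exI[of _ "1::nat"]) auto
      qed simp
    next
      case False
      \<comment> \<open>For roots of modulus at least K one has |a - b| \<le> 2 |a| |b| / K, so 4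
        \<le> \<epsilon> K^2 is what is needed after squaring.\<close>
      define K where "K = 1 + 4 / \<epsilon>"
      have K1: "K \<ge> 1" using \<epsilon> by (simp add: K_def)
      have "4 \<le> \<epsilon> * K" using \<epsilon> by (simp add: K_def field_simps)
      also have "\<dots> \<le> \<epsilon> * K ^ 2" using K1 \<epsilon> by (intro mult_left_mono) (auto simp: power2_eq_square)
      finally have K: "4 \<le> \<epsilon> * K ^ 2" .
      have key: "cmod ((a - b) ^ 2) \<le> \<epsilon> * (max 1 (cmod a) * max 1 (cmod b)) ^ 2"
        if "K \<le> cmod a" "K \<le> cmod b" for a b
      proof -
        have "K * cmod (a - b) \<le> K * cmod a + K * cmod b"
          using norm_triangle_ineq4[of a b] K1 by (simp flip: distrib_left)
        also have "\<dots> \<le> cmod b * cmod a + cmod a * cmod b"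
          using that by (intro add_mono mult_right_mono) auto
        finally have "(K * cmod (a - b)) ^ 2 \<le> (2 * (cmod a * cmod b)) ^ 2"
          using K1 by (intro power_mono) (auto simp: mult.commute)
        then have "K ^ 2 * cmod (a - b) ^ 2 \<le> 4 * (cmod a * cmod b) ^ 2" by (simp add: power_mult_distrib)
        also have "\<dots> \<le> (\<epsilon> * K ^ 2) * (cmod a * cmod b) ^ 2" using K by (intro mult_right_mono) auto
        finally have "cmod (a - b) ^ 2 \<le> \<epsilon> * (cmod a * cmod b) ^ 2" using K1
          by (simp add: mult.assoc mult.left_commute mult_le_cancel_left_pos)
        moreover have "max 1 (cmod a) = cmod a" "max 1 (cmod b) = cmod b" using that K1 by auto
        ultimately show ?thesis by (simp add: norm_power)
      qed
      obtain \<delta> where \<delta>: "\<delta> > 0" "\<And>t. t \<noteq> 0 \<Longrightarrow> \<bar>t\<bar> < \<delta> \<Longrightarrow> \<exists>i<n. \<exists>j<n. i \<noteq> j \<and> K \<le> cmod (r t i) \<and> K \<le> cmod (r t j)"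
        using perturbed_two_large_roots[OF d False assms(3,4) K1] unfolding r_def by blast
      show ?thesis
      proof (rule exI[of _ \<delta>], intro conjI allI impI)
        fix t assume "t \<noteq> 0 \<and> \<bar>t\<bar> < \<delta>"
        then obtain i j where ij: "i < n" "j < n" "i \<noteq> j" "K \<le> cmod (r t i)" "K \<le> cmod (r t j)"
          using \<delta>(2)[of t] by blast
        show "\<exists>i<n. \<exists>j<n. i \<noteq> j \<and>
         cmod ((croots (map_poly complex_of_real (F + monom t n)) ! i - croots (map_poly complex_of_real (F + monom t n)) ! j)\<^sup>2)
         \<le> \<epsilon> * (max 1 (cmod (croots (map_poly complex_of_real (F + monom t n)) ! i)) *
                max 1 (cmod (croots (map_poly complex_of_real (F + monom t n)) ! j)))\<^sup>2"
          using ij(1-3) key[OF ij(4,5)] unfolding r_def by blast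
      qed (rule \<delta>(1))
    qed
  qed
  then have "((\<lambda>t. disc_formula n (F + monom t n)) \<longlongrightarrow> 0) (at 0)"
  proof (rule Lim_transform_eventually)
    have "coeff F n = 0" by fact
    then show "\<forall>\<^sub>F t in at 0. Re (complex_of_real t ^ ((n - 1) * 2) * (\<Prod>i<n. \<Prod>j\<in>{i<..<n}. (r t i - r t j) ^ 2)) = disc_formula n (F + monom t n)"
    proof (intro always_eventually allI)
      fix t :: real
      have "2 * n - 2 = (n - 1) * 2" by simp
      moreover have "coeff (F + monom t n) n = t" using assms(2) by simp
      ultimately show "Re (complex_of_real t ^ ((n - 1) * 2) * (\<Prod>i<n. \<Prod>j\<in>{i<..<n}. (r t i - r t j) ^ 2)) = disc_formula n (F + monom t n)"
        by (simp only: disc_formula_def Let_def r_def)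
    qed
  qed
  then show ?thesis using assms(2) unfolding disc_def by (simp add: tendsto_Lim)
qed

section \<open>Vanishing at a double root and at a pair of related roots\<close>

lemma croots_image:
  assumes "q \<noteq> 0" "poly q \<alpha> = 0"
  shows "\<exists>i<degree q. croots q ! i = \<alpha>"
  using poly_croots[of q \<alpha>] assms by auto

lemma disc_eq_0_double_root:
  assumes "degree F \<le> n" "coeff F n \<noteq> 0"
    and \<alpha>: "poly (map_poly complex_of_real F) \<alpha> = 0" "poly (pderiv (map_poly complex_of_real F)) \<alpha> = 0"
  shows "disc n F = 0"
proof -
  define q where "q = map_poly complex_of_real F"
  have dF: "degree F = n" using assms by (simp add: le_antisym le_degree)
  have dq: "degree q = n" using dF by (simp add: q_def degree_of_real_poly)
  have q0: "q \<noteq> 0" using assms(2) by (metis coeff_0 coeff_of_real_poly of_real_eq_0_iff q_def)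
  define r where "r = (\<lambda>i. croots q ! i)"
  have qf: "q = smult (lead_coeff q) (\<Prod>i<n. [:- r i, 1:])"
    using croots_factorization[of q] by (simp add: prod_list_map_nth length_croots dq r_def)
  obtain i where i: "i < n" "r i = \<alpha>" using croots_image[OF q0] \<alpha> dq unfolding r_def q_def by blast
  let ?R = "smult (lead_coeff q) (\<Prod>j\<in>{..<n}-{i}. [:- r j, 1:])"
  have "(\<Prod>i<n. [:- r i, 1:]) = [:- r i, 1:] * (\<Prod>j\<in>{..<n}-{i}. [:- r j, 1:])"
    by (rule prod.remove) (use i in auto)
  then have q: "q = [:-\<alpha>, 1:] * ?R" using qf i(2) by (metis mult_smult_right)
  have "poly (pderiv ([:-\<alpha>, 1:] * ?R)) \<alpha> = poly ?R \<alpha>"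
    by (simp only: pderiv_mult) (simp add: pderiv_pCons)
  then have "poly ?R \<alpha> = 0" using \<alpha>(2) q unfolding q_def[symmetric] by simp
  then have "(\<Prod>j\<in>{..<n}-{i}. \<alpha> - r j) = 0" using q0 by (simp add: poly_prod)
  then obtain j where j: "j < n" "j \<noteq> i" "r j = \<alpha>" by (auto simp: prod_zero_iff)
  obtain a b where ab: "a < b" "b < n" "r a = r b"
  proof (cases "i < j")
    case True then show ?thesis using that[of i j] i j by auto
  next
    case False then show ?thesis using that[of j i] i j by auto
  qed
  have "\<exists>j\<in>{a<..<n}. (r a - r j) ^ 2 = 0" by (rule bexI[of _ b]) (use ab in auto)
  then have "(\<Prod>j\<in>{a<..<n}. (r a - r j) ^ 2) = 0" by (rule prod_zero[OF finite_greaterThanLessThan])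
  then have "\<exists>i\<in>{..<n}. (\<Prod>j\<in>{i<..<n}. (r i - r j) ^ 2) = 0" by (rule bexI[of _ a]) (use ab in auto)
  then have "(\<Prod>i<n. \<Prod>j\<in>{i<..<n}. (r i - r j) ^ 2) = 0" by (rule prod_zero[OF finite_lessThan])
  then have "disc_formula n F = 0" unfolding disc_formula_def Let_def q_def[symmetric] r_def
    by (simp only: mult_zero_right zero_complex.sel)
  then show ?thesis using assms(2) by (simp add: disc_def)
qed

text \<open>After the common power of ab is taken out, what remains is a difference of equal powers,
  divisible by a - b. The quotient has at most d + 1 monomials, each of degree at most d in a and in
  b.\<close>

lemma power_cross_diff_le:
  fixes a b :: complex
  assumes "k \<le> Suc d" "l \<le> Suc d"
  shows "cmod (a ^ k * b ^ l - b ^ k * a ^ l)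
    \<le> real (Suc d) * (max 1 (cmod a) * max 1 (cmod b)) ^ d * cmod (a - b)"
proof -
  have wlog: "cmod (a ^ k * b ^ l - b ^ k * a ^ l)
    \<le> real (Suc d) * (max 1 (cmod a) * max 1 (cmod b)) ^ d * cmod (a - b)"
    if "l \<le> k" "k \<le> Suc d" for k l
  proof -
    let ?m = "max 1 (cmod a) * max 1 (cmod b)"
    have m1: "?m \<ge> 1" using mult_mono[of 1 "max 1 (cmod a)" 1 "max 1 (cmod b)"] by simp
    have ma: "cmod a \<le> ?m" "cmod b \<le> ?m" "cmod (a * b) \<le> ?m"
      using mult_mono[of "cmod a" "max 1 (cmod a)" 1 "max 1 (cmod b)"]
        mult_mono[of 1 "max 1 (cmod a)" "cmod b" "max 1 (cmod b)"]
        mult_mono[of "cmod a" "max 1 (cmod a)" "cmod b" "max 1 (cmod b)"]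
      by (auto simp: norm_mult)
    show ?thesis
    proof (cases "l = k")
      case True
      then show ?thesis by simp
    next
      case False
      define e where "e = k - l - 1"
      have k: "k = l + Suc e" using that False by (simp add: e_def)
      have summand: "cmod (a ^ i * b ^ (e - i)) * cmod ((a * b) ^ l) \<le> ?m ^ d" if i: "i \<le> e" for i
      proof -
        have A: "cmod a ^ n \<le> max 1 (cmod a) ^ d" if "n \<le> d" for n and a :: complex
        proof -
          have "cmod a ^ n \<le> max 1 (cmod a) ^ n" by (intro power_mono) auto
          also have "\<dots> \<le> max 1 (cmod a) ^ d" using that by (intro power_increasing) auto
          finally show ?thesis .
        qed
        have "cmod (a ^ i * b ^ (e - i)) * cmod ((a * b) ^ l) = cmod a ^ (i + l) * cmod b ^ (e - i + l)"
          by (simp add: norm_mult norm_power power_mult_distrib power_add)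
        also have "\<dots> \<le> max 1 (cmod a) ^ d * max 1 (cmod b) ^ d"
          by (intro mult_mono A) (use i k \<open>k \<le> Suc d\<close> in auto)
        finally show ?thesis by (simp add: power_mult_distrib)
      qed
      have "a ^ k * b ^ l - b ^ k * a ^ l = (a * b) ^ l * (a ^ Suc e - b ^ Suc e)"
        unfolding k by (simp add: power_add power_mult_distrib algebra_simps)
      also have "a ^ Suc e - b ^ Suc e = (a - b) * (\<Sum>i\<le>e. a ^ i * b ^ (e - i))"
        using power_diff_sumr2[of a "Suc e" b] by (simp add: lessThan_Suc_atMost mult.commute)
      finally have 1: "cmod (a ^ k * b ^ l - b ^ k * a ^ l) = cmod (a - b) * (cmod ((a * b) ^ l) * cmod (\<Sum>i\<le>e. a ^ i * b ^ (e - i)))"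
        by (simp add: norm_mult)
      have "cmod ((a * b) ^ l) * cmod (\<Sum>i\<le>e. a ^ i * b ^ (e - i)) \<le> (\<Sum>i\<le>e. cmod (a ^ i * b ^ (e - i))) * cmod ((a * b) ^ l)"
        unfolding mult.commute[of "cmod ((a*b)^l)"] by (intro mult_right_mono norm_sum) auto
      also have "\<dots> = (\<Sum>i\<le>e. cmod (a ^ i * b ^ (e - i)) * cmod ((a * b) ^ l))" by (rule sum_distrib_right)
      also have "\<dots> \<le> (\<Sum>i\<le>e. ?m ^ d)" by (intro sum_mono summand) auto
      also have "\<dots> \<le> real (Suc d) * ?m ^ d" using m1 k \<open>k \<le> Suc d\<close> by (simp add: mult_right_mono)
      finally show ?thesis unfolding 1 mult.commute[of _ "cmod (a - b)"] by (rule mult_left_mono) simp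
    qed
  qed
  show ?thesis
  proof (cases "l \<le> k")
    case True
    then show ?thesis using wlog assms by blast
  next
    case False
    then have "cmod (a ^ l * b ^ k - b ^ l * a ^ k)
      \<le> real (Suc d) * (max 1 (cmod a) * max 1 (cmod b)) ^ d * cmod (a - b)"
      using wlog[of k l] assms by simp
    then show ?thesis by (simp add: norm_minus_commute mult.commute)
  qed
qed

text \<open>The divided difference is a polynomial of degree at most d in each variable. Off the
  diagonal the bound comes from expanding both polynomials into monomials.\<close>

lemma divdiff_bound:
  assumes "degree G \<le> Suc d" "degree H \<le> Suc d"
  shows "\<exists>B. \<forall>a b. cmod (divdiff G H a b) \<le> B * (max 1 (cmod a) * max 1 (cmod b)) ^ d"
proof -
  define B where "B = (\<Sum>k\<le>Suc d. \<Sum>l\<le>Suc d. cmod (coeff G k) * cmod (coeff H l) * real (Suc d))"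
  have ex: "poly F x = (\<Sum>k\<le>Suc d. coeff F k * x ^ k)" if "degree F \<le> Suc d" for F :: "complex poly" and x
    unfolding poly_altdef by (rule sum.mono_neutral_left) (use that in \<open>auto simp: coeff_eq_0\<close>)
  have num: "cmod (poly G a * poly H b - poly G b * poly H a)
      \<le> B * (max 1 (cmod a) * max 1 (cmod b)) ^ d * cmod (a - b)" for a b
  proof -
    have "poly G a * poly H b - poly G b * poly H a
      = (\<Sum>k\<le>Suc d. \<Sum>l\<le>Suc d. coeff G k * a ^ k * (coeff H l * b ^ l))
        - (\<Sum>k\<le>Suc d. \<Sum>l\<le>Suc d. coeff G k * b ^ k * (coeff H l * a ^ l))"
      by (simp only: ex[OF assms(1)] ex[OF assms(2)] sum_product)
    also have "\<dots> = (\<Sum>k\<le>Suc d. \<Sum>l\<le>Suc d. coeff G k * coeff H l * (a ^ k * b ^ l - b ^ k * a ^ l))"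
      unfolding sum_subtractf[symmetric] by (intro sum.cong refl) (simp add: algebra_simps)
    also have "cmod \<dots> \<le> (\<Sum>k\<le>Suc d. cmod (\<Sum>l\<le>Suc d. coeff G k * coeff H l * (a ^ k * b ^ l - b ^ k * a ^ l)))"
      by (rule norm_sum)
    also have "\<dots> \<le> (\<Sum>k\<le>Suc d. \<Sum>l\<le>Suc d. cmod (coeff G k * coeff H l * (a ^ k * b ^ l - b ^ k * a ^ l)))"
      by (intro sum_mono norm_sum)
    also have "\<dots> \<le> (\<Sum>k\<le>Suc d. \<Sum>l\<le>Suc d. cmod (coeff G k) * cmod (coeff H l) *
        (real (Suc d) * (max 1 (cmod a) * max 1 (cmod b)) ^ d * cmod (a - b)))"
      unfolding norm_mult by (intro sum_mono mult_left_mono) (use power_cross_diff_le in \<open>auto simp: norm_mult\<close>)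
    also have "\<dots> = B * (max 1 (cmod a) * max 1 (cmod b)) ^ d * cmod (a - b)"
      unfolding B_def by (simp only: sum_distrib_right mult.assoc)
    finally show ?thesis .
  qed
  have off: "cmod (divdiff G H a b) \<le> B * (max 1 (cmod a) * max 1 (cmod b)) ^ d" if "a \<noteq> b" for a b
    using num[of a b] that by (simp add: divdiff_def norm_divide pos_divide_le_eq)
  show ?thesis
  proof (intro exI[of _ B] allI)
    fix a b
    show "cmod (divdiff G H a b) \<le> B * (max 1 (cmod a) * max 1 (cmod b)) ^ d"
    proof (cases "a = b")
      \<comment> \<open>The diagonal value is the limit of the values at (x, a) as x tends to a, and
        the bound is continuous in x.\<close>
      case True
      let ?f = "\<lambda>x. poly G x * poly H a - poly G a * poly H x"
      have "(?f has_field_derivative (poly (pderiv G) a * poly H a - poly G a * poly (pderiv H) a)) (at a)"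
        by (auto intro!: derivative_eq_intros poly_DERIV)
      then have "((\<lambda>x. (?f x - ?f a) / (x - a)) \<longlongrightarrow> divdiff G H a a) (at a)"
        by (simp add: has_field_derivative_iff divdiff_def)
      then have "((\<lambda>x. divdiff G H x a) \<longlongrightarrow> divdiff G H a a) (at a)"
        by (rule Lim_transform_eventually) (auto simp: eventually_at_filter divdiff_def)
      then have lim: "((\<lambda>x. cmod (divdiff G H x a)) \<longlongrightarrow> cmod (divdiff G H a a)) (at a)"
        by (rule tendsto_norm)
      have lim2: "((\<lambda>x. B * (max 1 (cmod x) * max 1 (cmod a)) ^ d) \<longlongrightarrow> B * (max 1 (cmod a) * max 1 (cmod a)) ^ d) (at a)"
        by (intro tendsto_intros)
      have "cmod (divdiff G H a a) \<le> B * (max 1 (cmod a) * max 1 (cmod a)) ^ d"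
        by (rule tendsto_le[OF _ lim2 lim]) (auto simp: eventually_at_filter off)
      then show ?thesis using True by simp
    qed (rule off)
  qed
qed

lemma divdiff_commute: "divdiff G H a b = divdiff G H b a"
proof (cases "a = b")
  case False
  have "(p - q) / (a - b) = (q - p) / (b - a)" for p q :: complex
    using False by (simp add: divide_simps) (simp add: algebra_simps)
  then show ?thesis using False by (simp add: divdiff_def mult.commute)
qed simp

text \<open>The factor belonging to \<alpha> and \<beta> is 0. If the formal leading coefficient
  vanishes, \<open>Phi\<close> is a limit; the two finite roots then persist near \<alpha> and
  \<beta>, their factor tends to 0, and the escaping roots are absorbed by the weights.\<close>

lemma Phi_eq_0:
  assumes F: "F \<noteq> 0" "degree F \<le> m"
    and GH: "degree G \<le> n" "degree H \<le> n" "n \<ge> 1"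
    and \<alpha>\<beta>: "\<alpha> \<noteq> \<beta>" "poly (map_poly complex_of_real F) \<alpha> = 0" "poly (map_poly complex_of_real F) \<beta> = 0"
    and rel: "poly (map_poly complex_of_real G) \<alpha> * poly (map_poly complex_of_real H) \<beta>
      = poly (map_poly complex_of_real G) \<beta> * poly (map_poly complex_of_real H) \<alpha>"
  shows "Phi m n F G H = 0"
proof -
  define G' where "G' = map_poly complex_of_real G"
  define H' where "H' = map_poly complex_of_real H"
  define s where "s = divdiff G' H'"
  have s0: "s \<alpha> \<beta> = 0" using rel \<alpha>\<beta>(1) by (simp add: s_def divdiff_def G'_def H'_def)
  show ?thesis
  proof (cases "coeff F m = 0")
    case False
    define q where "q = map_poly complex_of_real F"
    have dq: "degree q = m" using F False by (simp add: q_def degree_of_real_poly le_antisym le_degree)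
    have q0: "q \<noteq> 0" using False by (metis coeff_0 coeff_of_real_poly of_real_eq_0_iff q_def)
    obtain i where i: "i < m" "croots q ! i = \<alpha>" using croots_image[OF q0] \<alpha>\<beta> dq unfolding q_def by blast
    obtain j where j: "j < m" "croots q ! j = \<beta>" using croots_image[OF q0] \<alpha>\<beta> dq unfolding q_def by blast
    obtain a b where ab: "a < b" "b < m" "s (croots q ! a) (croots q ! b) = 0"
    proof (cases "i < j")
      case True then show ?thesis using that[of i j] i j s0 by auto
    next
      case False
      then have "j < i" using i j \<alpha>\<beta>(1) by (metis linorder_neqE_nat)
      then show ?thesis using that[of j i] i j s0 divdiff_commute unfolding s_def by metis
    qed
    have "\<exists>j\<in>{a<..<m}. s (croots q ! a) (croots q ! j) = 0" by (rule bexI[of _ b]) (use ab in auto)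
    then have "(\<Prod>j\<in>{a<..<m}. s (croots q ! a) (croots q ! j)) = 0" by (rule prod_zero[OF finite_greaterThanLessThan])
    then have "\<exists>i\<in>{..<m}. (\<Prod>j\<in>{i<..<m}. s (croots q ! i) (croots q ! j)) = 0" by (rule bexI[of _ a]) (use ab in auto)
    then have "(\<Prod>i<m. \<Prod>j\<in>{i<..<m}. s (croots q ! i) (croots q ! j)) = 0" by (rule prod_zero[OF finite_lessThan])
    then have "Phi_formula m n F G H = 0"
      unfolding Phi_formula_def Let_def q_def[symmetric] s_def G'_def H'_def
      by (simp only: mult_zero_right zero_complex.sel)
    then show ?thesis using False by (simp add: Phi_def)
  next
    case True
    have d: "degree F < m"
    proof -
      have "degree F \<noteq> m" using F(1) True by auto
      then show ?thesis using F(2) by simp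
    qed
    define r where "r = (\<lambda>t i. croots (map_poly complex_of_real (F + monom t m)) ! i)"
    define e where "e = n - 1"
    have "degree G' \<le> Suc e" "degree H' \<le> Suc e" using GH by (auto simp: G'_def H'_def degree_of_real_poly e_def)
    then obtain B where B: "\<And>a b. cmod (s a b) \<le> B * (max 1 (cmod a) * max 1 (cmod b)) ^ e"
      using divdiff_bound unfolding s_def by blast
    have "((\<lambda>t. Re (complex_of_real t ^ ((m - 1) * e) * (\<Prod>i<m. \<Prod>j\<in>{i<..<m}. s (r t i) (r t j)))) \<longlongrightarrow> 0) (at 0)"
      unfolding r_def
    proof (rule perturbed_formula_tendsto_0[OF d, where s = s and d = e, OF B])
      show "cmod (s a b) = cmod (s b a)" for a b unfolding s_def by (subst divdiff_commute) (rule refl)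
      fix \<epsilon> :: real assume \<epsilon>: "\<epsilon> > 0"
      define h where "h = (\<lambda>z. (poly G' (fst z) * poly H' (snd z) - poly G' (snd z) * poly H' (fst z)) / (fst z - snd z))"
      have "isCont (\<lambda>z. poly p (fst z)) (\<alpha>, \<beta>)" "isCont (\<lambda>z. poly p (snd z)) (\<alpha>, \<beta>)" for p
        by (rule isCont_o2[OF _ poly_isCont], intro continuous_intros)+
      then have "isCont h (\<alpha>, \<beta>)"
        unfolding h_def using \<alpha>\<beta>(1) by (intro continuous_intros) auto
      then have "(h \<longlongrightarrow> h (\<alpha>, \<beta>)) (at (\<alpha>, \<beta>))" by (simp add: isCont_def)
      moreover have "h (\<alpha>, \<beta>) = 0" using s0 \<alpha>\<beta>(1) by (simp add: h_def s_def divdiff_def)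
      ultimately obtain \<eta>0 where \<eta>0: "\<eta>0 > 0" "\<And>z. z \<noteq> (\<alpha>,\<beta>) \<Longrightarrow> dist z (\<alpha>,\<beta>) < \<eta>0 \<Longrightarrow> cmod (h z) < \<epsilon>"
        unfolding LIM_def using \<epsilon> by (auto simp: dist_norm)
      have h: "cmod (h z) < \<epsilon>" if "dist z (\<alpha>,\<beta>) < \<eta>0" for z
        using \<eta>0(2)[OF _ that] \<epsilon> \<open>h (\<alpha>, \<beta>) = 0\<close> by (cases "z = (\<alpha>,\<beta>)") auto
      \<comment> \<open>Half of \<open>\<eta>0\<close> keeps the pair within \<open>\<eta>0\<close>
        in the product metric; half of |\<alpha> - \<beta>| keeps the two roots apart, so that they
        carry different indices and \<open>divdiff\<close> is the quotient \<open>h\<close>.\<close>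
      define \<eta> where "\<eta> = min (\<eta>0 / 2) (cmod (\<alpha> - \<beta>) / 2)"
      have \<eta>: "\<eta> > 0" using \<eta>0(1) \<alpha>\<beta>(1) by (simp add: \<eta>_def)
      have close: "x \<noteq> y \<and> cmod (s x y) \<le> \<epsilon>" if "cmod (x - \<alpha>) < \<eta>" "cmod (y - \<beta>) < \<eta>" for x y
      proof -
        have ne: "x \<noteq> y"
        proof
          assume "x = y"
          have "cmod (\<alpha> - \<beta>) \<le> cmod (x - \<alpha>) + cmod (x - \<beta>)"
            using norm_triangle_ineq4[of "x - \<beta>" "x - \<alpha>"] by simp
          then show False using that \<open>x = y\<close> unfolding \<eta>_def by simp
        qed
        have "dist (x, y) (\<alpha>, \<beta>) \<le> dist x \<alpha> + dist y \<beta>"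
          unfolding dist_Pair_Pair by (rule sqrt_sum_squares_le_sum) auto
        also have "\<dots> < \<eta>0" using that unfolding dist_norm \<eta>_def by simp
        finally have "cmod (h (x, y)) < \<epsilon>" by (rule h)
        then show ?thesis using ne by (simp add: h_def s_def divdiff_def)
      qed
      obtain \<delta>1 where \<delta>1: "\<delta>1 > 0" "\<And>t. t \<noteq> 0 \<Longrightarrow> \<bar>t\<bar> < \<delta>1 \<Longrightarrow> \<exists>i<m. cmod (r t i - \<alpha>) < \<eta>"
        using perturbed_root_near[OF d F(1) \<alpha>\<beta>(2) \<eta>] unfolding r_def by blast
      obtain \<delta>2 where \<delta>2: "\<delta>2 > 0" "\<And>t. t \<noteq> 0 \<Longrightarrow> \<bar>t\<bar> < \<delta>2 \<Longrightarrow> \<exists>i<m. cmod (r t i - \<beta>) < \<eta>"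
        using perturbed_root_near[OF d F(1) \<alpha>\<beta>(3) \<eta>] unfolding r_def by blast
      have main: "\<exists>i<m. \<exists>j<m. i \<noteq> j \<and> cmod (s (r t i) (r t j)) \<le> \<epsilon> * (max 1 (cmod (r t i)) * max 1 (cmod (r t j))) ^ e"
        if t: "t \<noteq> 0" "\<bar>t\<bar> < min \<delta>1 \<delta>2" for t
      proof -
        obtain i j where ij: "i < m" "j < m" "cmod (r t i - \<alpha>) < \<eta>" "cmod (r t j - \<beta>) < \<eta>"
          using \<delta>1(2)[of t] \<delta>2(2)[of t] t by auto
        have "r t i \<noteq> r t j" "cmod (s (r t i) (r t j)) \<le> \<epsilon>" using close ij by blast+
        moreover have "1 \<le> (max 1 (cmod (r t i)) * max 1 (cmod (r t j))) ^ e"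
          using mult_mono[of 1 "max 1 (cmod (r t i))" 1 "max 1 (cmod (r t j))"] by (intro one_le_power) simp
        then have "\<epsilon> * 1 \<le> \<epsilon> * (max 1 (cmod (r t i)) * max 1 (cmod (r t j))) ^ e"
          using \<epsilon> by (intro mult_left_mono) auto
        ultimately show ?thesis using ij by (intro exI[of _ i] conjI exI[of _ j]) auto
      qed
      show "\<exists>\<delta>>0. \<forall>t. t \<noteq> 0 \<and> \<bar>t\<bar> < \<delta> \<longrightarrow>
        (\<exists>i<m. \<exists>j<m. i \<noteq> j \<and>
           cmod (s (croots (map_poly complex_of_real (F + monom t m)) ! i) (croots (map_poly complex_of_real (F + monom t m)) ! j))
           \<le> \<epsilon> * (max 1 (cmod (croots (map_poly complex_of_real (F + monom t m)) ! i)) *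
                  max 1 (cmod (croots (map_poly complex_of_real (F + monom t m)) ! j))) ^ e)"
        by (rule exI[of _ "min \<delta>1 \<delta>2"]) (use main \<delta>1(1) \<delta>2(1) in \<open>auto simp: r_def\<close>)
    qed
    then have "((\<lambda>t. Phi_formula m n (F + monom t m) G H) \<longlongrightarrow> 0) (at 0)"
    proof (rule Lim_transform_eventually)
      show "\<forall>\<^sub>F t in at 0. Re (complex_of_real t ^ ((m - 1) * e) * (\<Prod>i<m. \<Prod>j\<in>{i<..<m}. s (r t i) (r t j)))
          = Phi_formula m n (F + monom t m) G H"
        using True by (simp add: Phi_formula_def Let_def r_def s_def G'_def H'_def e_def)
    qed
    then show ?thesis using True unfolding Phi_def by (simp add: tendsto_Lim)
  qed
qed

section \<open>Counting solutions of \<open>A\<^sup>2 + f B\<^sup>2 = H\<close>\<close>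

text \<open>A pair (A, B) stands for A + B sqrt(-f) in the quadratic extension; the equation
  prescribes its norm.\<close>

definition norm_sols :: "real poly \<Rightarrow> real poly \<Rightarrow> (real poly \<times> real poly) set" where
  "norm_sols f H = {(A, B). A\<^sup>2 + f * B\<^sup>2 = H}"

text \<open>Multiplication by \<open>l \<plusminus> \<kappa> \<surd>(-f)\<close>, of norm \<open>q\<close>, gives two injections with disjoint images.\<close>
lemma card_norm_sols_mult:
  fixes f q l \<kappa> H :: "real poly"
  assumes q: "prime_elem q" "q = l\<^sup>2 + \<kappa>\<^sup>2 * f" and ql: "\<not> q dvd l" and qH: "\<not> q dvd H"
    and fin: "finite (norm_sols f H)"
  shows "finite (norm_sols f (q * H)) \<and> card (norm_sols f (q * H)) = 2 * card (norm_sols f H)"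
proof -
  define \<phi> where "\<phi> = (\<lambda>\<kappa> (z :: real poly \<times> real poly). (l * fst z - \<kappa> * f * snd z, l * snd z + \<kappa> * fst z))"
  define S where "S = norm_sols f H"
  have q0: "q \<noteq> 0" using q(1) by auto
  have inv1: "l * fst (\<phi> \<mu> z) + \<mu> * f * snd (\<phi> \<mu> z) = q * fst z"
    and inv2: "l * snd (\<phi> \<mu> z) - \<mu> * fst (\<phi> \<mu> z) = q * snd z" if "\<mu> = \<kappa> \<or> \<mu> = - \<kappa>" for \<mu> z
    using that unfolding \<phi>_def q(2) by (auto simp: algebra_simps power2_eq_square)
  have norm: "(fst (\<phi> \<mu> z))\<^sup>2 + f * (snd (\<phi> \<mu> z))\<^sup>2 = q * ((fst z)\<^sup>2 + f * (snd z)\<^sup>2)"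
    if "\<mu> = \<kappa> \<or> \<mu> = - \<kappa>" for \<mu> z
    using that unfolding \<phi>_def q(2) by (auto simp: algebra_simps power2_eq_square)
  have inj: "inj_on (\<phi> \<mu>) S" if \<mu>: "\<mu> = \<kappa> \<or> \<mu> = - \<kappa>" for \<mu>
  proof (rule inj_onI)
    fix x y assume eq: "\<phi> \<mu> x = \<phi> \<mu> y"
    have "q * fst x = q * fst y" "q * snd x = q * snd y"
      unfolding inv1[OF \<mu>, symmetric] inv2[OF \<mu>, symmetric] eq by (rule refl)+
    then show "x = y" using q0 by (simp add: prod_eq_iff)
  qed
  \<comment> \<open>An element in both images is divisible by q after multiplication by l, hence
    divisible by q itself. Its norm qH would then be divisible by q^2.\<close>
  have disj: "\<phi> \<kappa> ` S \<inter> \<phi> (- \<kappa>) ` S = {}"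
  proof (rule ccontr)
    assume "\<phi> \<kappa> ` S \<inter> \<phi> (- \<kappa>) ` S \<noteq> {}"
    then obtain z z' where z: "z \<in> S" "\<phi> \<kappa> z = \<phi> (- \<kappa>) z'" by blast
    let ?A = "fst (\<phi> \<kappa> z)" and ?B = "snd (\<phi> \<kappa> z)"
    have e: "l * ?A + \<kappa> * f * ?B = q * fst z" "l * ?A + - \<kappa> * f * ?B = q * fst z'"
      "l * ?B - \<kappa> * ?A = q * snd z" "l * ?B - - \<kappa> * ?A = q * snd z'"
      using inv1[of \<kappa> z] inv1[of "-\<kappa>" z'] inv2[of \<kappa> z] inv2[of "-\<kappa>" z'] z(2) by metis+
    have d: "2 * (l * ?A) = q * (fst z + fst z')" "2 * (l * ?B) = q * (snd z + snd z')"
      unfolding distrib_left[of q] e[symmetric] by simp_all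
    note 2 = dvdI[OF d(1)] dvdI[OF d(2)]
    have half: "X = [:1/2:] * (2 * X)" for X :: "real poly" by (simp add: numeral_poly)
    have "q dvd l * ?A" "q dvd l * ?B" by (subst half, rule dvd_mult, rule 2)+
    then have "q dvd ?A" "q dvd ?B"
      using prime_elem_dvd_multD[OF q(1)] ql by blast+
    then obtain a b where ab: "?A = q * a" "?B = q * b" unfolding dvd_def by blast
    have "q * H = q * ((fst z)\<^sup>2 + f * (snd z)\<^sup>2)" using z(1) by (simp add: S_def norm_sols_def case_prod_beta)
    also have "\<dots> = q * (q * (a\<^sup>2 + f * b\<^sup>2))"
      unfolding norm[of \<kappa> z, OF disjI1[OF refl], symmetric] ab by (simp add: algebra_simps power2_eq_square)
    finally have "H = q * (a\<^sup>2 + f * b\<^sup>2)" using q0 by simp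
    then show False using qH by simp
  qed
  have "norm_sols f (q * H) = \<phi> \<kappa> ` S \<union> \<phi> (- \<kappa>) ` S"
  proof (intro equalityI subsetI)
    fix z assume "z \<in> \<phi> \<kappa> ` S \<union> \<phi> (- \<kappa>) ` S"
    then obtain \<mu> w where \<mu>: "\<mu> = \<kappa> \<or> \<mu> = - \<kappa>" "w \<in> S" "z = \<phi> \<mu> w" by auto
    then show "z \<in> norm_sols f (q * H)"
      using norm[OF \<mu>(1), of w] by (simp add: S_def norm_sols_def case_prod_beta)
  next
    fix z assume "z \<in> norm_sols f (q * H)"
    then obtain A B where z: "z = (A, B)" and AB: "A\<^sup>2 + f * B\<^sup>2 = q * H" by (auto simp: norm_sols_def)
    \<comment> \<open>Modulo the prime q this product is 0. The factor divisible by q decides by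
      which of the two conjugate elements of norm q the solution can be divided.\<close>
    have "(l * B - \<kappa> * A) * (l * B + \<kappa> * A) = l\<^sup>2 * B\<^sup>2 + \<kappa>\<^sup>2 * (f * B\<^sup>2) - \<kappa>\<^sup>2 * (A\<^sup>2 + f * B\<^sup>2)"
      by (simp add: algebra_simps power2_eq_square)
    also have "l\<^sup>2 * B\<^sup>2 + \<kappa>\<^sup>2 * (f * B\<^sup>2) = q * B\<^sup>2"
      unfolding q(2) by (simp add: distrib_right mult.assoc)
    also have "q * B\<^sup>2 - \<kappa>\<^sup>2 * (A\<^sup>2 + f * B\<^sup>2) = q * (B\<^sup>2 - \<kappa>\<^sup>2 * H)"
      unfolding AB by (simp add: right_diff_distrib mult.left_commute)
    finally have "(l * B - \<kappa> * A) * (l * B + \<kappa> * A) = q * (B\<^sup>2 - \<kappa>\<^sup>2 * H)" .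
    from prime_elem_dvd_multD[OF q(1) dvdI[OF this]]
    have "q dvd l * B - \<kappa> * A \<or> q dvd l * B - (- \<kappa>) * A" by simp
    then obtain \<mu> where \<mu>: "\<mu> = \<kappa> \<or> \<mu> = - \<kappa>" and d: "q dvd l * B - \<mu> * A" by blast
    then obtain b where b: "l * B - \<mu> * A = q * b" unfolding dvd_def by blast
    have q': "q = l\<^sup>2 + \<mu>\<^sup>2 * f" using q(2) \<mu> by auto
    have "l * (l * A + \<mu> * f * B) = q * A + \<mu> * f * (l * B - \<mu> * A)"
      unfolding q' by (simp add: algebra_simps power2_eq_square)
    also have "\<dots> = q * (A + \<mu> * f * b)" unfolding b by (simp add: algebra_simps)
    finally have "l * (l * A + \<mu> * f * B) = q * (A + \<mu> * f * b)" .
    from prime_elem_dvd_multD[OF q(1) dvdI[OF this]]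
    have "q dvd l * A + \<mu> * f * B" using ql by blast
    then obtain a where a: "l * A + \<mu> * f * B = q * a" unfolding dvd_def by blast
    have "q * (l * a - \<mu> * f * b) = l * (l * A + \<mu> * f * B) - \<mu> * f * (l * B - \<mu> * A)"
      unfolding a b by (simp add: algebra_simps)
    also have "\<dots> = q * A" unfolding q' by (simp add: algebra_simps power2_eq_square)
    finally have 1: "l * a - \<mu> * f * b = A" using q0 by simp
    have "q * (l * b + \<mu> * a) = l * (l * B - \<mu> * A) + \<mu> * (l * A + \<mu> * f * B)"
      unfolding a b by (simp add: algebra_simps)
    also have "\<dots> = q * B" unfolding q' by (simp add: algebra_simps power2_eq_square)
    finally have 2: "l * b + \<mu> * a = B" using q0 by simp
    have \<phi>: "\<phi> \<mu> (a, b) = z" unfolding \<phi>_def z using 1 2 by simp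
    have "q * (a\<^sup>2 + f * b\<^sup>2) = q * H" using norm[OF \<mu>, of "(a,b)"] AB unfolding \<phi> z by (simp only: fst_conv snd_conv)
    then have "a\<^sup>2 + f * b\<^sup>2 = H" using mult_left_cancel[OF q0] by blast
    then have "(a, b) \<in> S" by (simp add: S_def norm_sols_def)
    then show "z \<in> \<phi> \<kappa> ` S \<union> \<phi> (- \<kappa>) ` S" using \<mu> \<phi> by blast
  qed
  moreover have "finite S" using fin by (simp add: S_def)
  ultimately show ?thesis
    using inj[of \<kappa>] inj[of "-\<kappa>"] disj by (simp add: card_Un_disjoint card_image S_def)
qed

lemma degree_add_pos_lead_coeff:
  fixes p q :: "'a::linordered_idom poly"
  assumes "lead_coeff p > 0" "lead_coeff q > 0"
  shows "degree q \<le> degree (p + q)"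
proof (cases "degree p" "degree q" rule: linorder_cases)
  case less
  then show ?thesis by (simp add: degree_add_eq_right)
next
  case equal
  have "coeff (p + q) (degree q) > 0" using assms equal by (simp add: add_pos_pos)
  then show ?thesis by (intro le_degree) auto
next
  case greater
  then show ?thesis by (simp add: degree_add_eq_left)
qed

text \<open>Positive leading coefficients cannot cancel, so a nonzero B would give the left side
  degree at least 2.\<close>

lemma norm_sols_const:
  assumes "degree f = 2" "lead_coeff f > 0" "c > 0"
  shows "norm_sols f [:c:] = {([:sqrt c:], 0), ([:- sqrt c:], 0)}"
proof -
  have "B = 0 \<and> (A = [:sqrt c:] \<or> A = [:- sqrt c:])" if AB: "A\<^sup>2 + f * B\<^sup>2 = [:c:]" for A B
  proof -
    have B: "B = 0"
    proof (rule ccontr)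
      assume B: "B \<noteq> 0"
      have l: "lead_coeff (f * B\<^sup>2) > 0" using assms B by (simp add: lead_coeff_mult lead_coeff_power)
      have f0: "f \<noteq> 0" using assms by auto
      have d: "degree (f * B\<^sup>2) \<ge> 2" using f0 B assms by (simp add: degree_mult_eq)
      have "degree (f * B\<^sup>2) \<le> degree (A\<^sup>2 + f * B\<^sup>2)"
      proof (cases "A = 0")
        case False
        then have "lead_coeff (A\<^sup>2) > 0" by (simp add: lead_coeff_power)
        then show ?thesis using l by (rule degree_add_pos_lead_coeff)
      qed simp
      then show False unfolding AB using d by simp
    qed
    then have A2: "A\<^sup>2 = [:c:]" using AB by simp
    then have "degree (A\<^sup>2) = 0" by simp
    then have "degree A = 0" by (cases "A = 0") (auto simp: degree_power_eq)
    then obtain a where a: "A = [:a:]" by (rule degree_eq_zeroE)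
    then have "a\<^sup>2 = c" using A2 by (simp add: power2_eq_square)
    then have "a = sqrt c \<or> a = - sqrt c" using assms(3) by (metis power2_eq_iff real_sqrt_pow2 less_imp_le)
    then show ?thesis using a B by auto
  qed
  then show ?thesis using assms(3) by (auto simp: norm_sols_def power2_eq_square)
qed

section \<open>Real polynomials at complex points\<close>

abbreviation cx :: "real poly \<Rightarrow> complex poly" where "cx p \<equiv> map_poly complex_of_real p"

lemma cx_simps [simp]:
  "cx (p + q) = cx p + cx q" "cx (p - q) = cx p - cx q" "cx (- p) = - cx p"
  "cx (p * q) = cx p * cx q" "cx (smult c p) = smult (of_real c) (cx p)" "cx (p ^ n) = cx p ^ n"
  "cx (numeral k) = numeral k" "cx (pderiv p) = pderiv (cx p)"
proof -
  show "cx (p + q) = cx p + cx q" "cx (p - q) = cx p - cx q" "cx (- p) = - cx p"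
    "cx (smult c p) = smult (of_real c) (cx p)" for p q c
    by (auto intro!: poly_eqI simp: coeff_map_poly)
  show mult: "cx (p * q) = cx p * cx q" for p q
    by (auto intro!: poly_eqI simp: coeff_map_poly coeff_mult)
  show "cx (p ^ n) = cx p ^ n" by (induction n) (auto simp: mult one_pCons map_poly_pCons)
  show "cx (numeral k) = numeral k" by (auto intro!: poly_eqI simp: coeff_map_poly numeral_poly coeff_pCons split: nat.splits)
  show "cx (pderiv p) = pderiv (cx p)"
    by (auto intro!: poly_eqI simp: coeff_map_poly coeff_pderiv)
qed

lemma cx_pCons [simp]: "cx (pCons a p) = pCons (of_real a) (cx p)"
  by (auto intro!: poly_eqI simp: coeff_map_poly coeff_pCons split: nat.splits)

lemma poly_cx_of_real [simp]: "poly (cx p) (of_real x) = of_real (poly p x)"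
  by (induction p) auto

lemma poly_cx_cnj: "poly (cx p) (cnj z) = cnj (poly (cx p) z)"
  by (induction p) auto

lemma cx_linear_root_nonreal:
  assumes "degree l \<le> 1" "poly (cx l) z = 0" "Im z \<noteq> 0"
  shows "l = 0"
proof -
  obtain a b where l: "l = [:a, b:]"
    using assms(1) by (cases l rule: pCons_cases) (metis One_nat_def degree_eq_zeroE degree_pCons_eq_if le_zero_eq not_less_eq_eq pCons_0_0)
  have "of_real a + z * of_real b = 0" using assms(2) unfolding l by simp
  then have "a + Re z * b = 0" "Im z * b = 0" by (simp_all add: complex_eq_iff)
  then show ?thesis using assms(3) l by auto
qed

text \<open>The quadratic is the real minimal polynomial of \<beta>: the remainder of p has degree
  at most 1, and a real polynomial of that degree vanishing at a nonreal point is 0.\<close>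

lemma dvd_real_quadratic_iff:
  assumes "Im \<beta> \<noteq> 0"
  defines "q \<equiv> [:(cmod \<beta>)\<^sup>2, - 2 * Re \<beta>, 1:]"
  shows "q dvd p \<longleftrightarrow> poly (cx p) \<beta> = 0"
proof -
  have q: "poly (cx q) \<beta> = 0"
    by (simp add: q_def complex_eq_iff cmod_def) (simp add: algebra_simps power2_eq_square)
  have d: "p = q * (p div q) + p mod q" by simp
  have "poly (cx p) \<beta> = poly (cx q) \<beta> * poly (cx (p div q)) \<beta> + poly (cx (p mod q)) \<beta>"
    by (subst d) (simp only: cx_simps poly_add poly_mult)
  then have e: "poly (cx p) \<beta> = poly (cx (p mod q)) \<beta>" using q by simp
  have "degree q = 2" by (simp add: q_def)
  then have "p mod q = 0 \<or> degree (p mod q) < 2" by (metis degree_0 degree_mod_less zero_neq_numeral)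
  then have "degree (p mod q) \<le> 1" by auto
  then have "poly (cx (p mod q)) \<beta> = 0 \<longleftrightarrow> p mod q = 0"
    using cx_linear_root_nonreal assms(1) by auto
  then show ?thesis using e by (simp add: dvd_eq_mod_eq_0)
qed

text \<open>In the pencil q - c f of real quadratics, starting from the definite q at c = 0, the
  discriminant reaches 0 before the outer coefficients turn negative. At that c the member of the
  pencil is the square of a real linear polynomial.\<close>

lemma split_off_definite_quadratic:
  fixes \<alpha> \<gamma> \<delta> b e :: real
  assumes "\<alpha> > 0" "\<gamma> > 0" "b\<^sup>2 < 4 * e"
  obtains c l where "c > 0" "degree l \<le> 1" "[:e, b, 1:] = l\<^sup>2 + smult c [:\<gamma>, \<delta>, \<alpha>:]"
proof -
  \<comment> \<open>The discriminant of q - c f. It is negative at 0, and at \<open>c0\<close>,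
    where the first of the two outer coefficients vanishes, it is a square.\<close>
  define h where "h = (\<lambda>c. (b - c * \<delta>)\<^sup>2 - 4 * (1 - c * \<alpha>) * (e - c * \<gamma>))"
  define c0 where "c0 = min (1 / \<alpha>) (e / \<gamma>)"
  have e: "e > 0" using assms(3) zero_le_power2[of b] by linarith
  have c0: "c0 > 0" using assms e by (simp add: c0_def)
  have "(1 - c0 * \<alpha>) * (e - c0 * \<gamma>) = 0" using assms by (auto simp: c0_def min_def)
  then have "h c0 \<ge> 0" by (simp only: h_def mult.assoc mult_zero_right diff_zero zero_le_power2)
  moreover have "h 0 \<le> 0" using assms by (simp add: h_def)
  moreover have "\<forall>x. 0 \<le> x \<and> x \<le> c0 \<longrightarrow> isCont h x" unfolding h_def by (intro allI impI continuous_intros)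
  ultimately obtain c where c: "0 \<le> c" "c \<le> c0" "h c = 0" using IVT[of h 0 0 c0] c0 by auto
  have "h 0 \<noteq> 0" using assms by (simp add: h_def)
  then have cpos: "c > 0" using c by (cases "c = 0") auto
  define u where "u = 1 - c * \<alpha>"
  define w where "w = e - c * \<gamma>"
  define v where "v = b - c * \<delta>"
  have "c * \<alpha> \<le> 1" "c * \<gamma> \<le> e" using c(2) assms by (auto simp: c0_def pos_le_divide_eq)
  then have uw: "u \<ge> 0" "w \<ge> 0" by (auto simp: u_def w_def)
  have "v\<^sup>2 = 4 * u * w" using c(3) by (simp add: h_def u_def v_def w_def)
  then have "v\<^sup>2 = (2 * (sqrt u * sqrt w))\<^sup>2" using uw by (simp add: power_mult_distrib)
  then have "v = 2 * (sqrt u * sqrt w) \<or> v = - (2 * (sqrt u * sqrt w))" by (simp only: power2_eq_iff)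
  then obtain \<sigma> :: real where \<sigma>: "\<sigma>\<^sup>2 = 1" "v = 2 * \<sigma> * (sqrt u * sqrt w)"
  proof
    assume "v = 2 * (sqrt u * sqrt w)" then show ?thesis using that[of 1] by simp
  next
    assume "v = - (2 * (sqrt u * sqrt w))" then show ?thesis using that[of "-1"] by simp
  qed
  define l where "l = [:\<sigma> * sqrt w, sqrt u:]"
  have "l\<^sup>2 = [:\<sigma>\<^sup>2 * (sqrt w)\<^sup>2, 2 * \<sigma> * (sqrt u * sqrt w), (sqrt u)\<^sup>2:]"
    by (simp add: l_def power2_eq_square algebra_simps)
  also have "\<dots> = [:w, v, u:]" using uw \<sigma> by simp
  finally have "[:e, b, 1:] = l\<^sup>2 + smult c [:\<gamma>, \<delta>, \<alpha>:]" by (simp add: u_def v_def w_def)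
  moreover have "degree l \<le> 1" by (simp add: l_def)
  ultimately show ?thesis using that cpos by blast
qed

text \<open>A positive H is a positive constant times real quadratics q without real roots. Each q
  is a norm l^2 + c f with c > 0, so it can be removed and halves the count: q does not divide l
  because f and H share no root, nor the cofactor because the roots of H are simple. A positive
  constant has two solutions.\<close>

lemma card_norm_sols:
  fixes f H :: "real poly"
  assumes f: "f = [:\<gamma>, \<delta>, \<alpha>:]" "\<alpha> > 0" "\<gamma> > 0"
  shows "degree H = 2 * n \<Longrightarrow> (\<And>x. poly H x > 0) \<Longrightarrow>
    (\<And>z. poly (cx H) z = 0 \<Longrightarrow> poly (pderiv (cx H)) z \<noteq> 0) \<Longrightarrow>
    (\<And>z. poly (cx H) z = 0 \<Longrightarrow> poly (cx f) z \<noteq> 0) \<Longrightarrow>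
    finite (norm_sols f H) \<and> card (norm_sols f H) = 2 ^ Suc n"
proof (induction n arbitrary: H)
  case 0
  then obtain c where c: "H = [:c:]" by (metis degree_eq_zeroE mult_0_right)
  then have "c > 0" using 0(2)[of 0] by simp
  then have "norm_sols f H = {([:sqrt c:], 0), ([:- sqrt c:], 0)}"
    unfolding c by (intro norm_sols_const) (use f in auto)
  moreover have "sqrt c \<noteq> - sqrt c" using \<open>c > 0\<close> real_sqrt_gt_zero[of c] by linarith
  ultimately show ?case by simp
next
  case (Suc n)
  have "degree (cx H) \<noteq> 0" using Suc.prems(1) by (simp add: degree_of_real_poly)
  then have "\<not> constant (poly (cx H))" by (simp add: constant_degree)
  then obtain \<beta> where \<beta>: "poly (cx H) \<beta> = 0" using fundamental_theorem_of_algebra by blast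
  have im: "Im \<beta> \<noteq> 0"
  proof
    assume "Im \<beta> = 0"
    then have "\<beta> = of_real (Re \<beta>)" by (simp add: complex_eq_iff)
    then have "poly H (Re \<beta>) = 0" using \<beta> by (metis of_real_eq_0_iff poly_cx_of_real)
    then show False using Suc.prems(2)[of "Re \<beta>"] by simp
  qed
  define q where "q = [:(cmod \<beta>)\<^sup>2, - 2 * Re \<beta>, 1:]"
  note qdvd = dvd_real_quadratic_iff[OF im, folded q_def]
  have q\<beta>: "poly (cx q) \<beta> = 0" using qdvd[of q] by simp
  obtain H' where H': "H = q * H'" using qdvd[of H] \<beta> by (auto elim: dvdE)
  have q0: "q \<noteq> 0" by (simp add: q_def)
  have "\<not> is_unit q" by (simp add: q_def is_unit_pCons_iff)
  then have pq: "prime_elem q"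
    by (intro prime_elemI q0) (simp_all only: qdvd cx_simps poly_mult mult_eq_0_iff not_False_eq_True)
  have "(2 * Re \<beta>)\<^sup>2 < 4 * (cmod \<beta>)\<^sup>2" using im by (simp add: cmod_power2 power_mult_distrib)
  then have "(- 2 * Re \<beta>)\<^sup>2 < 4 * (cmod \<beta>)\<^sup>2" by simp
  from split_off_definite_quadratic[OF f(2,3) this, of \<delta>]
  obtain c l where c: "c > 0" and l: "degree l \<le> 1" and ql: "q = l\<^sup>2 + smult c f"
    unfolding f(1) q_def by blast
  have f\<beta>: "poly (cx f) \<beta> \<noteq> 0" using Suc.prems(4) \<beta> by blast
  have ndl: "\<not> q dvd l"
  proof
    assume "q dvd l"
    then have "l = 0" using qdvd cx_linear_root_nonreal[OF l _ im] by blast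
    then show False using ql q\<beta> f\<beta> c by simp
  qed
  have ndH: "\<not> q dvd H'"
  proof
    assume "q dvd H'"
    then have "poly (cx H') \<beta> = 0" using qdvd by blast
    then have "poly (pderiv (cx H)) \<beta> = 0" unfolding H' using q\<beta> by (simp add: pderiv_mult)
    then show False using Suc.prems(3) \<beta> by blast
  qed
  have H0: "H' \<noteq> 0" using H' Suc.prems(1) by auto
  have dH: "degree H' = 2 * n"
    using Suc.prems(1) q0 H0 unfolding H' by (simp add: degree_mult_eq) (simp add: q_def)
  have qpos: "poly q x > 0" for x
  proof -
    have "poly q x = (x - Re \<beta>)\<^sup>2 + (Im \<beta>)\<^sup>2"
      unfolding q_def cmod_power2 by (simp add: power2_eq_square algebra_simps)
    also have "\<dots> > 0" using im by (simp add: add_nonneg_pos)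
    finally show ?thesis .
  qed
  have "finite (norm_sols f H') \<and> card (norm_sols f H') = 2 ^ Suc n"
  proof (rule Suc.IH[OF dH])
    show "poly H' x > 0" for x using Suc.prems(2)[of x] qpos[of x] by (simp add: H' zero_less_mult_iff)
    fix z assume z: "poly (cx H') z = 0"
    then have zH: "poly (cx H) z = 0" by (simp add: H')
    then show "poly (cx f) z \<noteq> 0" by (rule Suc.prems(4))
    show "poly (pderiv (cx H')) z \<noteq> 0"
      using Suc.prems(3)[OF zH] z unfolding H' by (auto simp: pderiv_mult)
  qed
  moreover have "q = l\<^sup>2 + [:sqrt c:]\<^sup>2 * f" using ql c by (simp add: power2_eq_square)
  ultimately show ?case
    using card_norm_sols_mult[OF pq _ ndl ndH, of "[:sqrt c:]" f] unfolding H' by simp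
qed

section \<open>Representations with fixed linear forms at s = 0\<close>

lemma degree_sum_squares:
  fixes p q :: "'a::linordered_idom poly"
  assumes "degree (p\<^sup>2 + q) \<le> 2 * n" "q = 0 \<or> lead_coeff q > 0"
  shows "degree p \<le> n" "degree q \<le> 2 * n"
proof -
  have "degree (p\<^sup>2) \<le> 2 * n \<and> degree q \<le> 2 * n"
  proof (cases "p = 0 \<or> q = 0")
    case False
    then have "lead_coeff (p\<^sup>2) > 0" "lead_coeff q > 0" using assms(2) by (auto simp: lead_coeff_power)
    then show ?thesis using degree_add_pos_lead_coeff[of q "p\<^sup>2"] degree_add_pos_lead_coeff[of "p\<^sup>2" q] assms(1)
      by (simp add: add.commute)
  qed (use assms(1) in auto)
  then show "degree p \<le> n" "degree q \<le> 2 * n" by (cases "p = 0"; auto simp: degree_power_eq)+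
qed

lemma lead_coeff_square_pos: "p\<^sup>2 = 0 \<or> lead_coeff (p\<^sup>2) > 0" for p :: "'a::linordered_idom poly"
  by (cases "p = 0") (auto simp: lead_coeff_power)

lemma lead_coeff_sum_pos:
  fixes p q :: "'a::linordered_idom poly"
  assumes "p = 0 \<or> lead_coeff p > 0" "q = 0 \<or> lead_coeff q > 0"
  shows "p + q = 0 \<or> lead_coeff (p + q) > 0"
proof (cases "p = 0 \<or> q = 0")
  case False
  then have pos: "lead_coeff p > 0" "lead_coeff q > 0" using assms by auto
  show ?thesis
  proof (cases "degree p" "degree q" rule: linorder_cases)
    case less
    have "lead_coeff (p + q) = lead_coeff q" by (rule lead_coeff_add_le[OF less])
    then show ?thesis using pos by metis
  next
    case equal
    have c: "coeff (p + q) (degree q) > 0" using pos equal by (simp add: add_pos_pos)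
    have "degree (p + q) \<le> degree q" using equal degree_add_le_max[of p q] by simp
    moreover have "degree q \<le> degree (p + q)" using c by (intro le_degree) simp
    ultimately have "degree (p + q) = degree q" by (rule le_antisym)
    then show ?thesis using c by metis
  next
    case greater
    have "lead_coeff (q + p) = lead_coeff p" by (rule lead_coeff_add_le[OF greater])
    then show ?thesis using pos add.commute[of p q] by metis
  qed
qed (use assms in auto)

text \<open>The pair (L2, L3) is in triangular form with positive diagonal r, \<mu>. This
  normalization uses up the O(2) freedom, so completions of the pair correspond to orbits.\<close>

locale gauge_fixed =
  fixes F2 F3 F4 L2 L3 :: "real poly" and m r \<mu> :: real
  assumes r: "r > 0" and \<mu>: "\<mu> > 0"
    and L2: "L2 = [:m, r:]" and L3: "L3 = [:\<mu>:]"
    and F2: "F2 = L2\<^sup>2 + L3\<^sup>2"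
    and ndvd: "\<not> F2 dvd F3"
    and D_deg: "degree (4 * F2 * F4 - F3\<^sup>2) = 6"
    and D_pos: "\<And>x. poly (4 * F2 * F4 - F3\<^sup>2) x > 0"
    and D_simple: "\<And>z. poly (cx (4 * F2 * F4 - F3\<^sup>2)) z = 0 \<Longrightarrow> poly (pderiv (cx (4 * F2 * F4 - F3\<^sup>2))) z \<noteq> 0"
begin

definition D where "D = 4 * F2 * F4 - F3\<^sup>2"
text \<open>The root of F2 = (L2 + \<i> L3)(L2 - \<i> L3) at which L2 = \<i> L3; F2 is its minimal
  polynomial up to a scalar.\<close>

definition \<rho> where "\<rho> = (\<i> * of_real \<mu> - of_real m) / of_real r"

definition triples :: "(real poly \<times> real poly \<times> real poly) set" where
  "triples = {(A, Q2, Q3). F3 = smult 2 (L2 * Q2 + L3 * Q3) \<and> F4 = A\<^sup>2 + Q2\<^sup>2 + Q3\<^sup>2}"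

lemma Im_\<rho>: "Im \<rho> \<noteq> 0"
  using r \<mu> by (simp add: \<rho>_def)

lemma at_\<rho>: "poly (cx L2) \<rho> = \<i> * of_real \<mu>" "poly (cx L3) \<rho> = of_real \<mu>" "poly (cx F2) \<rho> = 0"
proof -
  show 1: "poly (cx L2) \<rho> = \<i> * of_real \<mu>" using r by (simp add: L2 \<rho>_def)
  show 2: "poly (cx L3) \<rho> = of_real \<mu>" by (simp add: L3)
  show "poly (cx F2) \<rho> = 0" using 1 2 by (simp add: F2 power_mult_distrib)
qed

lemma F2_dvd_iff: "F2 dvd p \<longleftrightarrow> poly (cx p) \<rho> = 0"
proof -
  have re: "Re \<rho> = - m / r" "Im \<rho> = \<mu> / r" by (simp_all add: \<rho>_def)
  have "F2 = smult (r\<^sup>2) [:(cmod \<rho>)\<^sup>2, - 2 * Re \<rho>, 1:]"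
    unfolding F2 L2 L3 cmod_power2 re using r by (simp add: power2_eq_square field_simps)
  then have "F2 dvd p \<longleftrightarrow> [:(cmod \<rho>)\<^sup>2, - 2 * Re \<rho>, 1:] dvd p" using r by (simp only: smult_dvd_iff) simp
  then show ?thesis using dvd_real_quadratic_iff[OF Im_\<rho>, of p] by simp
qed

lemma F3_\<rho>: "poly (cx F3) \<rho> \<noteq> 0"
  using ndvd F2_dvd_iff by blast

lemma F2_nz: "F2 \<noteq> 0"
  using r by (auto simp: F2 L2 L3 power2_eq_square)

text \<open>Lagrange's identity for the vectors (L2, L3) and (Q2, Q3): squared inner product plus
  squared determinant is the product of the squared lengths.\<close>

lemma norm_D:
  assumes "F3 = smult 2 (L2 * Q2 + L3 * Q3)" "F4 = A\<^sup>2 + Q2\<^sup>2 + Q3\<^sup>2"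
  shows "(2 * (L2 * Q3 - L3 * Q2))\<^sup>2 + F2 * (2 * A)\<^sup>2 = D"
proof -
  have "F3 = 2 * (L2 * Q2 + L3 * Q3)" using assms(1) by (simp add: numeral_poly)
  then show ?thesis unfolding D_def unfolding assms(2) F2 by (simp add: algebra_simps power2_eq_square)
qed

lemma root_cases: "(\<eta>, B) \<in> norm_sols F2 D \<Longrightarrow>
  poly (cx \<eta>) \<rho> = \<i> * poly (cx F3) \<rho> \<or> poly (cx \<eta>) \<rho> = - (\<i> * poly (cx F3) \<rho>)"
proof -
  assume "(\<eta>, B) \<in> norm_sols F2 D"
  then have "\<eta>\<^sup>2 + F2 * B\<^sup>2 = D" by (simp add: norm_sols_def)
  then have "poly (cx (\<eta>\<^sup>2 + F2 * B\<^sup>2)) \<rho> = poly (cx D) \<rho>" by (rule arg_cong)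
  then have "(poly (cx \<eta>) \<rho>)\<^sup>2 = (\<i> * poly (cx F3) \<rho>)\<^sup>2"
    by (simp add: D_def at_\<rho> power_mult_distrib)
  then show ?thesis by (simp only: power2_eq_iff)
qed

text \<open>At \<rho> the equation only fixes \<eta> up to sign. For \<eta> = 2 (L2 Q3 - L3 Q2) the
  relation L2 = \<i> L3 selects this sign, and negating \<eta> exchanges the two halves.\<close>

definition half where "half = {(\<eta>, B) \<in> norm_sols F2 D. poly (cx \<eta>) \<rho> = \<i> * poly (cx F3) \<rho>}"

lemma card_half: "finite half \<and> card half = 8"
proof -
  have F2e: "F2 = [:m\<^sup>2 + \<mu>\<^sup>2, 2 * m * r, r\<^sup>2:]"
    by (simp add: F2 L2 L3 power2_eq_square algebra_simps)
  have "finite (norm_sols F2 D) \<and> card (norm_sols F2 D) = 2 ^ Suc 3"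
  proof (rule card_norm_sols[OF F2e])
    show "r\<^sup>2 > 0" "m\<^sup>2 + \<mu>\<^sup>2 > 0" using r \<mu> by (auto simp: add_nonneg_pos)
    show "degree D = 2 * 3" using D_deg by (simp add: D_def)
    show "poly D x > 0" for x using D_pos by (simp add: D_def)
    fix z assume z: "poly (cx D) z = 0"
    then show "poly (pderiv (cx D)) z \<noteq> 0" using D_simple unfolding D_def by blast
    show "poly (cx F2) z \<noteq> 0"
    proof
      \<comment> \<open>A common root of F2 and D is a root of F3. The roots of F2 are \<rho> and
        its conjugate, where F3 does not vanish because F2 does not divide it.\<close>
      assume f: "poly (cx F2) z = 0"
      then have F3z: "poly (cx F3) z = 0" using z by (simp add: D_def)
      have "(poly (cx L2) z)\<^sup>2 = (\<i> * of_real \<mu>)\<^sup>2"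
        using f by (simp add: F2 L3 power_mult_distrib eq_neg_iff_add_eq_0)
      then have "poly (cx L2) z = \<i> * of_real \<mu> \<or> poly (cx L2) z = - (\<i> * of_real \<mu>)" by (simp only: power2_eq_iff)
      then have "of_real r * z = \<i> * of_real \<mu> - of_real m \<or> of_real r * z = - (\<i> * of_real \<mu>) - of_real m"
        by (auto simp: L2 algebra_simps)
      then have "z = \<rho> \<or> z = cnj \<rho>" using r by (auto simp: \<rho>_def field_simps)
      then have "poly (cx F3) \<rho> = 0" using F3z poly_cx_cnj[of F3 \<rho>] by auto
      then show False using F3_\<rho> by blast
    qed
  qed
  then have fin: "finite (norm_sols F2 D)" and c16: "card (norm_sols F2 D) = 16" by auto
  define g where "g = (\<lambda>z :: real poly \<times> real poly. (- fst z, snd z))"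
  have inj: "inj_on g half" by (auto simp: inj_on_def g_def prod_eq_iff)
  have disj: "half \<inter> g ` half = {}"
  proof (rule ccontr)
    assume "half \<inter> g ` half \<noteq> {}"
    then obtain w where w: "w \<in> half" "g w \<in> half" by blast
    then have "poly (cx (fst w)) \<rho> = \<i> * poly (cx F3) \<rho>" "- poly (cx (fst w)) \<rho> = \<i> * poly (cx F3) \<rho>"
      by (auto simp: half_def g_def)
    then show False using F3_\<rho> by (simp add: minus_equation_iff)
  qed
  have "norm_sols F2 D = half \<union> g ` half"
  proof (intro equalityI subsetI)
    fix w assume w: "w \<in> norm_sols F2 D"
    obtain \<eta> B where e: "w = (\<eta>, B)" by (cases w)
    show "w \<in> half \<union> g ` half"
    proof (cases "poly (cx \<eta>) \<rho> = \<i> * poly (cx F3) \<rho>")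
      case True
      then show ?thesis using w e by (simp add: half_def)
    next
      case False
      then have "poly (cx \<eta>) \<rho> = - (\<i> * poly (cx F3) \<rho>)" using root_cases w e by blast
      then have "(- \<eta>, B) \<in> half" using w e by (simp add: half_def norm_sols_def)
      moreover have "w = g (- \<eta>, B)" by (simp add: g_def e)
      ultimately show ?thesis by blast
    qed
  next
    fix w assume "w \<in> half \<union> g ` half"
    then show "w \<in> norm_sols F2 D" by (auto simp: half_def g_def norm_sols_def)
  qed
  moreover have fh: "finite half" using fin unfolding half_def by (rule rev_finite_subset) auto
  ultimately have "16 = card half + card half" using c16 inj disj by (simp add: card_Un_disjoint card_image)
  then show ?thesis using fh by simp
qed

text \<open>The inner product F3/2 and the determinant \<eta>/2 of (L2, L3) and (Q2, Q3) determine
  the latter by Cramer's rule with determinant F2. The quotients are polynomials precisely when the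
  numerators vanish at \<rho>, which is the sign condition in \<open>half\<close>.\<close>

lemma bij_triples_half:
  "bij_betw (\<lambda>(A, Q2, Q3). (2 * (L2 * Q3 - L3 * Q2), 2 * A)) triples half"
proof (rule bij_betwI')
  fix x y assume xy: "x \<in> triples" "y \<in> triples"
  obtain A Q2 Q3 where x: "x = (A, Q2, Q3)" by (cases x)
  obtain A' Q2' Q3' where y: "y = (A', Q2', Q3')" by (cases y)
  have two: "(2 :: real poly) \<noteq> 0" by simp
  show "((case x of (A, Q2, Q3) \<Rightarrow> (2 * (L2 * Q3 - L3 * Q2), 2 * A)) =
         (case y of (A, Q2, Q3) \<Rightarrow> (2 * (L2 * Q3 - L3 * Q2), 2 * A))) = (x = y)"
  proof
    assume "(case x of (A, Q2, Q3) \<Rightarrow> (2 * (L2 * Q3 - L3 * Q2), 2 * A)) =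
         (case y of (A, Q2, Q3) \<Rightarrow> (2 * (L2 * Q3 - L3 * Q2), 2 * A))"
    then have a: "A = A'" and e: "L2 * Q3 - L3 * Q2 = L2 * Q3' - L3 * Q2'"
      unfolding x y by (simp_all only: prod.case prod.inject mult_left_cancel[OF two])
    have "smult 2 (L2 * Q2 + L3 * Q3) = smult 2 (L2 * Q2' + L3 * Q3')" using xy unfolding x y triples_def by simp
    then have e2: "L2 * Q2 + L3 * Q3 = L2 * Q2' + L3 * Q3'" by (metis smult_eq_iff zero_neq_numeral)
    have "F2 * Q2 = L2 * (L2 * Q2 + L3 * Q3) - L3 * (L2 * Q3 - L3 * Q2)" "F2 * Q3 = L3 * (L2 * Q2 + L3 * Q3) + L2 * (L2 * Q3 - L3 * Q2)"
      "F2 * Q2' = L2 * (L2 * Q2' + L3 * Q3') - L3 * (L2 * Q3' - L3 * Q2')" "F2 * Q3' = L3 * (L2 * Q2' + L3 * Q3') + L2 * (L2 * Q3' - L3 * Q2')"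
      unfolding F2 by (simp_all add: algebra_simps power2_eq_square)
    then have "F2 * Q2 = F2 * Q2'" "F2 * Q3 = F2 * Q3'" using e e2 by metis+
    then show "x = y" using a F2_nz by (simp add: x y)
  qed simp
next
  fix x assume "x \<in> triples"
  then obtain A Q2 Q3 where x: "x = (A, Q2, Q3)" and h: "F3 = smult 2 (L2 * Q2 + L3 * Q3)" "F4 = A\<^sup>2 + Q2\<^sup>2 + Q3\<^sup>2"
    by (auto simp: triples_def)
  have "poly (cx (2 * (L2 * Q3 - L3 * Q2))) \<rho> = \<i> * poly (cx F3) \<rho>"
    unfolding h(1) by (simp add: at_\<rho> algebra_simps)
  then have "(2 * (L2 * Q3 - L3 * Q2), 2 * A) \<in> half"
    using norm_D[OF h] by (simp only: half_def norm_sols_def mem_Collect_eq prod.case)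
  then show "(case x of (A, Q2, Q3) \<Rightarrow> (2 * (L2 * Q3 - L3 * Q2), 2 * A)) \<in> half"
    by (simp only: x prod.case)
next
  fix y assume "y \<in> half"
  then obtain \<eta> B where y: "y = (\<eta>, B)" and n: "\<eta>\<^sup>2 + F2 * B\<^sup>2 = D" and e: "poly (cx \<eta>) \<rho> = \<i> * poly (cx F3) \<rho>"
    by (auto simp: half_def norm_sols_def)
  have "F2 dvd L2 * F3 - L3 * \<eta>" "F2 dvd L3 * F3 + L2 * \<eta>"
    unfolding F2_dvd_iff using e at_\<rho> by (simp_all add: algebra_simps)
  then obtain p q where pq: "L2 * F3 - L3 * \<eta> = F2 * p" "L3 * F3 + L2 * \<eta> = F2 * q" unfolding dvd_def by blast
  define Q2 where "Q2 = smult (1/2) p"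
  define Q3 where "Q3 = smult (1/2) q"
  define A where "A = smult (1/2) B"
  have dbl: "p = 2 * Q2" "q = 2 * Q3" "B = 2 * A" by (simp_all add: Q2_def Q3_def A_def numeral_poly)
  have "F2 * F3 = L2 * (L2 * F3 - L3 * \<eta>) + L3 * (L3 * F3 + L2 * \<eta>)"
    unfolding F2 by (simp add: algebra_simps power2_eq_square)
  also have "\<dots> = F2 * (2 * (L2 * Q2 + L3 * Q3))" unfolding pq dbl by (simp add: algebra_simps)
  finally have 1: "F3 = 2 * (L2 * Q2 + L3 * Q3)" by (simp only: mult_left_cancel[OF F2_nz])
  have "F2 * \<eta> = L2 * (L3 * F3 + L2 * \<eta>) - L3 * (L2 * F3 - L3 * \<eta>)"
    unfolding F2 by (simp add: algebra_simps power2_eq_square)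
  also have "\<dots> = F2 * (2 * (L2 * Q3 - L3 * Q2))" unfolding pq dbl by (simp add: algebra_simps)
  finally have 2: "\<eta> = 2 * (L2 * Q3 - L3 * Q2)" by (simp only: mult_left_cancel[OF F2_nz])
  have "(4 * F2) * F4 = \<eta>\<^sup>2 + F2 * B\<^sup>2 + F3\<^sup>2" unfolding n D_def by simp
  also have "\<dots> = (4 * F2) * (A\<^sup>2 + Q2\<^sup>2 + Q3\<^sup>2)"
    unfolding 1 2 dbl F2 by (simp add: algebra_simps power2_eq_square)
  finally have E: "(4 * F2) * F4 = (4 * F2) * (A\<^sup>2 + Q2\<^sup>2 + Q3\<^sup>2)" .
  have N: "4 * F2 \<noteq> 0" using F2_nz by simp
  have "F4 = A\<^sup>2 + Q2\<^sup>2 + Q3\<^sup>2" by (rule mult_left_cancel[OF N, THEN iffD1, OF E])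
  moreover have "F3 = smult 2 (L2 * Q2 + L3 * Q3)" by (subst 1) (simp add: numeral_poly)
  ultimately have "(A, Q2, Q3) \<in> triples" unfolding triples_def by blast
  then show "\<exists>x\<in>triples. y = (case x of (A, Q2, Q3) \<Rightarrow> (2 * (L2 * Q3 - L3 * Q2), 2 * A))"
    using 2 dbl(3) y by (intro bexI[of _ "(A, Q2, Q3)"]) simp_all
qed

lemma card_triples: "finite triples \<and> card triples = 8"
  using bij_betw_same_card[OF bij_triples_half] bij_betw_finite[OF bij_triples_half] card_half by simp

text \<open>D is a combination of the squares of the two polynomials, so a common zero would be a
  double root of D.\<close>

lemma coprime_at:
  assumes "(A, Q2, Q3) \<in> triples"
  shows "\<not> (poly (cx A) z = 0 \<and> poly (cx (L2 * Q3 - L3 * Q2)) z = 0)"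
proof
  assume z: "poly (cx A) z = 0 \<and> poly (cx (L2 * Q3 - L3 * Q2)) z = 0"
  have h: "(2 * (L2 * Q3 - L3 * Q2))\<^sup>2 + F2 * (2 * A)\<^sup>2 = D"
    using assms norm_D by (auto simp: triples_def)
  define E where "E = cx (2 * (L2 * Q3 - L3 * Q2))"
  have d: "cx D = E\<^sup>2 + cx F2 * (2 * cx A)\<^sup>2" unfolding h[symmetric] E_def by simp
  have E0: "poly E z = 0" using z by (simp add: E_def)
  have "poly (cx D) z = 0" using E0 z by (simp add: d)
  moreover have "poly (pderiv (cx D)) z = 0" unfolding d using E0 z
    by (simp add: pderiv_add pderiv_mult power2_eq_square)
  ultimately show False using D_simple unfolding D_def by blast
qed

text \<open>With A = 0 the polynomial D would be the square of a nonconstant polynomial and have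
  double roots. This makes the sign change of A free of fixed points.\<close>

lemma A_nonzero:
  assumes "(A, Q2, Q3) \<in> triples"
  shows "A \<noteq> 0"
proof
  assume "A = 0"
  define p where "p = L2 * Q3 - L3 * Q2"
  have "(2 * p)\<^sup>2 = D" unfolding p_def using \<open>A = 0\<close> norm_D[of Q2 Q3 A] assms by (auto simp: triples_def)
  then have d: "degree ((2 * p)\<^sup>2) = 6" using D_deg by (simp add: D_def)
  have "degree p \<noteq> 0"
  proof
    assume "degree p = 0"
    then obtain c where "p = [:c:]" by (rule degree_eq_zeroE)
    then show False using d by (simp add: power2_eq_square numeral_poly)
  qed
  then have "\<not> constant (poly (cx p))" by (simp add: constant_degree degree_of_real_poly)
  then obtain z where "poly (cx p) z = 0" using fundamental_theorem_of_algebra by blast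
  then show False using coprime_at[OF assms, of z] \<open>A = 0\<close> by (simp add: p_def)
qed

text \<open>Leading coefficients of real squares cannot cancel, so the degree of F4 bounds all three
  summands.\<close>

lemma degree_triples:
  assumes "(A, Q2, Q3) \<in> triples" "degree F4 \<le> 4"
  shows "degree A \<le> 2" "degree Q2 \<le> 2" "degree Q3 \<le> 2"
proof -
  have F4: "F4 = A\<^sup>2 + (Q2\<^sup>2 + Q3\<^sup>2)" using assms by (auto simp: triples_def)
  have 1: "degree (A\<^sup>2 + (Q2\<^sup>2 + Q3\<^sup>2)) \<le> 2 * 2" using assms(2) F4 by simp
  note l = lead_coeff_sum_pos[OF lead_coeff_square_pos[of Q2] lead_coeff_square_pos[of Q3]]
  show "degree A \<le> 2" using degree_sum_squares(1)[OF 1 l] .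
  note 2 = degree_sum_squares(2)[OF 1 l]
  show "degree Q2 \<le> 2" using degree_sum_squares(1)[OF 2 lead_coeff_square_pos] .
  note 3 = degree_sum_squares(2)[OF 2 lead_coeff_square_pos]
  then show "degree Q3 \<le> 2" using degree_sum_squares(1)[of Q3 0 2] by simp
qed

end

section \<open>Constancy of the number of orbits in a family\<close>

lemma card_image_eq:
  assumes "\<And>x y. x \<in> W \<Longrightarrow> y \<in> W \<Longrightarrow> f x = f y \<longleftrightarrow> g x = g y"
  shows "card (f ` W) = card (g ` W)"
proof -
  define h where "h = (\<lambda>c. g (inv_into W f c))"
  have h: "h (f x) = g x" if "x \<in> W" for x
    using assms[of "inv_into W f (f x)" x] that by (simp add: h_def inv_into_into f_inv_into_f)
  have "inj_on h (f ` W)"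
  proof (rule inj_onI)
    fix a b assume "a \<in> f ` W" "b \<in> f ` W" "h a = h b"
    then obtain x y where "x \<in> W" "y \<in> W" "a = f x" "b = f y" by blast
    then show "a = b" using \<open>h a = h b\<close> h assms by metis
  qed
  moreover have "h ` (f ` W) = g ` W" using h by force
  ultimately show ?thesis by (metis card_image)
qed

text \<open>\<open>R_separate\<close> says that R is closed, \<open>R_open\<close> that orbits vary
  openly. \<open>local_unique\<close> forbids nearby fibres to contain two orbits close to a given
  point, \<open>local_exist\<close> forbids an orbit to disappear, and compactness forbids new ones
  to arrive from elsewhere.\<close>

locale orbit_family =
  fixes Z :: "real \<Rightarrow> 'v::{metric_space} set" and R :: "'v \<Rightarrow> 'v \<Rightarrow> bool"
  assumes R_refl: "R x x"
    and R_sym: "R x y \<Longrightarrow> R y x"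
    and R_trans: "R x y \<Longrightarrow> R y z \<Longrightarrow> R x z"
    and R_inv: "x \<in> Z s \<Longrightarrow> R x y \<Longrightarrow> y \<in> Z s"
    and R_separate: "\<not> R x y \<Longrightarrow> \<exists>e>0. \<forall>x' y'. dist x' x < e \<longrightarrow> dist y' y < e \<longrightarrow> \<not> R x' y'"
    and R_open: "R x y \<Longrightarrow> e > 0 \<Longrightarrow> \<exists>d>0. \<forall>x'. dist x' x < d \<longrightarrow> (\<exists>y'. R x' y' \<and> dist y' y < e)"
    and Z_compact: "compact {(s, z). s \<in> {0..1} \<and> z \<in> Z s}"
    and local_unique: "s \<in> {0..1} \<Longrightarrow> z \<in> Z s \<Longrightarrow>
      \<exists>e>0. \<exists>d>0. \<forall>s'\<in>{0..1}. \<bar>s' - s\<bar> < d \<longrightarrow>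
        (\<forall>w\<in>Z s'. \<forall>w'\<in>Z s'. dist w z < e \<longrightarrow> dist w' z < e \<longrightarrow> R w w')"
    and local_exist: "s \<in> {0..1} \<Longrightarrow> z \<in> Z s \<Longrightarrow> e > 0 \<Longrightarrow>
      \<exists>d>0. \<forall>s'\<in>{0..1}. \<bar>s' - s\<bar> < d \<longrightarrow> (\<exists>w\<in>Z s'. dist w z < e)"
begin

definition orbits where "orbits s = (\<lambda>z. {w. R z w}) ` Z s"

lemma orbit_eq_iff: "{w. R x w} = {w. R y w} \<longleftrightarrow> R x y"
  using R_refl R_sym R_trans by blast

lemma Z_compact_slice:
  assumes "s \<in> {0..1}"
  shows "compact (Z s)"
proof -
  have "compact ({(s, z). s \<in> {0..1} \<and> z \<in> Z s} \<inter> {s} \<times> UNIV)"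
    by (intro compact_Int_closed Z_compact closed_Times) auto
  then have "compact (snd ` ({(s, z). s \<in> {0..1} \<and> z \<in> Z s} \<inter> {s} \<times> UNIV))"
    by (rule compact_continuous_image[rotated]) (intro continuous_intros)
  moreover have "snd ` ({(s, z). s \<in> {0..1} \<and> z \<in> Z s} \<inter> {s} \<times> UNIV) = Z s"
    using assms by force
  ultimately show ?thesis by simp
qed

text \<open>The parameters with a solution outside U form the projection of a compact set. This set
  is closed and misses \<open>s0\<close>.\<close>

lemma Z_nearby_subset:
  assumes "s0 \<in> {0..1}" "open U" "Z s0 \<subseteq> U"
  shows "\<exists>d>0. \<forall>s\<in>{0..1}. \<bar>s - s0\<bar> < d \<longrightarrow> Z s \<subseteq> U"
proof -
  define K where "K = fst ` ({(s, z). s \<in> {0..1} \<and> z \<in> Z s} \<inter> UNIV \<times> (- U))"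
  have "compact ({(s, z). s \<in> {0..1} \<and> z \<in> Z s} \<inter> UNIV \<times> (- U))"
    by (intro compact_Int_closed Z_compact closed_Times) (use assms in auto)
  then have "compact K" unfolding K_def
    by (rule compact_continuous_image[rotated]) (intro continuous_intros)
  then have "open (- K)" by (simp add: compact_imp_closed open_Compl)
  moreover have "s0 \<in> - K" using assms by (auto simp: K_def)
  ultimately obtain d where d: "d > 0" "ball s0 d \<subseteq> - K" by (meson open_contains_ball)
  have "Z s \<subseteq> U" if s: "s \<in> {0..1}" "\<bar>s - s0\<bar> < d" for s
  proof (rule ccontr)
    assume "\<not> Z s \<subseteq> U"
    then obtain z where "z \<in> Z s" "z \<notin> U" by auto
    then have "s \<in> K" unfolding K_def using s by force
    moreover have "s \<in> ball s0 d" using s by (simp add: dist_real_def)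
    ultimately show False using d by auto
  qed
  then show ?thesis using d(1) by blast
qed

text \<open>Finitely many balls around points of the central fibre cover all nearby fibres, each
  meeting them in a single orbit. Whether two balls carry the same orbit does not change near
  \<open>s0\<close>, so the orbits of every nearby fibre are labelled by the same quotient of the
  finite set of centres.\<close>

lemma card_orbits_locally_constant:
  assumes s0: "s0 \<in> {0..1}"
  shows "\<exists>d>0. \<forall>s\<in>{0..1}. \<bar>s - s0\<bar> < d \<longrightarrow> finite (orbits s) \<and> card (orbits s) = card (orbits s0)"
proof -
  have "\<forall>z\<in>Z s0. \<exists>e d. e > 0 \<and> d > 0 \<and> (\<forall>s'\<in>{0..1}. \<bar>s' - s0\<bar> < d \<longrightarrow>
        (\<forall>w\<in>Z s'. \<forall>w'\<in>Z s'. dist w z < e \<longrightarrow> dist w' z < e \<longrightarrow> R w w'))"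
    using local_unique[OF s0] by blast
  then obtain E where E': "\<forall>z\<in>Z s0. \<exists>d. E z > 0 \<and> d > 0 \<and> (\<forall>s'\<in>{0..1}. \<bar>s' - s0\<bar> < d \<longrightarrow>
        (\<forall>w\<in>Z s'. \<forall>w'\<in>Z s'. dist w z < E z \<longrightarrow> dist w' z < E z \<longrightarrow> R w w'))" by metis
  then obtain dl where E: "\<And>z. z \<in> Z s0 \<Longrightarrow> E z > 0" "\<And>z. z \<in> Z s0 \<Longrightarrow> dl z > 0"
    "\<And>z s' w w'. z \<in> Z s0 \<Longrightarrow> s' \<in> {0..1} \<Longrightarrow> \<bar>s' - s0\<bar> < dl z \<Longrightarrow> w \<in> Z s' \<Longrightarrow> w' \<in> Z s' \<Longrightarrow>
      dist w z < E z \<Longrightarrow> dist w' z < E z \<Longrightarrow> R w w'" by metis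
  have "Z s0 \<subseteq> (\<Union>z\<in>Z s0. ball z (E z))" using E(1) by auto
  then obtain W where W: "W \<subseteq> Z s0" "finite W" "Z s0 \<subseteq> (\<Union>z\<in>W. ball z (E z))"
    by (rule compactE_image[OF Z_compact_slice[OF s0], rotated]) auto
  \<comment> \<open>Three facts make W a set of labels for the fibre over s: the balls cover it,
    none of them is empty, and orbit equivalence can be read off at the centres.\<close>
  define good where "good = (\<lambda>s. s \<in> {0..1} \<and> Z s \<subseteq> (\<Union>z\<in>W. ball z (E z)) \<and>
     (\<forall>w\<in>W. \<exists>y\<in>Z s. dist y w < E w) \<and>
     (\<forall>w\<in>W. \<forall>w'\<in>W. \<forall>y\<in>Z s. \<forall>y'\<in>Z s. dist y w < E w \<longrightarrow> dist y' w' < E w' \<longrightarrow> (R y y' \<longleftrightarrow> R w w')))"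
  have pair: "\<exists>d>0. \<forall>s\<in>{0..1}. \<bar>s - s0\<bar> < d \<longrightarrow>
      (\<forall>y\<in>Z s. \<forall>y'\<in>Z s. dist y w < E w \<longrightarrow> dist y' w' < E w' \<longrightarrow> (R y y' \<longleftrightarrow> R w w'))"
    if w: "w \<in> W" "w' \<in> W" for w w'
  proof -
    have wZ: "w \<in> Z s0" "w' \<in> Z s0" using w W by auto
    show ?thesis
    proof (cases "R w w'")
      case True
      obtain \<delta> where \<delta>: "\<delta> > 0" "\<And>x'. dist x' w < \<delta> \<Longrightarrow> \<exists>y'. R x' y' \<and> dist y' w' < E w'"
        using R_open[OF True E(1)[OF wZ(2)]] by blast
      obtain d where d: "d > 0" "\<And>s. s \<in> {0..1} \<Longrightarrow> \<bar>s - s0\<bar> < d \<Longrightarrow> \<exists>x\<in>Z s. dist x w < min \<delta> (E w)"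
        using local_exist[OF s0 wZ(1), of "min \<delta> (E w)"] \<delta>(1) E(1)[OF wZ(1)] by auto
      show ?thesis
      proof (rule exI[of _ "min d (min (dl w) (dl w'))"], intro conjI ballI impI)
        show "min d (min (dl w) (dl w')) > 0" using d E(2) wZ by simp
        fix s y y'
        assume s: "s \<in> {0..1}" "\<bar>s - s0\<bar> < min d (min (dl w) (dl w'))"
          and y: "y \<in> Z s" "y' \<in> Z s" "dist y w < E w" "dist y' w' < E w'"
        obtain x where x: "x \<in> Z s" "dist x w < \<delta>" "dist x w < E w" using d(2)[of s] s by auto
        obtain x' where x': "R x x'" "dist x' w' < E w'" using \<delta>(2)[OF x(2)] by blast
        have "x' \<in> Z s" using R_inv[OF x(1) x'(1)] .
        then have "R x' y'" using E(3)[OF wZ(2) s(1), of x' y'] s y x' by simp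
        moreover have "R y x" using E(3)[OF wZ(1) s(1), of y x] s y x by simp
        ultimately show "R y y' \<longleftrightarrow> R w w'" using True x'(1) R_trans by blast
      qed
    next
      case False
      obtain \<eta> where \<eta>: "\<eta> > 0" "\<And>x x'. dist x w < \<eta> \<Longrightarrow> dist x' w' < \<eta> \<Longrightarrow> \<not> R x x'"
        using R_separate[OF False] by blast
      obtain d where d: "d > 0" "\<And>s. s \<in> {0..1} \<Longrightarrow> \<bar>s - s0\<bar> < d \<Longrightarrow> \<exists>x\<in>Z s. dist x w < min \<eta> (E w)"
        using local_exist[OF s0 wZ(1), of "min \<eta> (E w)"] \<eta>(1) E(1)[OF wZ(1)] by auto
      obtain d' where d': "d' > 0" "\<And>s. s \<in> {0..1} \<Longrightarrow> \<bar>s - s0\<bar> < d' \<Longrightarrow> \<exists>x\<in>Z s. dist x w' < min \<eta> (E w')"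
        using local_exist[OF s0 wZ(2), of "min \<eta> (E w')"] \<eta>(1) E(1)[OF wZ(2)] by auto
      show ?thesis
      proof (rule exI[of _ "min (min d d') (min (dl w) (dl w'))"], intro conjI ballI impI)
        show "min (min d d') (min (dl w) (dl w')) > 0" using d d' E(2) wZ by simp
        fix s y y'
        assume s: "s \<in> {0..1}" "\<bar>s - s0\<bar> < min (min d d') (min (dl w) (dl w'))"
          and y: "y \<in> Z s" "y' \<in> Z s" "dist y w < E w" "dist y' w' < E w'"
        obtain x where x: "x \<in> Z s" "dist x w < \<eta>" "dist x w < E w" using d(2)[of s] s by auto
        obtain x' where x': "x' \<in> Z s" "dist x' w' < \<eta>" "dist x' w' < E w'" using d'(2)[of s] s by auto
        have "R y' x'" using E(3)[OF wZ(2) s(1), of y' x'] s y x' by simp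
        moreover have "R x y" using E(3)[OF wZ(1) s(1), of x y] s y x by simp
        ultimately have "R y y' \<Longrightarrow> R x x'" using R_trans by blast
        then show "R y y' \<longleftrightarrow> R w w'" using False \<eta>(2)[OF x(2) x'(2)] by blast
      qed
    qed
  qed
  have ex: "\<exists>d>0. \<forall>s\<in>{0..1}. \<bar>s - s0\<bar> < d \<longrightarrow> (\<exists>y\<in>Z s. dist y w < E w)" if "w \<in> W" for w
    using local_exist[OF s0, of w "E w"] E(1)[of w] W that by blast
  obtain d0 where d0: "d0 > 0" "\<forall>s\<in>{0..1}. \<bar>s - s0\<bar> < d0 \<longrightarrow> Z s \<subseteq> (\<Union>z\<in>W. ball z (E z))"
    using Z_nearby_subset[OF s0 _ W(3)] by auto
  have ev: "\<forall>\<^sub>F s in at s0. s \<in> {0..1} \<longrightarrow> P s"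
    if "\<exists>d>0. \<forall>s\<in>{0..1}. \<bar>s - s0\<bar> < d \<longrightarrow> P s" for P :: "real \<Rightarrow> bool"
    using that unfolding eventually_at dist_real_def by blast
  have sat: "P s0" if "\<exists>d>0. \<forall>s\<in>{0..1}. \<bar>s - s0\<bar> < d \<longrightarrow> P s" for P :: "real \<Rightarrow> bool"
    using that s0 by force
  have near: "\<exists>d>0. \<forall>s\<in>{0..1}. \<bar>s - s0\<bar> < d \<longrightarrow> good s"
  proof -
    have 1: "\<forall>\<^sub>F s in at s0. \<forall>w\<in>W. s \<in> {0..1} \<longrightarrow> (\<exists>y\<in>Z s. dist y w < E w)"
      by (intro eventually_ball_finite W(2) ballI ev ex)
    have 2: "\<forall>\<^sub>F s in at s0. \<forall>w\<in>W. \<forall>w'\<in>W. s \<in> {0..1} \<longrightarrow> (\<forall>y\<in>Z s. \<forall>y'\<in>Z s. dist y w < E w \<longrightarrow> dist y' w' < E w' \<longrightarrow> (R y y' \<longleftrightarrow> R w w'))"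
      by (intro eventually_ball_finite W(2) ballI ev pair)
    have 3: "\<forall>\<^sub>F s in at s0. s \<in> {0..1} \<longrightarrow> Z s \<subseteq> (\<Union>z\<in>W. ball z (E z))"
      by (rule ev) (use d0 in blast)
    have "\<forall>\<^sub>F s in at s0. s \<in> {0..1} \<longrightarrow> good s"
      using 1 2 3 by eventually_elim (simp add: good_def)
    then obtain d where d: "d > 0" "\<And>s. s \<noteq> s0 \<Longrightarrow> \<bar>s - s0\<bar> < d \<Longrightarrow> s \<in> {0..1} \<Longrightarrow> good s"
      unfolding eventually_at dist_real_def by auto
    have "good s0" unfolding good_def using s0 W(3) sat[OF ex] sat[OF pair] by blast
    then show ?thesis using d by metis
  qed
  have count: "finite (orbits s) \<and> card (orbits s) = card ((\<lambda>w. {v. R w v}) ` W)" if "good s" for s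
  proof -
    have "\<forall>w\<in>W. \<exists>y. y \<in> Z s \<and> dist y w < E w" using that unfolding good_def by blast
    then obtain p where "\<forall>w\<in>W. p w \<in> Z s \<and> dist (p w) w < E w"
      using bchoice[of W "\<lambda>w y. y \<in> Z s \<and> dist y w < E w"] by blast
    then have p: "\<And>w. w \<in> W \<Longrightarrow> p w \<in> Z s" "\<And>w. w \<in> W \<Longrightarrow> dist (p w) w < E w" by blast+
    have sub: "Z s \<subseteq> (\<Union>z\<in>W. ball z (E z))"
      and RR: "\<And>w w' y y'. w \<in> W \<Longrightarrow> w' \<in> W \<Longrightarrow> y \<in> Z s \<Longrightarrow> y' \<in> Z s \<Longrightarrow>
        dist y w < E w \<Longrightarrow> dist y' w' < E w' \<Longrightarrow> R y y' \<longleftrightarrow> R w w'"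
      using that unfolding good_def by blast+
    have "orbits s = (\<lambda>w. {v. R (p w) v}) ` W"
    proof (intro equalityI subsetI)
      fix c assume "c \<in> orbits s"
      then obtain z where z: "z \<in> Z s" "c = {v. R z v}" unfolding orbits_def by blast
      obtain w where w: "w \<in> W" "dist z w < E w" using sub z(1) by (auto simp: dist_commute)
      have "R z (p w)" using RR[OF w(1) w(1) z(1) p(1)[OF w(1)] w(2) p(2)[OF w(1)]] R_refl by blast
      then show "c \<in> (\<lambda>w. {v. R (p w) v}) ` W" using w(1) z(2) orbit_eq_iff by blast
    next
      fix c assume "c \<in> (\<lambda>w. {v. R (p w) v}) ` W"
      then show "c \<in> orbits s" using p(1) unfolding orbits_def by blast
    qed
    moreover have "card ((\<lambda>w. {v. R (p w) v}) ` W) = card ((\<lambda>w. {v. R w v}) ` W)"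
      by (rule card_image_eq) (unfold orbit_eq_iff, use RR p in blast)
    ultimately show ?thesis using W(2) by simp
  qed
  have "good s0" by (rule sat[OF near])
  then have "card (orbits s0) = card ((\<lambda>w. {v. R w v}) ` W)" using count by blast
  moreover obtain d where "d > 0" "\<forall>s\<in>{0..1}. \<bar>s - s0\<bar> < d \<longrightarrow> good s" using near by blast
  ultimately show ?thesis using count by (intro exI[of _ d]) auto
qed

theorem card_orbits_constant: "card (orbits 1) = card (orbits 0)"
proof -
  have "(\<lambda>s. card (orbits s)) constant_on {0..1}"
  proof (rule locally_constant_imp_constant)
    fix a :: real assume a: "a \<in> {0..1}"
    obtain d where d: "d > 0" "\<forall>s\<in>{0..1}. \<bar>s - a\<bar> < d \<longrightarrow> finite (orbits s) \<and> card (orbits s) = card (orbits a)"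
      using card_orbits_locally_constant[OF a] by blast
    show "\<exists>T. openin (top_of_set {0..1}) T \<and> a \<in> T \<and> (\<forall>x\<in>T. card (orbits x) = card (orbits a))"
    proof (intro exI[of _ "{0..1} \<inter> ball a d"] conjI ballI)
      show "openin (top_of_set {0..1}) ({0..1} \<inter> ball a d)" by (rule openin_open_Int) simp
      show "a \<in> {0..1} \<inter> ball a d" using a d(1) by simp
      fix x assume "x \<in> {0..1} \<inter> ball a d"
      then have "x \<in> {0..1}" "\<bar>x - a\<bar> < d" by (auto simp: dist_real_def)
      then show "card (orbits x) = card (orbits a)" using d(2) by blast
    qed
  qed simp
  then obtain c where "\<And>s. s \<in> {0..1} \<Longrightarrow> card (orbits s) = c" unfolding constant_on_def by blast
  from this[of 0] this[of 1] show ?thesis by simp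
qed

end

section \<open>Representations in normal form\<close>

lemma dist_prod_square: "(dist p q)\<^sup>2 = (dist (fst p) (fst q))\<^sup>2 + (dist (snd p) (snd q))\<^sup>2"
  by (simp add: dist_prod_def)

lemma norm_le_norm_fst_snd: "norm q \<le> norm (fst q) + norm (snd q)"
  using norm_Pair_le[of "fst q" "snd q"] by simp

text \<open>Pairs of distinct points x, y near p with equal image have unit difference vectors
  annihilated by \<open>D (x + y)\<close>. By compactness of the sphere a limit of such vectors is a
  unit vector annihilated by \<open>D (p + p)\<close>.\<close>

lemma locally_injective_quadratic:
  fixes \<Phi> :: "'a::euclidean_space \<Rightarrow> 'b::real_normed_vector" and D :: "'a \<Rightarrow> 'a \<Rightarrow> 'b"
  assumes diff: "\<And>x y. \<Phi> x - \<Phi> y = D (x + y) (x - y)"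
    and scale: "\<And>m h c. D m (c *\<^sub>R h) = c *\<^sub>R D m h"
    and cont: "continuous_on UNIV (\<lambda>z. D (fst z) (snd z))"
    and inj: "\<And>h. D (p + p) h = 0 \<Longrightarrow> h = 0"
  shows "\<exists>e>0. inj_on \<Phi> (ball p e)"
proof (rule ccontr)
  assume no: "\<not> ?thesis"
  have "\<exists>x y. x \<in> ball p (1 / real (Suc n)) \<and> y \<in> ball p (1 / real (Suc n)) \<and> \<Phi> x = \<Phi> y \<and> x \<noteq> y" for n
  proof -
    have "\<not> inj_on \<Phi> (ball p (1 / real (Suc n)))" using no by (metis of_nat_0_less_iff zero_less_Suc zero_less_divide_1_iff)
    then show ?thesis unfolding inj_on_def by blast
  qed
  then obtain x y where xy: "\<And>n. x n \<in> ball p (1 / real (Suc n))" "\<And>n. y n \<in> ball p (1 / real (Suc n))"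
    "\<And>n. \<Phi> (x n) = \<Phi> (y n)" "\<And>n. x n \<noteq> y n" by metis
  define h where "h = (\<lambda>n. (1 / norm (x n - y n)) *\<^sub>R (x n - y n))"
  have h1: "h n \<in> sphere 0 1" for n using xy(4)[of n] by (simp add: h_def)
  have D0: "D (x n + y n) (h n) = 0" for n
    unfolding h_def scale using diff[of "x n" "y n"] xy(3)[of n] by simp
  obtain l r where l: "l \<in> sphere 0 1" "strict_mono r" "(h \<circ> r) \<longlonglongrightarrow> l"
    using compact_sphere[of "0::'a" 1] h1 unfolding compact_def by metis
  have lim: "w \<longlonglongrightarrow> p" if "\<And>n. w n \<in> ball p (1 / real (Suc n))" for w
  proof (rule metric_tendsto_imp_tendsto[OF lim_1_over_n[THEN LIMSEQ_Suc]])
    show "\<forall>\<^sub>F n in sequentially. dist (w n) p \<le> dist (1 / of_nat (Suc n)) (0::real)"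
      using that by (intro always_eventually) (auto simp: dist_commute less_imp_le)
  qed
  have "(\<lambda>n. (x (r n) + y (r n), h (r n))) \<longlonglongrightarrow> (p + p, l)"
    using LIMSEQ_subseq_LIMSEQ[OF lim[OF xy(1)] l(2)] LIMSEQ_subseq_LIMSEQ[OF lim[OF xy(2)] l(2)] l(3)
    by (intro tendsto_intros) (simp_all add: o_def)
  then have "(\<lambda>n. D (fst (x (r n) + y (r n), h (r n))) (snd (x (r n) + y (r n), h (r n)))) \<longlonglongrightarrow> D (fst (p + p, l)) (snd (p + p, l))"
    by (rule continuous_on_tendsto_compose[OF cont]) auto
  then have "D (p + p) l = 0" using D0 by (simp add: LIMSEQ_const_iff)
  then show False using inj l(1) by fastforce
qed

text \<open>A tuple \<open>(a\<^sub>0, a\<^sub>1, a\<^sub>2, u\<^sub>0, u\<^sub>1, v\<^sub>0, v\<^sub>1, v\<^sub>2)\<close> stands for the coefficients of the forms \<open>a\<close>,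
  \<open>l\<^sub>2 + \<i> l\<^sub>3\<close> and \<open>q\<^sub>2 + \<i> q\<^sub>3\<close>, highest power of \<open>x\<close> first. The form \<open>bil\<close> polarizes the
  coefficients of \<open>z\<^sup>2\<close>, \<open>z\<close> and \<open>1\<close> in \<open>(s z\<^sup>2 + a)\<^sup>2 + (l\<^sub>2 z + q\<^sub>2)\<^sup>2 + (l\<^sub>3 z + q\<^sub>3)\<^sup>2\<close>.\<close>
type_synonym sol = "real \<times> real \<times> real \<times> complex \<times> complex \<times> complex \<times> complex \<times> complex"

abbreviation sa0 :: "sol \<Rightarrow> real" where "sa0 z \<equiv> fst z"
abbreviation sa1 :: "sol \<Rightarrow> real" where "sa1 z \<equiv> fst (snd z)"
abbreviation sa2 :: "sol \<Rightarrow> real" where "sa2 z \<equiv> fst (snd (snd z))"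
abbreviation su0 :: "sol \<Rightarrow> complex" where "su0 z \<equiv> fst (snd (snd (snd z)))"
abbreviation su1 :: "sol \<Rightarrow> complex" where "su1 z \<equiv> fst (snd (snd (snd (snd z))))"
abbreviation sv0 :: "sol \<Rightarrow> complex" where "sv0 z \<equiv> fst (snd (snd (snd (snd (snd z)))))"
abbreviation sv1 :: "sol \<Rightarrow> complex" where "sv1 z \<equiv> fst (snd (snd (snd (snd (snd (snd z))))))"
abbreviation sv2 :: "sol \<Rightarrow> complex" where "sv2 z \<equiv> snd (snd (snd (snd (snd (snd (snd z))))))"

type_synonym rhs = "real \<times> real \<times> real \<times> real \<times> real \<times> real \<times> real \<times> real \<times> real \<times> real \<times> real \<times> real"

definition bil :: "real \<times> sol \<Rightarrow> real \<times> sol \<Rightarrow> rhs" where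
  "bil p q = (let s = fst p; z = snd p; t = fst q; w = snd q in
    (su0 z \<bullet> su0 w + (s * sa0 w + t * sa0 z),
     su0 z \<bullet> su1 w + su1 z \<bullet> su0 w + (s * sa1 w + t * sa1 z),
     su1 z \<bullet> su1 w + (s * sa2 w + t * sa2 z),
     su0 z \<bullet> sv0 w + sv0 z \<bullet> su0 w,
     su0 z \<bullet> sv1 w + sv1 z \<bullet> su0 w + su1 z \<bullet> sv0 w + sv0 z \<bullet> su1 w,
     su0 z \<bullet> sv2 w + sv2 z \<bullet> su0 w + su1 z \<bullet> sv1 w + sv1 z \<bullet> su1 w,
     su1 z \<bullet> sv2 w + sv2 z \<bullet> su1 w,
     sv0 z \<bullet> sv0 w + sa0 z * sa0 w,
     sv0 z \<bullet> sv1 w + sv1 z \<bullet> sv0 w + (sa0 z * sa1 w + sa1 z * sa0 w),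
     sv0 z \<bullet> sv2 w + sv2 z \<bullet> sv0 w + sv1 z \<bullet> sv1 w + (sa0 z * sa2 w + sa2 z * sa0 w + sa1 z * sa1 w),
     sv1 z \<bullet> sv2 w + sv2 z \<bullet> sv1 w + (sa1 z * sa2 w + sa2 z * sa1 w),
     sv2 z \<bullet> sv2 w + sa2 z * sa2 w))"

lemma bil_diff: "bil x x - bil y y = bil (x + y) (x - y)"
  unfolding bil_def Let_def minus_prod_def plus_prod_def fst_conv snd_conv prod.inject
  by (intro conjI) (simp_all add: inner_add_left inner_add_right inner_diff_left inner_diff_right inner_commute algebra_simps)

lemma bil_scale: "bil m (c *\<^sub>R h) = c *\<^sub>R bil m h"
  unfolding bil_def Let_def scaleR_prod_def fst_conv snd_conv prod.inject
  by (intro conjI) (simp_all add: algebra_simps)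

lemma bil_double: "bil (m + m) h = 2 *\<^sub>R bil m h"
  unfolding bil_def Let_def scaleR_prod_def plus_prod_def fst_conv snd_conv prod.inject
  by (intro conjI; simp only: inner_add_left real_scaleR_def; simp add: algebra_simps)

lemma bil_continuous: "continuous_on UNIV (\<lambda>z. bil (fst z) (snd z))"
  unfolding bil_def Let_def by (intro continuous_intros)

text \<open>Only coordinates moved by O(2) enter. The imaginary part is the real inner product of w
  with \<i> times those coordinates of z, the tangent of the orbit at z; its vanishing is the slice
  condition.\<close>

definition herm :: "sol \<Rightarrow> sol \<Rightarrow> complex" where
  "herm z w = cnj (su0 z) * su0 w + cnj (su1 z) * su1 w + cnj (sv0 z) * sv0 w + cnj (sv1 z) * sv1 w + cnj (sv2 z) * sv2 w"

definition rot :: "complex \<Rightarrow> sol \<Rightarrow> sol" where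
  "rot e z = (sa0 z, sa1 z, sa2 z, e * su0 z, e * su1 z, e * sv0 z, e * sv1 z, e * sv2 z)"

definition cj :: "sol \<Rightarrow> sol" where
  "cj z = (sa0 z, sa1 z, sa2 z, cnj (su0 z), cnj (su1 z), cnj (sv0 z), cnj (sv1 z), cnj (sv2 z))"

definition orth2 :: "sol \<Rightarrow> sol \<Rightarrow> bool" where
  "orth2 z w \<longleftrightarrow> (\<exists>e. cmod e = 1 \<and> (w = rot e z \<or> w = rot e (cj z)))"

lemma cnj_unit: "cmod e = 1 \<Longrightarrow> e * cnj e = 1"
  using complex_norm_square[of e] by simp

lemma rot_rot: "rot e (rot e' z) = rot (e * e') z" and cj_rot: "cj (rot e z) = rot (cnj e) (cj z)"
  and cj_cj: "cj (cj z) = z" and rot_1: "rot 1 z = z"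
  by (simp_all add: rot_def cj_def mult.assoc)

lemma orth2_refl: "orth2 z z"
  unfolding orth2_def by (rule exI[of _ 1]) (simp add: rot_1)

lemma orth2_sym:
  assumes "orth2 z w"
  shows "orth2 w z"
proof -
  obtain e where e: "cmod e = 1" "w = rot e z \<or> w = rot e (cj z)" using assms by (auto simp: orth2_def)
  then show ?thesis
  proof (elim disjE)
    assume "w = rot e z"
    then have "z = rot (cnj e) w" using cnj_unit[OF e(1)] by (simp add: rot_rot mult.commute rot_1)
    then show ?thesis using e(1) unfolding orth2_def by (intro exI[of _ "cnj e"]) simp
  next
    assume "w = rot e (cj z)"
    then have "z = rot e (cj w)" using cnj_unit[OF e(1)] by (simp add: rot_rot cj_rot cj_cj rot_1)
    then show ?thesis using e(1) unfolding orth2_def by blast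
  qed
qed

lemma orth2_trans:
  assumes "orth2 x y" "orth2 y z"
  shows "orth2 x z"
proof -
  obtain e e' where e: "cmod e = 1" "y = rot e x \<or> y = rot e (cj x)"
    "cmod e' = 1" "z = rot e' y \<or> z = rot e' (cj y)" using assms by (auto simp: orth2_def)
  have "z = rot (e' * e) x \<or> z = rot (e' * e) (cj x) \<or> z = rot (e' * cnj e) (cj x) \<or> z = rot (e' * cnj e) x"
    using e by (auto simp: rot_rot cj_rot cj_cj)
  moreover have "cmod (e' * e) = 1" "cmod (e' * cnj e) = 1" using e by (auto simp: norm_mult)
  ultimately show ?thesis unfolding orth2_def by blast
qed

lemma dist_rot: "cmod e = 1 \<Longrightarrow> dist (rot e z) (rot e w) = dist z w"
  and dist_cj: "dist (cj z) (cj w) = dist z w"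
proof -
  show "dist (cj z) (cj w) = dist z w"
    unfolding dist_prod_def cj_def fst_conv snd_conv by (simp add: dist_norm flip: complex_cnj_diff)
  assume e: "cmod e = 1"
  have "dist (e * a) (e * b) = dist a b" for a b
    using e by (simp add: dist_norm norm_mult flip: right_diff_distrib)
  then show "dist (rot e z) (rot e w) = dist z w"
    unfolding dist_prod_def rot_def fst_conv snd_conv by simp
qed

lemma inner_rot: "cmod e = 1 \<Longrightarrow> (e * a) \<bullet> (e * b) = a \<bullet> b"
proof -
  assume e: "cmod e = 1"
  have "(e * a) \<bullet> (e * b) = Re (cnj e * e * (cnj a * b))"
    by (simp add: inner_complex_def) (simp add: algebra_simps)
  also have "\<dots> = Re (cnj a * b)" using cnj_unit[OF e] by (simp add: mult.commute[of "cnj e"])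
  also have "\<dots> = a \<bullet> b" by (simp add: inner_complex_def)
  finally show ?thesis .
qed

lemma inner_cnj: "cnj a \<bullet> cnj b = a \<bullet> b"
  by (simp add: inner_complex_def)

lemma bil_orth2:
  assumes "orth2 z w"
  shows "bil (s, w) (s, w) = bil (s, z) (s, z)"
  using assms unfolding orth2_def
  by (auto simp: bil_def rot_def cj_def inner_rot inner_cnj)

text \<open>The orbit consists of two images of a circle, hence has positive distance from a point
  outside it. Since the group acts by isometries, this distance survives small
  displacements.\<close>

lemma orth2_separate:
  assumes "\<not> orth2 x y"
  shows "\<exists>e>0. \<forall>x' y'. dist x' x < e \<longrightarrow> dist y' y < e \<longrightarrow> \<not> orth2 x' y'"
proof -
  have far: "\<exists>m>0. \<forall>e. cmod e = 1 \<longrightarrow> m \<le> dist y (rot e x)" if "\<And>e. cmod e = 1 \<Longrightarrow> y \<noteq> rot e x" for x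
  proof -
    have "continuous_on (sphere (0::complex) 1) (\<lambda>e. dist y (rot e x))"
      unfolding rot_def by (intro continuous_intros)
    then obtain e0 where e0: "e0 \<in> sphere (0::complex) 1" "\<And>e. e \<in> sphere 0 1 \<Longrightarrow> dist y (rot e0 x) \<le> dist y (rot e x)"
      using continuous_attains_inf[OF compact_sphere, of 0 1 "\<lambda>e. dist y (rot e x)"] by auto
    show ?thesis using that[of e0] e0 by (intro exI[of _ "dist y (rot e0 x)"]) auto
  qed
  obtain m1 where m1: "m1 > 0" "\<And>e. cmod e = 1 \<Longrightarrow> m1 \<le> dist y (rot e x)"
    using far[of x] assms by (auto simp: orth2_def)
  obtain m2 where m2: "m2 > 0" "\<And>e. cmod e = 1 \<Longrightarrow> m2 \<le> dist y (rot e (cj x))"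
    using far[of "cj x"] assms by (auto simp: orth2_def)
  let ?m = "min m1 m2 / 2"
  have "\<not> orth2 x' y'" if d: "dist x' x < ?m" "dist y' y < ?m" for x' y'
  proof
    assume "orth2 x' y'"
    then obtain e where e: "cmod e = 1" "y' = rot e x' \<or> y' = rot e (cj x')" by (auto simp: orth2_def)
    from e(2) show False
    proof
      assume y': "y' = rot e x'"
      have "dist y (rot e x) \<le> dist y' y + dist (rot e x') (rot e x)"
        unfolding y' by (metis dist_commute dist_triangle)
      then show False using m1(2)[OF e(1)] d unfolding dist_rot[OF e(1)] by simp
    next
      assume y': "y' = rot e (cj x')"
      have "dist y (rot e (cj x)) \<le> dist y' y + dist (rot e (cj x')) (rot e (cj x))"
        unfolding y' by (metis dist_commute dist_triangle)
      then show False using m2(2)[OF e(1)] d unfolding dist_rot[OF e(1)] dist_cj by simp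
    qed
  qed
  then show ?thesis using m1(1) m2(1) by (intro exI[of _ ?m]) auto
qed

lemma orth2_open:
  assumes "orth2 x y" "e > 0"
  shows "\<exists>d>0. \<forall>x'. dist x' x < d \<longrightarrow> (\<exists>y'. orth2 x' y' \<and> dist y' y < e)"
proof -
  obtain c where c: "cmod c = 1" "y = rot c x \<or> y = rot c (cj x)" using assms by (auto simp: orth2_def)
  show ?thesis
  proof (intro exI[of _ e] conjI allI impI)
    fix x' assume x': "dist x' x < e"
    from c(2) show "\<exists>y'. orth2 x' y' \<and> dist y' y < e"
    proof
      assume "y = rot c x"
      then show ?thesis using c(1) x' by (intro exI[of _ "rot c x'"]) (auto simp: orth2_def dist_rot)
    next
      assume "y = rot c (cj x)"
      then show ?thesis using c(1) x' by (intro exI[of _ "rot c (cj x')"]) (auto simp: orth2_def dist_rot dist_cj)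
    qed
  qed fact
qed

text \<open>Rotating so that the hermitian product with \<open>z\<close> becomes a nonnegative real number moves
  \<open>w\<close> into the slice orthogonal to the orbit of \<open>z\<close> and does not increase the distance to \<open>z\<close>.\<close>
lemma move_to_slice:
  obtains w' where "orth2 w w'" "Im (herm z w') = 0" "dist w' z \<le> dist w z"
proof -
  define c where "c = herm z w"
  define e where "e = (if c = 0 then 1 else cnj c / of_real (cmod c))"
  have e: "cmod e = 1" by (simp add: e_def norm_divide)
  have ec: "e * c = of_real (cmod c)"
    by (auto simp: e_def complex_norm_square[symmetric] power2_eq_square mult.commute)
  have h: "herm z (rot e w) = e * c" by (simp add: herm_def rot_def c_def algebra_simps)
  have sq: "(cmod (a - b))\<^sup>2 = (cmod a)\<^sup>2 + (cmod b)\<^sup>2 - 2 * Re (cnj b * a)" for a b :: complex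
    by (simp add: cmod_power2) (simp add: power2_eq_square algebra_simps)
  have dsq: "(dist x z)\<^sup>2 = (sa0 x - sa0 z)\<^sup>2 + (sa1 x - sa1 z)\<^sup>2 + (sa2 x - sa2 z)\<^sup>2
     + ((cmod (su0 x))\<^sup>2 + (cmod (su1 x))\<^sup>2 + (cmod (sv0 x))\<^sup>2 + (cmod (sv1 x))\<^sup>2 + (cmod (sv2 x))\<^sup>2)
     + ((cmod (su0 z))\<^sup>2 + (cmod (su1 z))\<^sup>2 + (cmod (sv0 z))\<^sup>2 + (cmod (sv1 z))\<^sup>2 + (cmod (sv2 z))\<^sup>2)
     - 2 * Re (herm z x)" for x
  proof -
    have r: "(dist a b)\<^sup>2 = (a - b)\<^sup>2" for a b :: real by (simp add: dist_real_def)
    have c: "(dist a b)\<^sup>2 = (cmod a)\<^sup>2 + (cmod b)\<^sup>2 - 2 * Re (cnj b * a)" for a b :: complex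
      by (simp only: dist_norm sq)
    have "A0 + (A1 + (A2 + (p0 + q0 - 2 * r0 + (p1 + q1 - 2 * r1 + (p2 + q2 - 2 * r2 + (p3 + q3 - 2 * r3 + (p4 + q4 - 2 * r4)))))))
      = A0 + A1 + A2 + (p0 + p1 + p2 + p3 + p4) + (q0 + q1 + q2 + q3 + q4) - 2 * (r0 + r1 + r2 + r3 + r4)"
      for A0 A1 A2 p0 p1 p2 p3 p4 q0 q1 q2 q3 q4 r0 r1 r2 r3 r4 :: real by simp
    then show ?thesis unfolding dist_prod_square r c herm_def plus_complex.sel .
  qed
  \<comment> \<open>Rotation preserves all norms, so the squared distance changes only through the
    real part of the hermitian product, which grows from Re c to |c|.\<close>
  have "(dist (rot e w) z)\<^sup>2 - (dist w z)\<^sup>2 = 2 * Re c - 2 * cmod c"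
  proof -
    have "cmod (su0 (rot e w)) = cmod (su0 w)" "cmod (su1 (rot e w)) = cmod (su1 w)" "cmod (sv0 (rot e w)) = cmod (sv0 w)"
      "cmod (sv1 (rot e w)) = cmod (sv1 w)" "cmod (sv2 (rot e w)) = cmod (sv2 w)"
      "sa0 (rot e w) = sa0 w" "sa1 (rot e w) = sa1 w" "sa2 (rot e w) = sa2 w"
      using e by (simp_all add: rot_def norm_mult)
    then show ?thesis unfolding dsq h ec c_def[symmetric] by simp
  qed
  also have "\<dots> \<le> 0" using complex_Re_le_cmod[of c] by simp
  finally have "(dist (rot e w) z)\<^sup>2 \<le> (dist w z)\<^sup>2" by simp
  then have "dist (rot e w) z \<le> dist w z" by (rule power2_le_imp_le) simp
  moreover have "orth2 w (rot e w)" using e unfolding orth2_def by blast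
  moreover have "Im (herm z (rot e w)) = 0" unfolding h ec by simp
  ultimately show ?thesis using that by blast
qed

section \<open>Compactness and local charts of the solution set\<close>

locale sol_family =
  fixes t :: rhs
  assumes kernel: "\<And>s z w. s \<in> {0..1} \<Longrightarrow> bil (s, z) (s, z) = t \<Longrightarrow> bil (s, z) (0, w) = 0 \<Longrightarrow>
     Im (herm z w) = 0 \<Longrightarrow> w = 0"
begin

definition Z :: "real \<Rightarrow> sol set" where "Z s = {z. bil (s, z) (s, z) = t}"

text \<open>The coefficients of x^4 and y^4 bound the outer coefficients of the three quadratic
  forms, and the one of x^2 y^2 then bounds the middle ones. As s is at most 1, the coefficients of
  x^2 z^2 and y^2 z^2 bound the linear forms.\<close>

lemma Z_bounded: "bounded {(s, z). s \<in> {0..1} \<and> z \<in> Z s}"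
proof -
  obtain f20 f21 f22 f30 f31 f32 f33 f40 f41 f42 f43 f44
    where t: "t = (f20, f21, f22, f30, f31, f32, f33, f40, f41, f42, f43, f44)" by (metis prod.exhaust)
  obtain g20 g22 g40 g42 g44 :: real where g: "f20 \<le> g20" "f22 \<le> g22" "f40 \<le> g40" "f42 \<le> g42" "f44 \<le> g44"
    "0 \<le> g20" "0 \<le> g22" "0 \<le> g40" "0 \<le> g42" "0 \<le> g44"
    using that[of "\<bar>f20\<bar>" "\<bar>f22\<bar>" "\<bar>f40\<bar>" "\<bar>f42\<bar>" "\<bar>f44\<bar>"] by simp
  define M where "M = 2 + g20 + g22 + 2 * g40 + 2 * g42 + 2 * g44"
  have M1: "M \<ge> 1" using g(6-10) by (simp add: M_def)
  \<comment> \<open>The nine components are s, three real and five complex coordinates, each of norm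
    at most M.\<close>
  have "norm (s, z) \<le> 9 * M" if s: "s \<in> {0..1}" and z: "z \<in> Z s" for s z
  proof -
    have e: "(norm (su0 z))\<^sup>2 + 2 * (s * sa0 z) = f20" "(norm (su1 z))\<^sup>2 + 2 * (s * sa2 z) = f22"
      "(norm (sv0 z))\<^sup>2 + (sa0 z)\<^sup>2 = f40" "(norm (sv2 z))\<^sup>2 + (sa2 z)\<^sup>2 = f44"
      "2 * (sv0 z \<bullet> sv2 z) + (norm (sv1 z))\<^sup>2 + (2 * (sa0 z * sa2 z) + (sa1 z)\<^sup>2) = f42"
    proof -
      have "bil (s, z) (s, z) = (f20, f21, f22, f30, f31, f32, f33, f40, f41, f42, f43, f44)"
        using z unfolding Z_def unfolding t by simp
      then show "(norm (su0 z))\<^sup>2 + 2 * (s * sa0 z) = f20" "(norm (su1 z))\<^sup>2 + 2 * (s * sa2 z) = f22"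
        "(norm (sv0 z))\<^sup>2 + (sa0 z)\<^sup>2 = f40" "(norm (sv2 z))\<^sup>2 + (sa2 z)\<^sup>2 = f44"
        "2 * (sv0 z \<bullet> sv2 z) + (norm (sv1 z))\<^sup>2 + (2 * (sa0 z * sa2 z) + (sa1 z)\<^sup>2) = f42"
        unfolding bil_def Let_def fst_conv snd_conv prod.inject power2_norm_eq_inner
        by (auto simp: inner_commute power2_eq_square)
    qed
    have i: "\<bar>2 * (sv0 z \<bullet> sv2 z)\<bar> \<le> (norm (sv0 z))\<^sup>2 + (norm (sv2 z))\<^sup>2"
      using Cauchy_Schwarz_ineq2[of "sv0 z" "sv2 z"] sum_squares_bound[of "norm (sv0 z)" "norm (sv2 z)"] by simp
    have a: "\<bar>2 * (sa0 z * sa2 z)\<bar> \<le> (sa0 z)\<^sup>2 + (sa2 z)\<^sup>2"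
      using sum_squares_bound[of "\<bar>sa0 z\<bar>" "\<bar>sa2 z\<bar>"] by (simp add: abs_mult)
    have sa: "\<bar>2 * (s * x)\<bar> \<le> 1 + x\<^sup>2" for x
    proof -
      have "s * \<bar>x\<bar> \<le> 1 * \<bar>x\<bar>" using s by (intro mult_right_mono) auto
      then have "\<bar>2 * (s * x)\<bar> \<le> 2 * \<bar>x\<bar>" using s by (simp add: abs_mult)
      also have "\<dots> \<le> 1 + x\<^sup>2" using sum_squares_bound[of 1 "\<bar>x\<bar>"] by simp
      finally show ?thesis .
    qed
    have nn: "0 \<le> (norm (sv0 z))\<^sup>2" "0 \<le> (norm (sv2 z))\<^sup>2" "0 \<le> (norm (sv1 z))\<^sup>2"
      "0 \<le> (sa0 z)\<^sup>2" "0 \<le> (sa1 z)\<^sup>2" "0 \<le> (sa2 z)\<^sup>2" by auto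
    have "(sa0 z)\<^sup>2 \<le> M" "(sa2 z)\<^sup>2 \<le> M" "(sa1 z)\<^sup>2 \<le> M" "(norm (sv0 z))\<^sup>2 \<le> M"
      "(norm (sv1 z))\<^sup>2 \<le> M" "(norm (sv2 z))\<^sup>2 \<le> M" "(norm (su0 z))\<^sup>2 \<le> M" "(norm (su1 z))\<^sup>2 \<le> M"
      using e abs_le_D2[OF i] abs_le_D2[OF a] abs_le_D2[OF sa[of "sa0 z"]] abs_le_D2[OF sa[of "sa2 z"]] nn g
      unfolding M_def by linarith+
    moreover have le: "\<bar>x\<bar> \<le> M" if "x\<^sup>2 \<le> M" for x :: real
    proof -
      have "M * 1 \<le> M * M" using M1 by (intro mult_left_mono) auto
      then have "x\<^sup>2 \<le> M\<^sup>2" using that by (simp add: power2_eq_square)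
      then show ?thesis using M1 abs_le_square_iff[of x M] by simp
    qed
    ultimately have b: "\<bar>sa0 z\<bar> \<le> M" "\<bar>sa2 z\<bar> \<le> M" "\<bar>sa1 z\<bar> \<le> M" "norm (sv0 z) \<le> M"
      "norm (sv1 z) \<le> M" "norm (sv2 z) \<le> M" "norm (su0 z) \<le> M" "norm (su1 z) \<le> M"
      using le[of "norm _"] by (simp_all add: le)
    have "norm z \<le> \<bar>sa0 z\<bar> + (\<bar>sa1 z\<bar> + (\<bar>sa2 z\<bar> + (norm (su0 z) + (norm (su1 z) + (norm (sv0 z) + (norm (sv1 z) + norm (sv2 z)))))))"
      by (intro order_trans[OF norm_le_norm_fst_snd] add_mono order_refl) auto
    moreover have "norm (s, z) \<le> \<bar>s\<bar> + norm z" using norm_Pair_le[of s z] by simp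
    moreover have "\<bar>s\<bar> \<le> M" using s M1 by auto
    ultimately show ?thesis using b by linarith
  qed
  then show ?thesis unfolding bounded_iff by blast
qed

lemma Z_compact: "compact {(s, z). s \<in> {0..1} \<and> z \<in> Z s}"
proof -
  have "continuous_on UNIV (\<lambda>p. bil p p)"
    using continuous_on_compose2[OF bil_continuous, of UNIV "\<lambda>p. (p, p)"]
    by (simp add: continuous_on_Pair)
  then have c1: "closed {p. bil p p = t}" by (rule closed_Collect_eq[OF _ continuous_on_const])
  have c2: "closed ({0..1::real} \<times> (UNIV :: sol set))" by (intro closed_Times) auto
  have "{(s, z). s \<in> {0..1} \<and> z \<in> Z s} = {p. bil p p = t} \<inter> ({0..1} \<times> UNIV)"
    by (auto simp: Z_def)
  then have "closed {(s, z). s \<in> {0..1} \<and> z \<in> Z s}" using closed_Int[OF c1 c2] by simp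
  then show ?thesis using Z_bounded compact_eq_bounded_closed by blast
qed

text \<open>Source and target both have real dimension 14. Keeping s as a component lets one
  statement about \<open>chart\<close> cover all nearby parameters.\<close>

definition chart :: "sol \<Rightarrow> real \<times> sol \<Rightarrow> real \<times> real \<times> rhs" where
  "chart z p = (fst p, Im (herm z (snd p)), bil p p)"

lemma chart_local:
  assumes s: "s \<in> {0..1}" and z: "z \<in> Z s"
  shows "\<exists>e>0. inj_on (chart z) (ball (s, z) e)"
proof (rule locally_injective_quadratic[where D = "\<lambda>m h. (fst h, Im (herm z (snd h)), bil m h)"])
  have hd: "herm z (a - b) = herm z a - herm z b" for a b by (simp add: herm_def algebra_simps)
  have hs: "herm z (c *\<^sub>R a) = of_real c * herm z a" for a c by (simp add: herm_def scaleR_conv_of_real algebra_simps)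
  show "chart z x - chart z y = (fst (x - y), Im (herm z (snd (x - y))), bil (x + y) (x - y))" for x y
    by (simp add: chart_def bil_diff[symmetric] hd)
  show "(fst (c *\<^sub>R h), Im (herm z (snd (c *\<^sub>R h))), bil m (c *\<^sub>R h)) = c *\<^sub>R (fst h, Im (herm z (snd h)), bil m h)" for m h c
    by (simp add: bil_scale hs)
  show "continuous_on UNIV (\<lambda>q. (fst (snd q), Im (herm z (snd (snd q))), bil (fst q) (snd q)))"
    unfolding herm_def by (intro continuous_intros bil_continuous)
  fix h :: "real \<times> sol"
  assume h: "(fst h, Im (herm z (snd h)), bil ((s, z) + (s, z)) h) = 0"
  have 1: "fst h = 0" using arg_cong[OF h, of fst] by simp
  have 2: "Im (herm z (snd h)) = 0" using arg_cong[OF h, of "\<lambda>x. fst (snd x)"] by simp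
  have "2 *\<^sub>R bil (s, z) h = 0" using arg_cong[OF h, of "\<lambda>x. snd (snd x)"] unfolding bil_double by simp
  then have 3: "bil (s, z) h = 0" by (metis scaleR_eq_0_iff zero_neq_numeral)
  obtain w where w: "h = (0, w)" using 1 by (cases h) simp
  have "bil (s, z) (s, z) = t" using z by (simp add: Z_def)
  from kernel[OF s this, of w] 2 3 show "h = 0" unfolding w by (simp add: zero_prod_def)
qed

sublocale orbit_family Z orth2
proof unfold_locales
  show "orth2 x x" for x by (rule orth2_refl)
  show "orth2 x y \<Longrightarrow> orth2 y x" for x y by (rule orth2_sym)
  show "orth2 x y \<Longrightarrow> orth2 y z \<Longrightarrow> orth2 x z" for x y z by (rule orth2_trans)
  show "x \<in> Z s \<Longrightarrow> orth2 x y \<Longrightarrow> y \<in> Z s" for x y s by (simp add: Z_def bil_orth2)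
  show "\<not> orth2 x y \<Longrightarrow> \<exists>e>0. \<forall>x' y'. dist x' x < e \<longrightarrow> dist y' y < e \<longrightarrow> \<not> orth2 x' y'" for x y
    by (rule orth2_separate)
  show "orth2 x y \<Longrightarrow> e > 0 \<Longrightarrow> \<exists>d>0. \<forall>x'. dist x' x < d \<longrightarrow> (\<exists>y'. orth2 x' y' \<and> dist y' y < e)" for x y e
    by (rule orth2_open)
  show "compact {(s, z). s \<in> {0..1} \<and> z \<in> Z s}" by (rule Z_compact)
next
  fix s :: real and z
  assume s: "s \<in> {0..1}" and z: "z \<in> Z s"
  obtain e where e: "e > 0" "inj_on (chart z) (ball (s, z) e)" using chart_local[OF s z] by blast
  show "\<exists>e>0. \<exists>d>0. \<forall>s'\<in>{0..1}. \<bar>s' - s\<bar> < d \<longrightarrow>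
        (\<forall>w\<in>Z s'. \<forall>w'\<in>Z s'. dist w z < e \<longrightarrow> dist w' z < e \<longrightarrow> orth2 w w')"
  proof (rule exI[of _ "e / 2"], intro conjI exI[of _ "e / 2"] ballI impI)
    fix s' w w'
    assume s': "s' \<in> {0..1}" "\<bar>s' - s\<bar> < e / 2" and w: "w \<in> Z s'" "w' \<in> Z s'" "dist w z < e / 2" "dist w' z < e / 2"
    \<comment> \<open>Inside the slice both solutions have the same image under
      \<open>chart\<close>, so injectivity identifies them.\<close>
    obtain w1 where w1: "orth2 w w1" "Im (herm z w1) = 0" "dist w1 z \<le> dist w z" by (rule move_to_slice)
    obtain w2 where w2: "orth2 w' w2" "Im (herm z w2) = 0" "dist w2 z \<le> dist w' z" by (rule move_to_slice)
    have in_ball: "(s', x) \<in> ball (s, z) e" if "dist x z < e / 2" for x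
    proof -
      have "dist (s', x) (s, z) \<le> dist s' s + dist x z"
        unfolding dist_Pair_Pair by (rule sqrt_sum_squares_le_sum) auto
      then show ?thesis using that s'(2) by (simp add: dist_commute dist_real_def)
    qed
    have "bil (s', w1) (s', w1) = t" "bil (s', w2) (s', w2) = t"
      using w(1,2) bil_orth2[OF w1(1), of s'] bil_orth2[OF w2(1), of s'] by (simp_all add: Z_def)
    then have "chart z (s', w1) = chart z (s', w2)" using w1 w2 by (simp add: chart_def)
    then have "(s', w1) = (s', w2)"
      by (rule inj_onD[OF e(2)]) (rule in_ball, use w1(3) w2(3) w(3,4) in linarith)+
    then have "w1 = w2" by simp
    then show "orth2 w w'" using w1(1) w2(1) orth2_sym orth2_trans by blast
  qed (use e in auto)
next
  fix s :: real and z and \<epsilon> :: real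
  assume s: "s \<in> {0..1}" and z: "z \<in> Z s" and \<epsilon>: "\<epsilon> > 0"
  obtain e where e: "e > 0" "inj_on (chart z) (ball (s, z) e)" using chart_local[OF s z] by blast
  define U where "U = ball (s, z) (min e \<epsilon>)"
  have inj: "inj_on (chart z) U" unfolding U_def by (rule inj_on_subset[OF e(2)]) auto
  have cbil: "continuous_on U (\<lambda>p. bil p p)"
    using continuous_on_compose2[OF bil_continuous, of U "\<lambda>p. (p, p)"]
    by (simp add: continuous_on_Pair)
  have cont: "continuous_on U (chart z)" unfolding chart_def herm_def
    by (intro continuous_intros cbil)
  \<comment> \<open>Invariance of domain: the image is open and contains (s, 0, t), hence (s', 0, t)
    for s' near s.\<close>
  have "openin (top_of_set UNIV) (chart z ` U)"
    by (rule invariance_of_domain_subspaces[where U = UNIV])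
       (use inj cont in \<open>auto simp: U_def\<close>)
  then have op: "open (chart z ` U)" by simp
  have zz: "Im (herm z z) = 0" by (simp add: herm_def)
  have "(s, 0, t) \<in> chart z ` U"
    by (rule image_eqI[of _ _ "(s, z)"]) (use z e \<epsilon> zz in \<open>auto simp: chart_def Z_def U_def\<close>)
  then obtain d where d: "d > 0" "ball (s, 0, t) d \<subseteq> chart z ` U" using op by (meson open_contains_ball)
  show "\<exists>d>0. \<forall>s'\<in>{0..1}. \<bar>s' - s\<bar> < d \<longrightarrow> (\<exists>w\<in>Z s'. dist w z < \<epsilon>)"
  proof (intro exI[of _ d] conjI ballI impI)
    fix s' assume s': "\<bar>s' - s\<bar> < d"
    have "dist (s, 0::real, t) (s', 0, t) = \<bar>s' - s\<bar>" by (simp add: dist_Pair_Pair dist_real_def abs_minus_commute)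
    then have "(s', 0, t) \<in> chart z ` U" using d(2) s' by auto
    then obtain p where p: "p \<in> U" "chart z p = (s', 0, t)" by auto
    obtain x w where pw: "p = (x, w)" by (cases p)
    have "w \<in> Z s'" using p(2) by (auto simp: pw chart_def Z_def)
    moreover have "dist w z \<le> dist p (s, z)" unfolding pw dist_Pair_Pair by (rule real_sqrt_sum_squares_ge2)
    then have "dist w z < \<epsilon>" using p(1) by (simp add: U_def dist_commute)
    ultimately show "\<exists>w\<in>Z s'. dist w z < \<epsilon>" by blast
  qed fact
qed

end

section \<open>Infinitesimal rigidity of representations\<close>

definition pA :: "sol \<Rightarrow> real poly" where "pA z = [:sa2 z, sa1 z, sa0 z:]"
definition pL2 :: "sol \<Rightarrow> real poly" where "pL2 z = [:Re (su1 z), Re (su0 z):]"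
definition pL3 :: "sol \<Rightarrow> real poly" where "pL3 z = [:Im (su1 z), Im (su0 z):]"
definition pQ2 :: "sol \<Rightarrow> real poly" where "pQ2 z = [:Re (sv2 z), Re (sv1 z), Re (sv0 z):]"
definition pQ3 :: "sol \<Rightarrow> real poly" where "pQ3 z = [:Im (sv2 z), Im (sv1 z), Im (sv0 z):]"

lemmas sol_polys = pA_def pL2_def pL3_def pQ2_def pQ3_def

lemma bil_eq_iff:
  "bil (s, z) (t, w) = (c1, c2, c3, c4, c5, c6, c7, c8, c9, c10, c11, c12) \<longleftrightarrow>
    smult s (pA w) + smult t (pA z) + pL2 z * pL2 w + pL3 z * pL3 w = [:c3, c2, c1:] \<and>
    pL2 z * pQ2 w + pL3 z * pQ3 w + pQ2 z * pL2 w + pQ3 z * pL3 w = [:c7, c6, c5, c4:] \<and>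
    pA z * pA w + pQ2 z * pQ2 w + pQ3 z * pQ3 w = [:c12, c11, c10, c9, c8:]"
  by (auto simp: bil_def sol_polys inner_complex_def algebra_simps)

lemma degree_sol_polys:
  "degree (pA z) \<le> 2" "degree (pL2 z) \<le> 1" "degree (pL3 z) \<le> 1" "degree (pQ2 z) \<le> 2" "degree (pQ3 z) \<le> 2"
  by (simp_all add: sol_polys)

section \<open>Divisibility, common zeros and the chart at infinity\<close>

lemma minimal_polynomial:
  obtains p :: "real poly" where "degree p > 0" "\<And>q. p dvd q \<longleftrightarrow> poly (cx q) \<beta> = 0"
proof (cases "Im \<beta> = 0")
  case True
  then have \<beta>: "\<beta> = of_real (Re \<beta>)" by (simp add: complex_eq_iff)
  have "[:- Re \<beta>, 1:] dvd q \<longleftrightarrow> poly (cx q) \<beta> = 0" for q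
    by (subst \<beta>) (simp only: poly_cx_of_real of_real_eq_0_iff poly_eq_0_iff_dvd)
  then show ?thesis using that[of "[:- Re \<beta>, 1:]"] by simp
next
  case False
  show ?thesis by (rule that[OF _ dvd_real_quadratic_iff[OF False]]) simp
qed

lemma coprime_no_common_root:
  assumes "coprime p q"
  shows "\<not> (poly (cx p) z = 0 \<and> poly (cx q) z = 0)"
proof
  assume h: "poly (cx p) z = 0 \<and> poly (cx q) z = 0"
  obtain r :: "real poly" where r: "degree r > 0" "\<And>q. r dvd q \<longleftrightarrow> poly (cx q) z = 0"
    using minimal_polynomial[where \<beta> = z] by blast
  then have "is_unit r" using h coprime_common_divisor[OF assms] by blast
  then show False using r(1) by (auto simp: is_unit_poly_iff)
qed

text \<open>At a root of E one of a, b, c is nonzero, so K vanishes there. The real minimal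
  polynomial of that root divides both E and K and can be cancelled, lowering the degree of
  E.\<close>

lemma no_common_root_dvd:
  fixes E a b c K :: "real poly"
  assumes "\<And>z. \<not> (poly (cx E) z = 0 \<and> poly (cx a) z = 0 \<and> poly (cx b) z = 0 \<and> poly (cx c) z = 0)"
    and "E dvd a * K" "E dvd b * K" "E dvd c * K"
  shows "E dvd K"
  using assms
proof (induction "degree E" arbitrary: E K rule: less_induct)
  case less
  show ?case
  proof (cases "degree E = 0")
    case True
    then obtain e where e: "E = [:e:]" by (rule degree_eq_zeroE)
    show ?thesis
    proof (cases "e = 0")
      \<comment> \<open>For E = 0 the hypotheses make all three products zero, while a, b, c do not
        all vanish at 0.\<close>
      case True
      then have "a * K = 0" "b * K = 0" "c * K = 0" using less.prems e by auto
      moreover have "a \<noteq> 0 \<or> b \<noteq> 0 \<or> c \<noteq> 0" using less.prems(1)[of 0] True e by auto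
      ultimately show ?thesis by auto
    next
      case False
      then have "is_unit E" by (intro dvdI[of _ _ "[:1 / e:]"]) (simp add: e one_pCons)
      then show ?thesis by (rule unit_imp_dvd)
    qed
  next
    case False
    then have "\<not> constant (poly (cx E))" by (simp add: constant_degree degree_of_real_poly)
    then obtain \<beta> where \<beta>: "poly (cx E) \<beta> = 0" using fundamental_theorem_of_algebra by blast
    obtain p :: "real poly" where p: "degree p > 0" "\<And>q. p dvd q \<longleftrightarrow> poly (cx q) \<beta> = 0"
      using minimal_polynomial[where \<beta> = \<beta>] by blast
    have p0: "p \<noteq> 0" using p(1) by auto
    obtain E' where E': "E = p * E'" using p(2)[of E] \<beta> by (auto elim: dvdE)
    have pE: "p dvd E" using E' by simp
    have "poly (cx (a * K)) \<beta> = 0" "poly (cx (b * K)) \<beta> = 0" "poly (cx (c * K)) \<beta> = 0"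
      using dvd_trans[OF pE less.prems(2)] dvd_trans[OF pE less.prems(3)] dvd_trans[OF pE less.prems(4)] p(2) by blast+
    then have "poly (cx K) \<beta> = 0" using less.prems(1)[of \<beta>] \<beta> by auto
    then obtain K' where K': "K = p * K'" using p(2)[of K] by (auto elim: dvdE)
    have E0: "E \<noteq> 0" using False by auto
    have "degree E = degree p + degree E'" using E0 unfolding E' by (simp add: degree_mult_eq)
    then have "degree E' < degree E" using p(1) by simp
    moreover have "\<not> (poly (cx E') z = 0 \<and> poly (cx a) z = 0 \<and> poly (cx b) z = 0 \<and> poly (cx c) z = 0)" for z
      using less.prems(1)[of z] unfolding E' by auto
    moreover have "E' dvd x * K'" if "E dvd x * K" for x
      using that p0 unfolding E' K' by (simp add: mult.left_commute)
    ultimately have "E' dvd K'" using less.hyps less.prems(2-4) by blast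
    then show ?thesis unfolding E' K' by simp
  qed
qed

text \<open>Concerns the complex points (\<alpha>, 1, \<zeta>) of the three quadratic forms of a
  representation. A common zero is a singular point of the sum of their squares.\<close>

definition no_common_zero :: "real \<Rightarrow> sol \<Rightarrow> bool" where
  "no_common_zero s z \<longleftrightarrow> (\<forall>\<alpha> \<zeta>. \<not> (of_real s * \<zeta>\<^sup>2 + poly (cx (pA z)) \<alpha> = 0 \<and>
     poly (cx (pL2 z)) \<alpha> * \<zeta> + poly (cx (pQ2 z)) \<alpha> = 0 \<and> poly (cx (pL3 z)) \<alpha> * \<zeta> + poly (cx (pQ3 z)) \<alpha> = 0))"

text \<open>The same for the points (1, 0, \<zeta>), where each form reduces to its coefficients of
  the highest powers of x.\<close>

definition no_zero_at_infinity :: "real \<Rightarrow> sol \<Rightarrow> bool" where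
  "no_zero_at_infinity s z \<longleftrightarrow> (\<forall>\<zeta>. \<not> (of_real s * \<zeta>\<^sup>2 + of_real (sa0 z) = 0 \<and>
     of_real (Re (su0 z)) * \<zeta> + of_real (Re (sv0 z)) = 0 \<and> of_real (Im (su0 z)) * \<zeta> + of_real (Im (sv0 z)) = (0::complex)))"

text \<open>Exchanges x and y. It turns points with y = 0 into points of the affine chart, and the
  dehomogenized polynomials into their reversals.\<close>

definition swap :: "sol \<Rightarrow> sol" where
  "swap z = (sa2 z, sa1 z, sa0 z, su1 z, su0 z, sv2 z, sv1 z, sv0 z)"

lemma bil_swap: "bil (s, z) (t, w) = 0 \<Longrightarrow> bil (s, swap z) (t, swap w) = 0"
  unfolding bil_def Let_def swap_def fst_conv snd_conv zero_prod_def prod.inject by (auto simp: algebra_simps)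

lemma no_common_zero_swap:
  assumes "no_common_zero s z" "no_zero_at_infinity s z"
  shows "no_common_zero s (swap z)"
  unfolding no_common_zero_def
proof (intro allI notI)
  fix \<alpha> \<zeta>
  assume h: "of_real s * \<zeta>\<^sup>2 + poly (cx (pA (swap z))) \<alpha> = 0 \<and>
     poly (cx (pL2 (swap z))) \<alpha> * \<zeta> + poly (cx (pQ2 (swap z))) \<alpha> = 0 \<and> poly (cx (pL3 (swap z))) \<alpha> * \<zeta> + poly (cx (pQ3 (swap z))) \<alpha> = 0"
  show False
  proof (cases "\<alpha> = 0")
    case True
    then show False using h assms(2) by (auto simp: no_zero_at_infinity_def swap_def sol_polys)
  next
    case False
    have e: "poly (cx (pA (swap z))) \<alpha> = \<alpha>\<^sup>2 * poly (cx (pA z)) (1 / \<alpha>)"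
      "poly (cx (pL2 (swap z))) \<alpha> = \<alpha> * poly (cx (pL2 z)) (1 / \<alpha>)" "poly (cx (pL3 (swap z))) \<alpha> = \<alpha> * poly (cx (pL3 z)) (1 / \<alpha>)"
      "poly (cx (pQ2 (swap z))) \<alpha> = \<alpha>\<^sup>2 * poly (cx (pQ2 z)) (1 / \<alpha>)" "poly (cx (pQ3 (swap z))) \<alpha> = \<alpha>\<^sup>2 * poly (cx (pQ3 z)) (1 / \<alpha>)"
      using False by (simp_all add: sol_polys swap_def field_simps power2_eq_square)
    define \<xi> where "\<xi> = \<zeta> / \<alpha>"
    have z: "\<zeta> = \<alpha> * \<xi>" using False by (simp add: \<xi>_def)
    have "\<alpha>\<^sup>2 * (of_real s * \<xi>\<^sup>2 + poly (cx (pA z)) (1 / \<alpha>)) = 0"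
      "\<alpha>\<^sup>2 * (poly (cx (pL2 z)) (1 / \<alpha>) * \<xi> + poly (cx (pQ2 z)) (1 / \<alpha>)) = 0"
      "\<alpha>\<^sup>2 * (poly (cx (pL3 z)) (1 / \<alpha>) * \<xi> + poly (cx (pQ3 z)) (1 / \<alpha>)) = 0"
      using h unfolding e z by (simp_all add: algebra_simps power2_eq_square)
    then show False using assms(1) False unfolding no_common_zero_def by auto
  qed
qed

text \<open>The eliminant of the two equations that are linear in \<zeta>, a binary cubic before
  dehomogenization.\<close>

definition pE :: "sol \<Rightarrow> real poly" where "pE z = pL2 z * pQ3 z - pL3 z * pQ2 z"

text \<open>With \<open>K = Q\<^sub>2 M\<^sub>2 + Q\<^sub>3 M\<^sub>3\<close> and \<open>L = L\<^sub>2 M\<^sub>2 + L\<^sub>3 M\<^sub>3\<close>, the equations say that \<open>E\<close> divides the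
  products of \<open>K\<close> and of \<open>L\<close> with \<open>s Q\<^sub>i Q\<^sub>j + A L\<^sub>i L\<^sub>j\<close>, and a common root of these multipliers and \<open>E\<close>
  would be a common zero of the three forms.\<close>
lemma pE_dvd:
  fixes L2 L3 Q2 Q3 A M2 M3 H2 H3 A' :: "real poly"
  assumes s: "s \<noteq> 0"
    and nz: "\<And>\<alpha> \<zeta>. \<not> (of_real s * \<zeta>\<^sup>2 + poly (cx A) \<alpha> = 0 \<and>
       poly (cx L2) \<alpha> * \<zeta> + poly (cx Q2) \<alpha> = 0 \<and> poly (cx L3) \<alpha> * \<zeta> + poly (cx Q3) \<alpha> = 0)"
    and e1: "smult s A' + L2 * M2 + L3 * M3 = 0"
    and e2: "L2 * H2 + L3 * H3 + Q2 * M2 + Q3 * M3 = 0"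
    and e3: "A * A' + Q2 * H2 + Q3 * H3 = 0"
  defines "E \<equiv> L2 * Q3 - L3 * Q2"
  shows "E dvd L2 * M2 + L3 * M3" "E dvd Q2 * M2 + Q3 * M3"
proof -
  define S where "S = [:s:]"
  define L where "L = L2 * M2 + L3 * M3"
  define K where "K = Q2 * M2 + Q3 * M3"
  have sS: "smult s p = S * p" for p by (simp add: S_def)
  have L': "L = - (S * A')" using e1 unfolding L_def sS by (simp add: eq_neg_iff_add_eq_0 algebra_simps)
  have e2': "L2 * H2 + L3 * H3 = - K" using e2 unfolding K_def by (simp add: eq_neg_iff_add_eq_0 algebra_simps)
  have e3': "Q2 * H2 + Q3 * H3 = - (A * A')" using e3 by (simp add: eq_neg_iff_add_eq_0 algebra_simps)
  have i: "S * Q3 * K + L3 * A * L = E * (- S * H2)"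
  proof -
    have "S * Q3 * K + L3 * A * L = - S * (Q3 * (- K) - L3 * (- (A * A')))" unfolding L' by (simp add: algebra_simps)
    also have "\<dots> = E * (- S * H2)" unfolding e2'[symmetric] e3'[symmetric] E_def by (simp add: algebra_simps)
    finally show ?thesis .
  qed
  have ii: "S * Q2 * K + L2 * A * L = E * (S * H3)"
  proof -
    have "S * Q2 * K + L2 * A * L = - S * (Q2 * (- K) - L2 * (- (A * A')))" unfolding L' by (simp add: algebra_simps)
    also have "\<dots> = E * (S * H3)" unfolding e2'[symmetric] e3'[symmetric] E_def by (simp add: algebra_simps)
    finally show ?thesis .
  qed
  have iii: "L2 * K - Q2 * L = E * M3" unfolding L_def K_def E_def by (simp add: algebra_simps)
  have iv: "L3 * K - Q3 * L = E * (- M2)" unfolding L_def K_def E_def by (simp add: algebra_simps)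
  define X22 where "X22 = S * Q2\<^sup>2 + A * L2\<^sup>2"
  define X33 where "X33 = S * Q3\<^sup>2 + A * L3\<^sup>2"
  define X23 where "X23 = S * Q2 * Q3 + A * L2 * L3"
  have K: "X22 * K = Q2 * (S * Q2 * K + L2 * A * L) + A * L2 * (L2 * K - Q2 * L)"
    "X33 * K = Q3 * (S * Q3 * K + L3 * A * L) + A * L3 * (L3 * K - Q3 * L)"
    "X23 * K = Q3 * (S * Q2 * K + L2 * A * L) + A * L2 * (L3 * K - Q3 * L)"
    unfolding X22_def X33_def X23_def by (simp_all add: algebra_simps power2_eq_square)
  have L: "X22 * L = L2 * (S * Q2 * K + L2 * A * L) - S * Q2 * (L2 * K - Q2 * L)"
    "X33 * L = L3 * (S * Q3 * K + L3 * A * L) - S * Q3 * (L3 * K - Q3 * L)"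
    "X23 * L = L3 * (S * Q2 * K + L2 * A * L) - S * Q2 * (L3 * K - Q3 * L)"
    unfolding X22_def X33_def X23_def by (simp_all add: algebra_simps power2_eq_square)
  have dv: "E dvd a * (E * b) + c * (E * d)" "E dvd a * (E * b) - c * (E * d)" for a b c d
    by (auto intro!: dvd_add dvd_diff)
  have root: "\<not> (poly (cx E) \<alpha> = 0 \<and> poly (cx X22) \<alpha> = 0 \<and> poly (cx X33) \<alpha> = 0 \<and> poly (cx X23) \<alpha> = 0)" for \<alpha>
  proof
    assume h: "poly (cx E) \<alpha> = 0 \<and> poly (cx X22) \<alpha> = 0 \<and> poly (cx X33) \<alpha> = 0 \<and> poly (cx X23) \<alpha> = 0"
    define l2 l3 q2 q3 a \<sigma> where "l2 = poly (cx L2) \<alpha>" "l3 = poly (cx L3) \<alpha>" "q2 = poly (cx Q2) \<alpha>" "q3 = poly (cx Q3) \<alpha>"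
      "a = poly (cx A) \<alpha>" "\<sigma> = complex_of_real s"
    note v = this
    have \<sigma>: "\<sigma> \<noteq> 0" using s by (simp add: v)
    have e: "l2 * q3 = l3 * q2" "\<sigma> * q2\<^sup>2 + a * l2\<^sup>2 = 0" "\<sigma> * q3\<^sup>2 + a * l3\<^sup>2 = 0"
      using h by (simp_all add: E_def X22_def X33_def S_def v)
    have nz': "\<not> (\<sigma> * \<zeta>\<^sup>2 + a = 0 \<and> l2 * \<zeta> + q2 = 0 \<and> l3 * \<zeta> + q3 = 0)" for \<zeta>
      using nz[of \<zeta> \<alpha>] unfolding v .
    consider "l2 \<noteq> 0" | "l3 \<noteq> 0" | "l2 = 0" "l3 = 0" by blast
    then show False
    proof cases
      case 1
      have "\<sigma> * (- q2 / l2)\<^sup>2 + a = (\<sigma> * q2\<^sup>2 + a * l2\<^sup>2) / l2\<^sup>2" using 1 by (simp add: field_simps)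
      moreover have "l3 * (- q2 / l2) + q3 = 0" using 1 e(1) by (simp add: field_simps)
      ultimately show False using nz'[of "- q2 / l2"] 1 e(2) by simp
    next
      case 2
      have "\<sigma> * (- q3 / l3)\<^sup>2 + a = (\<sigma> * q3\<^sup>2 + a * l3\<^sup>2) / l3\<^sup>2" using 2 by (simp add: field_simps)
      moreover have "l2 * (- q3 / l3) + q2 = 0" using 2 e(1) by (simp add: field_simps)
      ultimately show False using nz'[of "- q3 / l3"] 2 e(3) by simp
    next
      \<comment> \<open>Both linear equations hold identically in \<zeta> here, so a square root
        solving the remaining equation gives a common zero.\<close>
      case 3
      then have "q2 = 0" "q3 = 0" using e(2,3) \<sigma> by auto
      moreover have "\<sigma> * (csqrt (- a / \<sigma>))\<^sup>2 + a = 0" using \<sigma> by simp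
      ultimately show False using nz'[of "csqrt (- a / \<sigma>)"] 3 by simp
    qed
  qed
  show "E dvd L2 * M2 + L3 * M3"
    unfolding L_def[symmetric]
    by (rule no_common_root_dvd[OF root]) (simp_all only: L i ii iii iv dv)
  show "E dvd Q2 * M2 + Q3 * M3"
    unfolding K_def[symmetric]
    by (rule no_common_root_dvd[OF root]) (simp_all only: K i ii iii iv dv)
qed

text \<open>E and K come from binary forms of degrees m and n, E' and K' from the other chart. The
  second inequality compares the multiplicities m - deg E and n - deg K of the root at infinity,
  seen as powers of the variable dividing E' and K'.\<close>

lemma degree_le_of_dvd_reflected:
  fixes E K E' K' :: "'a::field poly"
  assumes "E dvd K" "E' dvd K'" "K \<noteq> 0" "degree E \<le> m" "degree K \<le> n"
    and E': "\<And>j. j \<le> m \<Longrightarrow> coeff E' j = coeff E (m - j)" and K': "\<And>j. j \<le> n \<Longrightarrow> coeff K' j = coeff K (n - j)"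
  shows "degree E \<le> degree K" "degree K + m \<le> n + degree E"
proof -
  show "degree E \<le> degree K" using assms(1,3) by (rule dvd_imp_degree_le)
  have "monom 1 (m - degree E) dvd E'"
    unfolding monom_1_dvd_iff' using E' assms(4) by (auto intro!: coeff_eq_0)
  then have "monom 1 (m - degree E) dvd K'" using assms(2) by (rule dvd_trans)
  then have z: "coeff K' j = 0" if "j < m - degree E" for j
    using that unfolding monom_1_dvd_iff' by blast
  show "degree K + m \<le> n + degree E"
  proof (rule ccontr)
    assume "\<not> ?thesis"
    then have "n - degree K < m - degree E" using assms(5) by linarith
    then have "coeff K' (n - degree K) = 0" by (rule z)
    then show False using K'[of "n - degree K"] assms(3,5) by simp
  qed
qed

text \<open>With vanishing eliminant the two linear equations are proportional. Either L2 divides Q2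
  and both are solved by one polynomial \<zeta> = - b, or the second is a constant multiple of the
  first. Inserting \<zeta> leaves one polynomial equation in \<alpha>; if its formal leading
  coefficient vanishes, the solution sits at infinity.\<close>

lemma common_zero_of_proportional:
  fixes L2 L3 Q2 Q3 A :: "real poly"
  assumes s: "s \<noteq> 0" and deg: "degree L2 \<le> 1" "degree L3 \<le> 1" "degree Q2 \<le> 2" "degree Q3 \<le> 2" "degree A \<le> 2"
    and lead: "coeff L2 1 \<noteq> 0" and eq: "L2 * Q3 = L3 * Q2"
  shows "(\<exists>\<alpha> \<zeta>. of_real s * \<zeta>\<^sup>2 + poly (cx A) \<alpha> = 0 \<and>
       poly (cx L2) \<alpha> * \<zeta> + poly (cx Q2) \<alpha> = 0 \<and> poly (cx L3) \<alpha> * \<zeta> + poly (cx Q3) \<alpha> = 0) \<or>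
     (\<exists>\<zeta>. of_real s * \<zeta>\<^sup>2 + of_real (coeff A 2) = 0 \<and>
       of_real (coeff L2 1) * \<zeta> + of_real (coeff Q2 2) = 0 \<and> of_real (coeff L3 1) * \<zeta> + of_real (coeff Q3 2) = (0::complex))"
    (is "?fin \<or> ?inf")
proof -
  define l0 l1 where "l0 = coeff L2 0" "l1 = coeff L2 1"
  define k0 k1 where "k0 = coeff L3 0" "k1 = coeff L3 1"
  have ex1: "p = [:coeff p 0, coeff p 1:]" if "degree p \<le> 1" for p :: "real poly"
    using that by (intro poly_eqI) (auto simp: coeff_pCons coeff_eq_0 split: nat.splits)
  have ex2: "p = [:coeff p 0, coeff p 1, coeff p 2:]" if "degree p \<le> 2" for p :: "real poly"
    using that by (intro poly_eqI) (auto simp: coeff_pCons coeff_eq_0 numeral_2_eq_2 split: nat.splits)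
  have L2: "L2 = [:l0, l1:]" and L3: "L3 = [:k0, k1:]" unfolding l0_l1_def k0_k1_def using ex1 deg by blast+
  have l1: "l1 \<noteq> 0" using lead by (simp add: l0_l1_def)
  have L20: "L2 \<noteq> 0" using l1 L2 by simp
  have rt: "\<exists>\<alpha>. poly (cx p) \<alpha> = 0" if "coeff p n \<noteq> 0" "n > 0" for p :: "real poly" and n
  proof -
    have "degree p \<noteq> 0" using le_degree[OF that(1)] that(2) by simp
    then have "\<not> constant (poly (cx p))" by (simp add: constant_degree degree_of_real_poly)
    then show ?thesis using fundamental_theorem_of_algebra by blast
  qed
  show ?thesis
  proof (cases "L2 dvd Q2")
    case True
    then obtain b where b: "Q2 = L2 * b" unfolding dvd_def by blast
    have "L2 * Q3 = L2 * (L3 * b)" using eq unfolding b by (simp add: mult_ac)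
    then have b3: "Q3 = L3 * b" using L20 by simp
    have "degree b \<le> 1"
    proof (cases "b = 0")
      case False
      then have "degree Q2 = degree L2 + degree b" unfolding b using L20 by (simp add: degree_mult_eq)
      moreover have "degree L2 = 1" using L2 l1 by simp
      ultimately show ?thesis using deg by simp
    qed simp
    then obtain b0 b1 where bb: "b = [:b0, b1:]" using ex1 by blast
    let ?p = "smult s (b\<^sup>2) + A"
    show ?thesis
    proof (cases "coeff ?p 2 = 0")
      case False
      then obtain \<alpha> where \<alpha>: "poly (cx ?p) \<alpha> = 0" using rt by fastforce
      have ?fin
        by (rule exI[of _ \<alpha>], rule exI[of _ "- poly (cx b) \<alpha>"]) (use \<alpha> in \<open>simp add: b b3 algebra_simps power2_eq_square\<close>)
      then show ?thesis ..
    next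
      case True
      then have "s * b1\<^sup>2 + coeff A 2 = 0" by (simp add: bb power2_eq_square numeral_2_eq_2)
      then have "complex_of_real (s * b1\<^sup>2 + coeff A 2) = 0" by (simp only: of_real_0)
      then have ?inf
        by (intro exI[of _ "- of_real b1"]) (simp add: b b3 bb L2 L3 numeral_2_eq_2)
      then show ?thesis ..
    qed
  next
    \<comment> \<open>The root \<open>a0\<close> of L2 is not a root of Q2, so it must be a root of
      L3, which makes L3 a multiple of L2.\<close>
    case False
    define a0 where "a0 = - l0 / l1"
    have La: "L2 = smult l1 [:- a0, 1:]" using l1 by (simp add: L2 a0_def)
    have q: "poly Q2 a0 \<noteq> 0"
    proof
      assume "poly Q2 a0 = 0"
      then have "[:- a0, 1:] dvd Q2" by (simp add: poly_eq_0_iff_dvd)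
      then have "L2 dvd Q2" unfolding La by (rule smult_dvd[OF _ l1])
      then show False using False by blast
    qed
    have "poly (L2 * Q3) a0 = 0" by (simp add: La)
    then have "poly L3 a0 = 0" using q unfolding eq by simp
    then have k: "k0 = - a0 * k1" by (simp add: L3)
    define \<kappa> where "\<kappa> = k1 / l1"
    have L3': "L3 = smult \<kappa> L2" using l1 by (simp add: L3 La k \<kappa>_def)
    have "L2 * Q3 = L2 * smult \<kappa> Q2" using eq unfolding L3' by simp
    then have Q3': "Q3 = smult \<kappa> Q2" by (rule mult_left_cancel[OF L20, THEN iffD1])
    let ?p = "smult s (Q2\<^sup>2) + A * L2\<^sup>2"
    define c0 c1 c2 d0 d1 d2 where "c0 = coeff Q2 0" "c1 = coeff Q2 1" "c2 = coeff Q2 2" "d0 = coeff A 0" "d1 = coeff A 1" "d2 = coeff A 2"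
    note cd = this
    have QA: "Q2 = [:c0, c1, c2:]" "A = [:d0, d1, d2:]" unfolding cd using ex2 deg by blast+
    show ?thesis
    proof (cases "coeff ?p 4 = 0")
      case False
      then obtain \<alpha> where \<alpha>: "poly (cx ?p) \<alpha> = 0" using rt by fastforce
      have l\<alpha>: "poly (cx L2) \<alpha> \<noteq> 0"
      proof
        assume z: "poly (cx L2) \<alpha> = 0"
        then have "\<alpha> = of_real a0" using l1 by (simp add: La)
        moreover have "poly (cx Q2) \<alpha> = 0" using \<alpha> z s by simp
        ultimately show False using q by simp
      qed
      have "of_real s * (poly (cx Q2) \<alpha>)\<^sup>2 + poly (cx A) \<alpha> * (poly (cx L2) \<alpha>)\<^sup>2 = 0" using \<alpha> by simp
      then have ?fin
        by (intro exI[of _ \<alpha>] exI[of _ "- poly (cx Q2) \<alpha> / poly (cx L2) \<alpha>"])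
           (use l\<alpha> in \<open>simp add: L3' Q3' field_simps\<close>)
      then show ?thesis ..
    next
      case True
      have "coeff ?p 4 = s * c2\<^sup>2 + d2 * l1\<^sup>2"
        unfolding QA L2 by (simp add: power2_eq_square eval_nat_numeral algebra_simps)
      then have "s * c2\<^sup>2 + d2 * l1\<^sup>2 = 0" using True by simp
      then have "s * (- c2 / l1)\<^sup>2 + d2 = 0" using l1 by (simp add: field_simps)
      then have "complex_of_real (s * (- c2 / l1)\<^sup>2 + d2) = 0" by (simp only: of_real_0)
      moreover have e: "coeff L2 1 = l1" "coeff Q2 2 = c2" "coeff A 2 = d2" "coeff L3 1 = \<kappa> * l1" "coeff Q3 2 = \<kappa> * c2"
        by (simp_all add: l0_l1_def cd L3' Q3')
      ultimately have ?inf unfolding e using l1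
        by (intro exI[of _ "of_real (- c2 / l1)"]) simp
      then show ?thesis ..
    qed
  qed
qed

lemma less_4_cases: "(j::nat) \<le> 3 \<Longrightarrow> j = 0 \<or> j = 1 \<or> j = 2 \<or> j = 3" by linarith

lemma pE_swap: "j \<le> 3 \<Longrightarrow> coeff (pE (swap z)) j = coeff (pE z) (3 - j)"
  by (drule less_4_cases) (auto simp: pE_def sol_polys swap_def eval_nat_numeral algebra_simps)

lemma degree_pE: "degree (pE z) \<le> 3"
  unfolding pE_def
  by (rule degree_diff_le; rule order_trans[OF degree_mult_le])
     (use degree_sol_polys(2-5)[of z] in linarith)+

text \<open>Otherwise the forms would have a common zero. The elimination needs a linear form of
  exact degree 1, and \<open>swap\<close> provides one when \<open>su0 z\<close> vanishes.\<close>

lemma pE_nonzero: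
  assumes s: "s \<noteq> 0" and nz: "no_common_zero s z" "no_zero_at_infinity s z" and u: "su0 z \<noteq> 0 \<or> su1 z \<noteq> 0"
  shows "pE z \<noteq> 0"
proof
  have main: False if nz: "no_common_zero s z" "no_zero_at_infinity s z" and u: "su0 z \<noteq> 0" and E: "pE z = 0" for z
  proof -
    have c: "coeff (pA z) 2 = sa0 z" "coeff (pL2 z) 1 = Re (su0 z)" "coeff (pL3 z) 1 = Im (su0 z)"
      "coeff (pQ2 z) 2 = Re (sv0 z)" "coeff (pQ3 z) 2 = Im (sv0 z)"
      by (simp_all add: sol_polys numeral_2_eq_2)
    have eq: "pL2 z * pQ3 z = pL3 z * pQ2 z" using E by (simp add: pE_def)
    from u consider "Re (su0 z) \<noteq> 0" | "Im (su0 z) \<noteq> 0" by (auto simp: complex_eq_iff)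
    then show False
    proof cases
      case 1
      from common_zero_of_proportional[OF s degree_sol_polys(2)[of z] degree_sol_polys(3)[of z] degree_sol_polys(4)[of z]
        degree_sol_polys(5)[of z] degree_sol_polys(1)[of z] _ eq] 1
      show False using nz unfolding no_common_zero_def no_zero_at_infinity_def c by blast
    next
      case 2
      from common_zero_of_proportional[OF s degree_sol_polys(3)[of z] degree_sol_polys(2)[of z] degree_sol_polys(5)[of z]
        degree_sol_polys(4)[of z] degree_sol_polys(1)[of z] _ eq[symmetric]] 2
      show False using nz unfolding no_common_zero_def no_zero_at_infinity_def c by blast
    qed
  qed
  assume E: "pE z = 0"
  show False
  proof (cases "su0 z = 0")
    case False
    then show False using main[OF nz _ E] by blast
  next
    case True
    have "coeff (pE (swap z)) j = 0" for j
    proof (cases "j \<le> 3")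
      case True
      then show ?thesis using pE_swap E by simp
    next
      case False
      then show ?thesis using degree_pE[of "swap z"] by (intro coeff_eq_0) simp
    qed
    then have "pE (swap z) = 0" by (simp add: poly_eq_iff)
    moreover have "su0 (swap z) \<noteq> 0" using u True by (simp add: swap_def)
    moreover have "no_zero_at_infinity s (swap z)"
      unfolding no_zero_at_infinity_def
    proof (intro allI notI)
      fix \<zeta> :: complex
      assume h: "of_real s * \<zeta>\<^sup>2 + of_real (sa0 (swap z)) = 0 \<and> of_real (Re (su0 (swap z))) * \<zeta> + of_real (Re (sv0 (swap z))) = 0 \<and>
        of_real (Im (su0 (swap z))) * \<zeta> + of_real (Im (sv0 (swap z))) = 0"
      have "poly (cx (pA z)) 0 = of_real (sa2 z)" "poly (cx (pL2 z)) 0 = of_real (Re (su1 z))" "poly (cx (pL3 z)) 0 = of_real (Im (su1 z))"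
        "poly (cx (pQ2 z)) 0 = of_real (Re (sv2 z))" "poly (cx (pQ3 z)) 0 = of_real (Im (sv2 z))"
        by (simp_all add: sol_polys)
      then show False using nz(1)[unfolded no_common_zero_def, rule_format, of \<zeta> 0] h by (simp add: swap_def)
    qed
    ultimately show False using main[OF no_common_zero_swap[OF nz]] by blast
  qed
qed

text \<open>Here w is c times the tangent of the orbit at z, so its hermitian product with z is \<i>
  c times a positive number and the slice condition forces c = 0.\<close>

lemma zero_if_orbit_tangent:
  assumes c: "su0 w = of_real c * \<i> * su0 z" "su1 w = of_real c * \<i> * su1 z" "sv0 w = of_real c * \<i> * sv0 z"
      "sv1 w = of_real c * \<i> * sv1 z" "sv2 w = of_real c * \<i> * sv2 z"
    and a: "sa0 w = 0" "sa1 w = 0" "sa2 w = 0" and u: "su0 z \<noteq> 0 \<or> su1 z \<noteq> 0" and h: "Im (herm z w) = 0"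
  shows "w = 0"
proof -
  define N where "N = (cmod (su0 z))\<^sup>2 + (cmod (su1 z))\<^sup>2 + (cmod (sv0 z))\<^sup>2 + (cmod (sv1 z))\<^sup>2 + (cmod (sv2 z))\<^sup>2"
  have m: "cnj a * (of_real c * \<i> * a) = of_real (c * (cmod a)\<^sup>2) * \<i>" for a
  proof -
    have "cnj a * (of_real c * \<i> * a) = of_real c * (a * cnj a) * \<i>" by (simp add: mult_ac)
    then show ?thesis by (simp only: complex_norm_square[symmetric] of_real_mult)
  qed
  have "herm z w = of_real (c * N) * \<i>"
    unfolding herm_def c m N_def by (simp add: algebra_simps)
  then have "c * N = 0" using h by simp
  moreover have "N > 0"
  proof -
    have "0 < (cmod (su0 z))\<^sup>2 + (cmod (su1 z))\<^sup>2" using u by (auto simp: add_pos_nonneg add_nonneg_pos)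
    then show ?thesis unfolding N_def by (simp add: add_pos_nonneg)
  qed
  ultimately have "c = 0" by simp
  then show ?thesis using c a by (simp add: prod_eq_iff)
qed

lemma complex_of_sol_polys:
  assumes "pL2 w = smult (- c) (pL3 z)" "pL3 w = smult c (pL2 z)"
    "pQ2 w = smult (- c) (pQ3 z)" "pQ3 w = smult c (pQ2 z)"
  shows "su0 w = of_real c * \<i> * su0 z" "su1 w = of_real c * \<i> * su1 z" "sv0 w = of_real c * \<i> * sv0 z"
      "sv1 w = of_real c * \<i> * sv1 z" "sv2 w = of_real c * \<i> * sv2 z"
  using assms by (simp_all add: sol_polys complex_eq_iff)

lemma bil_zero_polys:
  assumes "bil (s, z) (0, w) = 0"
  shows "smult s (pA w) + pL2 z * pL2 w + pL3 z * pL3 w = 0"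
    "pL2 z * pQ2 w + pL3 z * pQ3 w + pQ2 z * pL2 w + pQ3 z * pL3 w = 0"
    "pA z * pA w + pQ2 z * pQ2 w + pQ3 z * pQ3 w = 0"
  using assms unfolding zero_prod_def bil_eq_iff by simp_all

text \<open>Divisibility in the affine chart and, through the reversed polynomials of \<open>swap\<close>, at infinity
  compares degrees as for binary forms: \<open>L\<close> of degree 2 vanishes and \<open>K\<close> is a multiple of \<open>pE\<close>.\<close>
lemma kernel_pos:
  assumes s: "s \<noteq> 0" and nz: "no_common_zero s z" "no_zero_at_infinity s z" and u: "su0 z \<noteq> 0 \<or> su1 z \<noteq> 0"
    and k: "bil (s, z) (0, w) = 0" and h: "Im (herm z w) = 0"
  shows "w = 0"
proof -
  define L where "L = (\<lambda>z w. pL2 z * pL2 w + pL3 z * pL3 w)"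
  define K where "K = (\<lambda>z w. pQ2 z * pL2 w + pQ3 z * pL3 w)"
  note e = bil_zero_polys[OF k]
  note e' = bil_zero_polys[OF bil_swap[OF k]]
  have dz: "pE z dvd L z w" "pE z dvd K z w"
    using pE_dvd[OF s nz(1)[unfolded no_common_zero_def, rule_format] e] unfolding pE_def L_def K_def by blast+
  have ds: "pE (swap z) dvd L (swap z) (swap w)" "pE (swap z) dvd K (swap z) (swap w)"
    using pE_dvd[OF s no_common_zero_swap[OF nz, unfolded no_common_zero_def, rule_format] e'] unfolding pE_def L_def K_def by blast+
  have E0: "pE z \<noteq> 0" by (rule pE_nonzero[OF s nz u])
  have dL: "degree (L z w) \<le> 2" unfolding L_def
    by (rule degree_add_le; rule order_trans[OF degree_mult_le]) (use degree_sol_polys[of z] degree_sol_polys[of w] in linarith)+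
  have dK: "degree (K z w) \<le> 3" unfolding K_def
    by (rule degree_add_le; rule order_trans[OF degree_mult_le]) (use degree_sol_polys[of z] degree_sol_polys[of w] in linarith)+
  have cL: "coeff (L (swap z) (swap w)) j = coeff (L z w) (2 - j)" if "j \<le> 2" for j
  proof -
    have "j = 0 \<or> j = 1 \<or> j = 2" using that by linarith
    then show ?thesis by (auto simp: L_def sol_polys swap_def eval_nat_numeral algebra_simps)
  qed
  have cK: "coeff (K (swap z) (swap w)) j = coeff (K z w) (3 - j)" if "j \<le> 3" for j
    using less_4_cases[OF that] by (auto simp: K_def sol_polys swap_def eval_nat_numeral algebra_simps)
  have L0: "L z w = 0"
  proof (rule ccontr)
    assume "L z w \<noteq> 0"
    from degree_le_of_dvd_reflected[OF dz(1) ds(1) this degree_pE dL pE_swap cL] show False by linarith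
  qed
  obtain c where c: "K z w = smult c (pE z)"
  proof (cases "K z w = 0")
    case True
    then show ?thesis using that[of 0] by simp
  next
    case False
    from degree_le_of_dvd_reflected(2)[OF dz(2) ds(2) False degree_pE dK pE_swap cK]
    have d: "degree (K z w) \<le> degree (pE z)" by simp
    obtain q where q: "K z w = pE z * q" using dz(2) unfolding dvd_def by blast
    then have "degree q = 0" using d False E0 by (auto simp: degree_mult_eq)
    then obtain c where "q = [:c:]" by (rule degree_eq_zeroE)
    then show ?thesis using q that[of c] by simp
  qed
  let ?C = "[:c:]"
  have c': "K z w = ?C * pE z" using c by simp
  \<comment> \<open>Cramer's rule with determinant \<open>pE z\<close>: since L = 0 and K is c times
    the determinant, (pL2 w, pL3 w) is c times the rotation of (pL2 z, pL3 z) by a right angle. The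
    quadratic parts follow in the same way.\<close>
  have "pE z * pL2 w = pE z * (- ?C * pL3 z)"
  proof -
    have "pE z * pL2 w = pQ3 z * L z w - pL3 z * K z w" unfolding pE_def L_def K_def by (simp add: algebra_simps)
    then show ?thesis unfolding L0 c' by (simp add: algebra_simps)
  qed
  then have 1: "pL2 w = - ?C * pL3 z" by (rule mult_left_cancel[OF E0, THEN iffD1])
  have "pE z * pL3 w = pE z * (?C * pL2 z)"
  proof -
    have "pE z * pL3 w = pL2 z * K z w - pQ2 z * L z w" unfolding pE_def L_def K_def by (simp add: algebra_simps)
    then show ?thesis unfolding L0 c' by (simp add: algebra_simps)
  qed
  then have 2: "pL3 w = ?C * pL2 z" by (rule mult_left_cancel[OF E0, THEN iffD1])
  have "smult s (pA w) = 0" using e(1) L0 unfolding L_def by (simp add: add.assoc)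
  then have A0: "pA w = 0" using s by simp
  have e2: "pL2 z * pQ2 w + pL3 z * pQ3 w = - K z w" using e(2) unfolding K_def by (simp add: eq_neg_iff_add_eq_0 add.assoc)
  have e3: "pQ2 z * pQ2 w + pQ3 z * pQ3 w = 0" using e(3) A0 by simp
  have "pE z * pQ2 w = pE z * (- ?C * pQ3 z)"
  proof -
    have "pE z * pQ2 w = pQ3 z * (pL2 z * pQ2 w + pL3 z * pQ3 w) - pL3 z * (pQ2 z * pQ2 w + pQ3 z * pQ3 w)"
      unfolding pE_def by (simp add: algebra_simps)
    then show ?thesis unfolding e2 e3 c' by (simp add: algebra_simps)
  qed
  then have 3: "pQ2 w = - ?C * pQ3 z" by (rule mult_left_cancel[OF E0, THEN iffD1])
  have "pE z * pQ3 w = pE z * (?C * pQ2 z)"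
  proof -
    have "pE z * pQ3 w = pL2 z * (pQ2 z * pQ2 w + pQ3 z * pQ3 w) - pQ2 z * (pL2 z * pQ2 w + pL3 z * pQ3 w)"
      unfolding pE_def by (simp add: algebra_simps)
    then show ?thesis unfolding e2 e3 c' by (simp add: algebra_simps)
  qed
  then have 4: "pQ3 w = ?C * pQ2 z" by (rule mult_left_cancel[OF E0, THEN iffD1])
  have sm: "pL2 w = smult (- c) (pL3 z)" "pL3 w = smult c (pL2 z)" "pQ2 w = smult (- c) (pQ3 z)" "pQ3 w = smult c (pQ2 z)"
    using 1 2 3 4 by simp_all
  show ?thesis
    by (rule zero_if_orbit_tangent[OF complex_of_sol_polys[OF sm] _ _ _ u h]) (use A0 in \<open>simp_all add: pA_def\<close>)
qed

text \<open>At s = 0 the equation for f2 already forces the variation of the linear forms to be an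
  infinitesimal rotation. After subtracting it from the quadratic parts, Cramer's rule relates the
  rest H2, H3 to \<open>pA w\<close> through \<open>pE z\<close> and \<open>pA z\<close>. These have
  no common affine root, and \<open>deg\<close> excludes one at infinity, so divisibility and
  degrees make everything proportional; independence of the linear forms then gives 0.\<close>

lemma kernel_zero:
  assumes ind: "Re (su0 z) * Im (su1 z) - Im (su0 z) * Re (su1 z) \<noteq> 0"
    and cop: "\<And>\<alpha>. \<not> (poly (cx (pA z)) \<alpha> = 0 \<and> poly (cx (pE z)) \<alpha> = 0)"
    and deg: "degree (pE z) = 3 \<or> degree (pA z) = 2"
    and k: "bil (0, z) (0, w) = 0" and h: "Im (herm z w) = 0"
  shows "w = 0"
proof -
  have coef: "Re (su0 z) * Re (su0 w) + Im (su0 z) * Im (su0 w) = 0" "Re (su1 z) * Re (su1 w) + Im (su1 z) * Im (su1 w) = 0"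
    "Re (su0 z) * Re (su1 w) + Im (su0 z) * Im (su1 w) + (Re (su1 z) * Re (su0 w) + Im (su1 z) * Im (su0 w)) = 0"
    using k unfolding zero_prod_def bil_def Let_def fst_conv snd_conv prod.inject by (auto simp: inner_complex_def)
  \<comment> \<open>A plane vector orthogonal to (p, q) is a multiple of its rotation. The two
    multiples found below agree by the mixed coefficient of f2.\<close>
  have par: "\<exists>c. x = - c * q \<and> y = c * p" if "p * x + q * y = 0" "p \<noteq> 0 \<or> q \<noteq> 0" for p q x y :: real
  proof -
    define N d where "N = p * p + q * q" "d = p * y - q * x"
    note Nd = this
    have N: "N > 0" unfolding Nd using that(2) by (simp add: sum_squares_gt_zero_iff)
    have "x * N = p * (p * x + q * y) - d * q" "y * N = q * (p * x + q * y) + d * p"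
      unfolding Nd by (simp_all add: algebra_simps)
    then have "x * N = - d * q" "y * N = d * p" unfolding that(1) by simp_all
    then show ?thesis using N by (intro exI[of _ "d / N"]) (simp add: field_simps)
  qed
  obtain c where c: "Re (su0 w) = - c * Im (su0 z)" "Im (su0 w) = c * Re (su0 z)"
    using par[OF coef(1)] ind by force
  obtain c' where c': "Re (su1 w) = - c' * Im (su1 z)" "Im (su1 w) = c' * Re (su1 z)"
    using par[OF coef(2)] ind by force
  have "(c - c') * (Re (su0 z) * Im (su1 z) - Im (su0 z) * Re (su1 z)) = 0"
    using coef(3) unfolding c c' by (simp add: algebra_simps)
  then have cc: "c' = c" using ind by simp
  have M: "pL2 w = smult (- c) (pL3 z)" "pL3 w = smult c (pL2 z)"
    unfolding sol_polys by (simp_all add: c c' cc)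
  note e = bil_zero_polys[OF k]
  let ?C = "[:c:]"
  have M': "pL2 w = - ?C * pL3 z" "pL3 w = ?C * pL2 z" using M by simp_all
  define H2 where "H2 = pQ2 w + ?C * pQ3 z"
  define H3 where "H3 = pQ3 w - ?C * pQ2 z"
  have h1: "pL2 z * H2 + pL3 z * H3 = 0"
    using e(2) unfolding H2_def H3_def M' by (simp add: algebra_simps)
  have h2: "pQ2 z * H2 + pQ3 z * H3 = - (pA z * pA w)"
    using e(3) unfolding H2_def H3_def by (simp add: eq_neg_iff_add_eq_0 algebra_simps)
  have E2: "pE z * H2 = pL3 z * (pA z * pA w)"
  proof -
    have "pE z * H2 = pQ3 z * (pL2 z * H2 + pL3 z * H3) - pL3 z * (pQ2 z * H2 + pQ3 z * H3)"
      unfolding pE_def by (simp add: algebra_simps)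
    then show ?thesis unfolding h1 h2 by simp
  qed
  have E3: "pE z * H3 = - (pL2 z * (pA z * pA w))"
  proof -
    have "pE z * H3 = pL2 z * (pQ2 z * H2 + pQ3 z * H3) - pQ2 z * (pL2 z * H2 + pL3 z * H3)"
      unfolding pE_def by (simp add: algebra_simps)
    then show ?thesis unfolding h1 h2 by simp
  qed
  have indep: "a = 0 \<and> b = 0" if "smult a (pL2 z) + smult b (pL3 z) = 0" for a b
  proof -
    have e: "a * Re (su0 z) + b * Im (su0 z) = 0" "a * Re (su1 z) + b * Im (su1 z) = 0"
      using that by (auto simp: sol_polys)
    have "a * (Re (su0 z) * Im (su1 z) - Im (su0 z) * Re (su1 z)) = Im (su1 z) * (a * Re (su0 z) + b * Im (su0 z)) - Im (su0 z) * (a * Re (su1 z) + b * Im (su1 z))"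
      "b * (Re (su0 z) * Im (su1 z) - Im (su0 z) * Re (su1 z)) = Re (su0 z) * (a * Re (su1 z) + b * Im (su1 z)) - Re (su1 z) * (a * Re (su0 z) + b * Im (su0 z))"
      by (simp_all add: algebra_simps)
    then show ?thesis using e ind by auto
  qed
  have L2n: "pL2 z \<noteq> 0" using indep[of 1 0] by auto
  have An: "pA z \<noteq> 0 \<or> pE z \<noteq> 0" using cop[of 0] by auto
  have const: "\<exists>c. p = smult c q" if "q dvd p" "degree p \<le> degree q" for p q :: "real poly"
  proof (cases "p = 0")
    case True then show ?thesis by (intro exI[of _ 0]) simp
  next
    case False
    obtain r where r: "p = q * r" using \<open>q dvd p\<close> unfolding dvd_def by blast
    then have "degree r = 0" using that(2) False by (auto simp: degree_mult_eq)
    then obtain c where "r = [:c:]" by (rule degree_eq_zeroE)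
    then show ?thesis using r by (intro exI[of _ c]) simp
  qed
  have dA: "degree (pA w) \<le> 2" by (rule degree_sol_polys)
  have A'0: "pA w = 0" and H0: "H2 = 0 \<and> H3 = 0"
  proof -
    have "pA w = 0 \<and> H2 = 0 \<and> H3 = 0"
      using deg
    proof
      assume d3: "degree (pE z) = 3"
      then have En: "pE z \<noteq> 0" by auto
      have "pE z dvd pA z * (pL3 z * pA w)" "pE z dvd pA z * (pL2 z * pA w)"
        using dvdI[OF E2[symmetric]] dvdI[of "- (pL2 z * (pA z * pA w))", OF E3[symmetric]] by (simp_all add: mult_ac)
      then have "pE z dvd pL3 z * pA w" "pE z dvd pL2 z * pA w"
        using no_common_root_dvd[of "pE z" "pA z" "pA z" "pA z"] cop by blast+
      moreover have "degree (pL3 z * pA w) \<le> degree (pE z)" "degree (pL2 z * pA w) \<le> degree (pE z)"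
        unfolding d3 by (rule order_trans[OF degree_mult_le], use degree_sol_polys[of z] dA in linarith)+
      ultimately obtain a b where ab: "pL3 z * pA w = smult a (pE z)" "pL2 z * pA w = smult b (pE z)" using const by metis
      have "pA w * (smult a (pL2 z) + smult (- b) (pL3 z)) = smult a (pL2 z * pA w) - smult b (pL3 z * pA w)"
        by (simp add: algebra_simps)
      also have "\<dots> = 0" unfolding ab by (simp add: mult.commute)
      finally have "pA w = 0 \<or> smult a (pL2 z) + smult (- b) (pL3 z) = 0" by simp
      then have A0: "pA w = 0"
      proof
        assume "smult a (pL2 z) + smult (- b) (pL3 z) = 0"
        then have "b = 0" using indep[of a "- b"] by simp
        then show ?thesis using ab(2) L2n by simp
      qed simp
      then show ?thesis using E2 E3 En by simp
    next
      assume d2: "degree (pA z) = 2"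
      then have A0: "pA z \<noteq> 0" by auto
      have "pA z dvd pE z * H2" "pA z dvd pE z * H3" unfolding E2 E3 by (simp_all add: mult.left_commute)
      then have "pA z dvd H2" "pA z dvd H3"
        using no_common_root_dvd[of "pA z" "pE z" "pE z" "pE z"] cop by blast+
      moreover have "degree H2 \<le> degree (pA z)" "degree H3 \<le> degree (pA z)"
        unfolding d2 H2_def H3_def using degree_sol_polys[of z] degree_sol_polys[of w]
        by (auto intro!: degree_add_le degree_diff_le order_trans[OF degree_smult_le])
      ultimately obtain a b where ab: "H2 = smult a (pA z)" "H3 = smult b (pA z)" using const by metis
      have "pA z * (smult a (pL2 z) + smult b (pL3 z)) = 0" using h1 unfolding ab by (simp add: algebra_simps)
      then have "a = 0 \<and> b = 0" using A0 indep by simp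
      then have H: "H2 = 0" "H3 = 0" using ab by simp_all
      then have "pL2 z * (pA z * pA w) = 0" using E3 by simp
      then show ?thesis using H A0 L2n by simp
    qed
    then show "pA w = 0" "H2 = 0 \<and> H3 = 0" by blast+
  qed
  have "pQ2 w = smult (- c) (pQ3 z)" "pQ3 w = smult c (pQ2 z)"
    using H0 unfolding H2_def H3_def by (simp_all add: eq_neg_iff_add_eq_0)
  note sm = M this
  have u: "su0 z \<noteq> 0 \<or> su1 z \<noteq> 0" using ind by auto
  show ?thesis
    by (rule zero_if_orbit_tangent[OF complex_of_sol_polys[OF sm] _ _ _ u h]) (use A'0 in \<open>simp_all add: pA_def\<close>)
qed

section \<open>Singular points of the pencil\<close>

text \<open>Up to sign \<open>gfun\<close> is the dehomogenized Jacobian of two binary forms. The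
  formal top coefficient cancels, and the explicit lists exhibit degree i + j - 2.\<close>

lemma gfun_23_eq:
  "gfun 2 3 [:f22, f21, f20:] [:f33, f32, f31, f30:] =
    [:2*f22*f32 + (-3)*f21*f33, 4*f22*f31 + (-1)*f21*f32 + (-6)*f20*f33, 6*f22*f30 + 1*f21*f31 + (-4)*f20*f32, 3*f21*f30 + (-2)*f20*f31:]"
  by (simp add: gfun_def pderiv_pCons algebra_simps)

lemma gfun_24_eq:
  "gfun 2 4 [:f22, f21, f20:] [:f44, f43, f42, f41, f40:] =
    [:2*f22*f43 + (-4)*f21*f44, 4*f22*f42 + (-2)*f21*f43 + (-8)*f20*f44, 6*f22*f41 + (-6)*f20*f43, 8*f22*f40 + 2*f21*f41 + (-4)*f20*f42, 4*f21*f40 + (-2)*f20*f41:]"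
  by (simp add: gfun_def pderiv_pCons algebra_simps)

lemma gfun_34_eq:
  "gfun 3 4 [:f33, f32, f31, f30:] [:f44, f43, f42, f41, f40:] =
    [:3*f33*f43 + (-4)*f32*f44, 6*f33*f42 + (-1)*f32*f43 + (-8)*f31*f44, 9*f33*f41 + 2*f32*f42 + (-5)*f31*f43 + (-12)*f30*f44, 12*f33*f40 + 5*f32*f41 + (-2)*f31*f42 + (-9)*f30*f43, 8*f32*f40 + 1*f31*f41 + (-6)*f30*f42, 4*f31*f40 + (-3)*f30*f41:]"
  by (simp add: gfun_def pderiv_pCons algebra_simps)

text \<open>With w = f2 \<zeta> + 3 t \<zeta>^3 one has f4 = \<zeta> w, Q = 2 t (g23 w \<zeta>^3)^2
  and R = - 16 t g23 w \<zeta>^3, so the constant is 16^2 / 2 = 128.\<close>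

lemma singular_point_relation:
  fixes t f2 f3 f4 \<zeta> g23 g24 :: complex
  assumes "f3 = - 4 * t * \<zeta> ^ 3 - 2 * f2 * \<zeta>" "f4 = 3 * t * \<zeta> ^ 4 + f2 * \<zeta>\<^sup>2" "g24 = - \<zeta> * g23"
  shows "128 * t * (f4\<^sup>2 * g23 * (2 * f4 * g23 - f3 * g24)) = ((8 * f2 * f4 - 3 * f3\<^sup>2) * g23 + 2 * f2 * f3 * g24)\<^sup>2"
proof -
  have 1: "2 * f4 * g23 - f3 * g24 = g23 * (2 * t * \<zeta> ^ 4)"
    unfolding assms by (simp add: algebra_simps eval_nat_numeral)
  have 2: "(8 * f2 * f4 - 3 * f3\<^sup>2) * g23 + 2 * f2 * f3 * g24 = - g23 * (16 * t * \<zeta> ^ 3 * (f2 * \<zeta> + 3 * t * \<zeta> ^ 3))"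
    unfolding assms by (simp add: algebra_simps eval_nat_numeral)
  have 3: "f4 = \<zeta> * (f2 * \<zeta> + 3 * t * \<zeta> ^ 3)"
    unfolding assms by (simp add: algebra_simps eval_nat_numeral)
  show ?thesis unfolding 1 2 by (subst 3) (simp add: algebra_simps eval_nat_numeral)
qed

lemma degree_explicit_le: "degree [:a0, a1, a2, a3:] \<le> 3" "degree [:a0, a1, a2, a3, a4:] \<le> 4" "degree [:a0, a1, a2, a3, a4, a5:] \<le> 5"
  by (auto intro!: order_trans[OF degree_pCons_le])

lemma degree_num: "degree (numeral k * p) \<le> degree p" for p :: "real poly"
  by (simp add: numeral_poly)

lemma degree_mult_le_add: "degree p \<le> a \<Longrightarrow> degree q \<le> b \<Longrightarrow> a + b \<le> c \<Longrightarrow> degree (p * q) \<le> c" for p q :: "real poly"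
  by (rule order_trans[OF degree_mult_le]) linarith

locale nonsingular_pencil =
  fixes F2 F3 F4 :: "real poly"
  assumes deg: "degree F2 \<le> 2" "degree F3 \<le> 3" "degree F4 \<le> 4"
begin

definition g23 where "g23 = gfun 2 3 F2 F3"
definition g24 where "g24 = gfun 2 4 F2 F4"
definition g34 where "g34 = gfun 3 4 F3 F4"
definition P where "P = g23 * g34 - g24\<^sup>2"
definition Q where "Q = F4\<^sup>2 * g23 * (2 * F4 * g23 - F3 * g24)"
definition R where "R = (8 * F2 * F4 - 3 * F3\<^sup>2) * g23 + 2 * F2 * F3 * g24"

lemma explicit:
  "F2 = [:coeff F2 0, coeff F2 1, coeff F2 2:]"
  "F3 = [:coeff F3 0, coeff F3 1, coeff F3 2, coeff F3 3:]"
  "F4 = [:coeff F4 0, coeff F4 1, coeff F4 2, coeff F4 3, coeff F4 4:]"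
  using deg by (auto intro!: poly_eqI simp: coeff_pCons coeff_eq_0 eval_nat_numeral split: nat.splits)

lemma g_degrees: "degree g23 \<le> 3" "degree g24 \<le> 4" "degree g34 \<le> 5"
  and g_leads: "coeff g23 3 = 3 * coeff F3 3 * coeff F2 1 - 2 * coeff F2 2 * coeff F3 2"
    "coeff g24 4 = 4 * coeff F4 4 * coeff F2 1 - 2 * coeff F2 2 * coeff F4 3"
    "coeff g34 5 = 4 * coeff F4 4 * coeff F3 2 - 3 * coeff F3 3 * coeff F4 3"
proof -
  obtain f22 f21 f20 where 2: "F2 = [:f22, f21, f20:]" using explicit by blast
  obtain f33 f32 f31 f30 where 3: "F3 = [:f33, f32, f31, f30:]" using explicit by blast
  obtain f44 f43 f42 f41 f40 where 4: "F4 = [:f44, f43, f42, f41, f40:]" using explicit by blast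
  show "degree g23 \<le> 3" "degree g24 \<le> 4" "degree g34 \<le> 5"
    unfolding g23_def g24_def g34_def unfolding 2 3 4 gfun_23_eq gfun_24_eq gfun_34_eq by (rule degree_explicit_le)+
  show "coeff g23 3 = 3 * coeff F3 3 * coeff F2 1 - 2 * coeff F2 2 * coeff F3 2"
    "coeff g24 4 = 4 * coeff F4 4 * coeff F2 1 - 2 * coeff F2 2 * coeff F4 3"
    "coeff g34 5 = 4 * coeff F4 4 * coeff F3 2 - 3 * coeff F3 3 * coeff F4 3"
    unfolding g23_def g24_def g34_def unfolding 2 3 4 gfun_23_eq gfun_24_eq gfun_34_eq
    by (simp_all add: eval_nat_numeral)
qed

lemma degree_P: "degree P \<le> 8"
  unfolding P_def power2_eq_square
  by (rule degree_diff_le; rule degree_mult_le_add, rule g_degrees, rule g_degrees, simp)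

lemma degree_Q: "degree Q \<le> 18"
proof -
  have "degree (2 * F4 * g23) \<le> 7" unfolding mult.assoc
    by (rule order_trans[OF degree_num], rule degree_mult_le_add, rule deg, rule g_degrees, simp)
  moreover have "degree (F3 * g24) \<le> 7" by (rule degree_mult_le_add, rule deg, rule g_degrees, simp)
  ultimately have 1: "degree (2 * F4 * g23 - F3 * g24) \<le> 7" by (rule degree_diff_le)
  have "degree (F4\<^sup>2) \<le> 8" unfolding power2_eq_square by (rule degree_mult_le_add, rule deg, rule deg, simp)
  then have "degree (F4\<^sup>2 * g23) \<le> 11" by (rule degree_mult_le_add) (rule g_degrees, simp)
  then show ?thesis unfolding Q_def by (rule degree_mult_le_add) (rule 1, simp)
qed

lemma degree_R2: "degree (R\<^sup>2) \<le> 18"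
proof -
  have "degree (8 * F2 * F4) \<le> 6" unfolding mult.assoc
    by (rule order_trans[OF degree_num], rule degree_mult_le_add, rule deg, rule deg, simp)
  moreover have "degree (3 * F3\<^sup>2) \<le> 6" unfolding power2_eq_square
    by (rule order_trans[OF degree_num], rule degree_mult_le_add, rule deg, rule deg, simp)
  ultimately have "degree (8 * F2 * F4 - 3 * F3\<^sup>2) \<le> 6" by (rule degree_diff_le)
  then have 1: "degree ((8 * F2 * F4 - 3 * F3\<^sup>2) * g23) \<le> 9" by (rule degree_mult_le_add) (rule g_degrees, simp)
  have "degree (2 * F2 * F3) \<le> 5" unfolding mult.assoc
    by (rule order_trans[OF degree_num], rule degree_mult_le_add, rule deg, rule deg, simp)
  then have "degree (2 * F2 * F3 * g24) \<le> 9" by (rule degree_mult_le_add) (rule g_degrees, simp)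
  with 1 have "degree R \<le> 9" unfolding R_def by (rule degree_add_le)
  from degree_mult_le_add[OF this this] show ?thesis unfolding power2_eq_square by simp
qed

lemma real_root:
  assumes "of_real a * \<zeta> + of_real b = (0::complex)" "a \<noteq> 0"
  shows "\<zeta> = of_real (- b / a)"
  using assms by (simp add: field_simps eq_neg_iff_add_eq_0 add.commute)

lemma no_singular_point:
  assumes cop: "coprime g23 g24" and E9: "disc 8 P \<noteq> 0" and E10: "Phi 8 18 P Q (R\<^sup>2) \<noteq> 0"
    and t: "t > 0" and pos: "\<And>x y. t * y ^ 4 + poly F2 x * y\<^sup>2 + poly F3 x * y + poly F4 x > 0"
    and a: "of_real t * \<zeta> ^ 4 + poly (cx F2) \<alpha> * \<zeta>\<^sup>2 + poly (cx F3) \<alpha> * \<zeta> + poly (cx F4) \<alpha> = 0"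
    and b: "4 * of_real t * \<zeta> ^ 3 + 2 * poly (cx F2) \<alpha> * \<zeta> + poly (cx F3) \<alpha> = 0"
    and c: "poly (pderiv (cx F2)) \<alpha> * \<zeta>\<^sup>2 + poly (pderiv (cx F3)) \<alpha> * \<zeta> + poly (pderiv (cx F4)) \<alpha> = 0"
  shows False
proof -
  define f2 f3 f4 where f: "f2 = poly (cx F2) \<alpha>" "f3 = poly (cx F3) \<alpha>" "f4 = poly (cx F4) \<alpha>"
  define d2 d3 d4 where d: "d2 = poly (pderiv (cx F2)) \<alpha>" "d3 = poly (pderiv (cx F3)) \<alpha>" "d4 = poly (pderiv (cx F4)) \<alpha>"
  define h23 h24 h34 where h: "h23 = poly (cx g23) \<alpha>" "h24 = poly (cx g24) \<alpha>" "h34 = poly (cx g34) \<alpha>"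
  have hv: "h23 = 2 * (f2 * d3) - 3 * (f3 * d2)" "h24 = 2 * (f2 * d4) - 4 * (f4 * d2)" "h34 = 3 * (f3 * d4) - 4 * (f4 * d3)"
    unfolding h g23_def g24_def g34_def gfun_def f d by simp_all
  have f3: "f3 = - 4 * of_real t * \<zeta> ^ 3 - 2 * f2 * \<zeta>" using b unfolding f[symmetric]
    by (simp add: eq_neg_iff_add_eq_0 algebra_simps)
  have "f4 = - (of_real t * \<zeta> ^ 4 + f2 * \<zeta>\<^sup>2 + f3 * \<zeta>)" using a unfolding f[symmetric]
    by (simp add: eq_neg_iff_add_eq_0 algebra_simps)
  then have f4: "f4 = 3 * of_real t * \<zeta> ^ 4 + f2 * \<zeta>\<^sup>2" unfolding f3 by (simp add: algebra_simps eval_nat_numeral)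
  \<comment> \<open>Four times the equation minus \<zeta> times its \<zeta>-derivative is free of t.
    With the \<alpha>-derivative \<open>e2\<close> it forms two quadratics in \<zeta>: removing
    \<zeta>^2 gives \<open>r1\<close>, removing the linear term gives \<open>r2\<close>, and
    together they give P = 0.\<close>
  have e1: "2 * f2 * \<zeta>\<^sup>2 + 3 * f3 * \<zeta> + 4 * f4 = 0" unfolding f4 f3 by (simp add: algebra_simps eval_nat_numeral)
  have e2: "d2 * \<zeta>\<^sup>2 + d3 * \<zeta> + d4 = 0" using c unfolding d .
  have r1: "h23 * \<zeta> + h24 = 0"
  proof -
    have "h23 * \<zeta> + h24 = 2 * f2 * (d2 * \<zeta>\<^sup>2 + d3 * \<zeta> + d4) - d2 * (2 * f2 * \<zeta>\<^sup>2 + 3 * f3 * \<zeta> + 4 * f4)"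
      unfolding hv by (simp add: algebra_simps)
    then show ?thesis unfolding e1 e2 by simp
  qed
  have r2: "h23 * \<zeta>\<^sup>2 = h34"
  proof -
    have "h34 - h23 * \<zeta>\<^sup>2 = 3 * f3 * (d2 * \<zeta>\<^sup>2 + d3 * \<zeta> + d4) - d3 * (2 * f2 * \<zeta>\<^sup>2 + 3 * f3 * \<zeta> + 4 * f4)"
      unfolding hv by (simp add: algebra_simps)
    then show ?thesis unfolding e1 e2 by simp
  qed
  have h24: "h24 = - \<zeta> * h23" using r1 by (simp add: eq_neg_iff_add_eq_0 algebra_simps)
  have P\<alpha>: "poly (cx P) \<alpha> = 0"
    unfolding P_def by (simp add: h[symmetric] r2[symmetric] h24 power2_eq_square)
  \<comment> \<open>If g23 vanished at \<alpha>, so would g24 by \<open>r1\<close>, against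
    coprimality. Therefore \<zeta> is determined by \<alpha>, and is real when \<alpha> is.\<close>
  have h23: "h23 \<noteq> 0"
    using coprime_no_common_root[OF cop, of \<alpha>] h24 unfolding h by auto
  have QR: "128 * of_real t * poly (cx Q) \<alpha> = (poly (cx R) \<alpha>)\<^sup>2"
    using singular_point_relation[OF f3 f4 h24] unfolding Q_def R_def by (simp add: h[symmetric] f[symmetric])
  show False
  proof (cases "Im \<alpha> = 0")
    case True
    define x where "x = Re \<alpha>"
    have \<alpha>: "\<alpha> = of_real x" using True by (simp add: x_def complex_eq_iff)
    have "of_real (poly g23 x) * \<zeta> + of_real (poly g24 x) = (0::complex)" "poly g23 x \<noteq> 0"
      using r1 h23 unfolding h \<alpha> by simp_all
    then obtain y where y: "\<zeta> = of_real y" using real_root by blast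
    have "complex_of_real (t * y ^ 4 + poly F2 x * y\<^sup>2 + poly F3 x * y + poly F4 x) = 0"
      using a unfolding \<alpha> y by simp
    then have "t * y ^ 4 + poly F2 x * y\<^sup>2 + poly F3 x * y + poly F4 x = 0" by (simp only: of_real_eq_0_iff)
    then show False using pos[of y x] by simp
  next
    case False
    then have ne: "\<alpha> \<noteq> cnj \<alpha>" by (simp add: complex_eq_iff)
    \<comment> \<open>The persistence of roots in \<open>Phi_eq_0\<close> needs a nonzero
      polynomial; the zero polynomial has discriminant 0.\<close>
    have P0: "P \<noteq> 0" using E9 disc_eq_0_degenerate[of 0 8] by auto
    have t0: "complex_of_real t \<noteq> 0" using t by simp
    have QR': "128 * of_real t * poly (cx Q) (cnj \<alpha>) = (poly (cx R) (cnj \<alpha>))\<^sup>2"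
      using arg_cong[OF QR, of cnj] by (simp add: poly_cx_cnj)
    have "128 * of_real t * (poly (cx Q) \<alpha> * (poly (cx R) (cnj \<alpha>))\<^sup>2) = 128 * of_real t * (poly (cx Q) (cnj \<alpha>) * (poly (cx R) \<alpha>)\<^sup>2)"
      unfolding QR[symmetric] QR'[symmetric] by (simp add: mult_ac)
    then have "poly (cx Q) \<alpha> * (poly (cx R) (cnj \<alpha>))\<^sup>2 = poly (cx Q) (cnj \<alpha>) * (poly (cx R) \<alpha>)\<^sup>2"
      using t0 by simp
    then have "Phi 8 18 P Q (R\<^sup>2) = 0"
      using P\<alpha> by (intro Phi_eq_0[OF P0 degree_P degree_Q degree_R2 _ ne]) (auto simp: poly_cx_cnj)
    then show False using E10 by blast
  qed
qed

text \<open>Positivity makes \<zeta> nonreal, so the elimination relations, which are linear in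
  \<zeta> with real coefficients, must vanish coefficientwise. Those coefficients are the leading
  ones of g23, g24 and g34; P then has degree at most 6 and a double root at infinity.\<close>

lemma no_singular_point_at_infinity:
  assumes E9: "disc 8 P \<noteq> 0" and pos: "\<And>y. t * y ^ 4 + coeff F2 2 * y\<^sup>2 + coeff F3 3 * y + coeff F4 4 > 0"
    and a: "of_real t * \<zeta> ^ 4 + of_real (coeff F2 2) * \<zeta>\<^sup>2 + of_real (coeff F3 3) * \<zeta> + of_real (coeff F4 4) = (0::complex)"
    and b: "4 * of_real t * \<zeta> ^ 3 + 2 * of_real (coeff F2 2) * \<zeta> + of_real (coeff F3 3) = (0::complex)"
    and c: "of_real (coeff F2 1) * \<zeta>\<^sup>2 + of_real (coeff F3 2) * \<zeta> + of_real (coeff F4 3) = (0::complex)"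
  shows False
proof -
  define c2 c3 c4 d2 d3 d4 where v: "c2 = coeff F2 2" "c3 = coeff F3 3" "c4 = coeff F4 4" "d2 = coeff F2 1" "d3 = coeff F3 2" "d4 = coeff F4 3"
  define k23 where "k23 = 3 * c3 * d2 - 2 * c2 * d3"
  define k24 where "k24 = 4 * c4 * d2 - 2 * c2 * d4"
  define k34 where "k34 = 4 * c4 * d3 - 3 * c3 * d4"
  have e1: "2 * of_real c2 * \<zeta>\<^sup>2 + 3 * of_real c3 * \<zeta> + 4 * of_real c4 = (0::complex)"
  proof -
    have "2 * of_real c2 * \<zeta>\<^sup>2 + 3 * of_real c3 * \<zeta> + 4 * of_real c4
      = 4 * (of_real t * \<zeta> ^ 4 + of_real c2 * \<zeta>\<^sup>2 + of_real c3 * \<zeta> + of_real c4) - \<zeta> * (4 * of_real t * \<zeta> ^ 3 + 2 * of_real c2 * \<zeta> + of_real c3)"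
      by (simp add: algebra_simps eval_nat_numeral)
    then show ?thesis using a b unfolding v by simp
  qed
  have e2: "of_real d2 * \<zeta>\<^sup>2 + of_real d3 * \<zeta> + of_real d4 = (0::complex)" using c unfolding v .
  have im: "Im \<zeta> \<noteq> 0"
  proof
    assume "Im \<zeta> = 0"
    then have y: "\<zeta> = of_real (Re \<zeta>)" by (simp add: complex_eq_iff)
    define y where "y = Re \<zeta>"
    have \<zeta>: "\<zeta> = of_real y" using y by (simp add: y_def)
    have "complex_of_real (t * y ^ 4 + c2 * y\<^sup>2 + c3 * y + c4) = 0"
      using a unfolding v \<zeta> by simp
    then have "t * y ^ 4 + c2 * y\<^sup>2 + c3 * y + c4 = 0" by (simp only: of_real_eq_0_iff)
    then show False using pos[of y] unfolding v by simp
  qed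
  have r1: "of_real k23 * \<zeta> + of_real k24 = (0::complex)"
  proof -
    have "of_real k23 * \<zeta> + of_real k24 = of_real d2 * (2 * of_real c2 * \<zeta>\<^sup>2 + 3 * of_real c3 * \<zeta> + 4 * of_real c4)
      - 2 * of_real c2 * (of_real d2 * \<zeta>\<^sup>2 + of_real d3 * \<zeta> + of_real d4)"
      unfolding k23_def k24_def by (simp add: algebra_simps)
    then show ?thesis unfolding e1 e2 by simp
  qed
  have "k23 * Im \<zeta> = 0" using arg_cong[OF r1, of Im] by simp
  then have k23: "k23 = 0" using im by simp
  then have k24: "k24 = 0" using r1 by simp
  have "of_real k24 * \<zeta>\<^sup>2 + of_real k34 * \<zeta> = 4 * of_real c4 * (of_real d2 * \<zeta>\<^sup>2 + of_real d3 * \<zeta> + of_real d4)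
    - of_real d4 * (2 * of_real c2 * \<zeta>\<^sup>2 + 3 * of_real c3 * \<zeta> + 4 * of_real c4)"
    unfolding k34_def k24_def by (simp add: algebra_simps)
  then have "of_real k34 * \<zeta> = (0::complex)" unfolding e1 e2 k24 by simp
  then have k34: "k34 = 0" using im by auto
  have low: "degree p \<le> n" if "degree p \<le> Suc n" "coeff p (Suc n) = 0" for p :: "real poly" and n
    using that by (metis le_SucE leading_coeff_0_iff degree_0 le0)
  have "degree g23 \<le> 2" using low[of g23 2] g_degrees(1) g_leads(1) k23 unfolding k23_def v by simp
  moreover have "degree g24 \<le> 3" using low[of g24 3] g_degrees(2) g_leads(2) k24 unfolding k24_def v by simp
  moreover have "degree g34 \<le> 4" using low[of g34 4] g_degrees(3) g_leads(3) k34 unfolding k34_def v by simp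
  ultimately have "degree P \<le> 6" unfolding P_def power2_eq_square
    by (intro degree_diff_le degree_mult_le_add[of g23 2 g34 4] degree_mult_le_add[of g24 3 g24 3]) auto
  then have "coeff P 8 = 0" "coeff P 7 = 0" by (auto intro: coeff_eq_0)
  then have "disc 8 P = 0" using degree_P by (intro disc_eq_0_degenerate) auto
  then show False using E9 by blast
qed

end

section \<open>Gram vectors of a representation\<close>

no_notation fps_nth (infixl "$" 75)

text \<open>Arguments are listed by descending powers of x, opposite to the coefficient lists, as in
  the tuples of type \<open>sol\<close> and \<open>rhs\<close>.\<close>

definition form1 :: "real \<Rightarrow> real \<Rightarrow> bipoly" where "form1 a b = [:[:0, b:], [:a:]:]"
definition form2 :: "real \<Rightarrow> real \<Rightarrow> real \<Rightarrow> bipoly" where "form2 a b c = [:[:0, 0, c:], [:0, b:], [:a:]:]"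
definition form3 :: "real \<Rightarrow> real \<Rightarrow> real \<Rightarrow> real \<Rightarrow> bipoly" where
  "form3 a b c d = [:[:0, 0, 0, d:], [:0, 0, c:], [:0, b:], [:a:]:]"
definition form4 :: "real \<Rightarrow> real \<Rightarrow> real \<Rightarrow> real \<Rightarrow> real \<Rightarrow> bipoly" where
  "form4 a b c d e = [:[:0, 0, 0, 0, e:], [:0, 0, 0, d:], [:0, 0, c:], [:0, b:], [:a:]:]"

lemmas form_defs = form1_def form2_def form3_def form4_def

lemma bihom_eqI:
  assumes "bihom n f" "bihom n g" "\<And>i. i \<le> n \<Longrightarrow> coeff (coeff f i) (n - i) = coeff (coeff g i) (n - i)"
  shows "f = g"
proof (intro poly_eqI)
  fix i j
  show "coeff (coeff f i) j = coeff (coeff g i) j"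
  proof (cases "i + j = n")
    case True
    then show ?thesis using assms(3)[of i] by (metis add_diff_cancel_left' le_add1)
  next
    case False
    then show ?thesis using assms(1,2) unfolding bihom_def by metis
  qed
qed

lemma bihom_forms: "bihom 1 (form1 a b)" "bihom 2 (form2 a b c)" "bihom 3 (form3 a b c d)" "bihom 4 (form4 a b c d e)"
  by (auto simp: bihom_def form_defs coeff_pCons split: nat.splits if_splits)

lemma bihom_0E: assumes "bihom 0 f" obtains a where "f = [:[:a:]:]"
proof -
  have "f = [:[:coeff (coeff f 0) 0:]:]"
    by (rule bihom_eqI[OF assms]) (auto simp: bihom_def coeff_pCons split: nat.splits)
  then show ?thesis using that by blast
qed

lemma bihom_1E: assumes "bihom 1 f" obtains a b where "f = form1 a b"
proof -
  have "f = form1 (coeff (coeff f 1) 0) (coeff (coeff f 0) 1)"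
  proof (rule bihom_eqI[OF assms bihom_forms(1)])
    fix i :: nat assume "i \<le> 1"
    then have "i = 0 \<or> i = 1" by linarith
    then show "coeff (coeff f i) (1 - i) = coeff (coeff (form1 (coeff (coeff f 1) 0) (coeff (coeff f 0) 1)) i) (1 - i)"
      by (auto simp: form_defs)
  qed
  then show ?thesis using that by blast
qed

lemma bihom_2E: assumes "bihom 2 f" obtains a b c where "f = form2 a b c"
proof -
  have "f = form2 (coeff (coeff f 2) 0) (coeff (coeff f 1) 1) (coeff (coeff f 0) 2)"
  proof (rule bihom_eqI[OF assms bihom_forms(2)])
    fix i :: nat assume "i \<le> 2"
    then have "i = 0 \<or> i = 1 \<or> i = 2" by linarith
    then show "coeff (coeff f i) (2 - i) = coeff (coeff (form2 (coeff (coeff f 2) 0) (coeff (coeff f 1) 1) (coeff (coeff f 0) 2)) i) (2 - i)"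
      by (auto simp: form_defs eval_nat_numeral)
  qed
  then show ?thesis using that by blast
qed

lemma bihom_3E: assumes "bihom 3 f" obtains a b c d where "f = form3 a b c d"
proof -
  have "f = form3 (coeff (coeff f 3) 0) (coeff (coeff f 2) 1) (coeff (coeff f 1) 2) (coeff (coeff f 0) 3)"
  proof (rule bihom_eqI[OF assms bihom_forms(3)])
    fix i :: nat assume "i \<le> 3"
    then have "i = 0 \<or> i = 1 \<or> i = 2 \<or> i = 3" by linarith
    then show "coeff (coeff f i) (3 - i) = coeff (coeff (form3 (coeff (coeff f 3) 0) (coeff (coeff f 2) 1) (coeff (coeff f 1) 2) (coeff (coeff f 0) 3)) i) (3 - i)"
      by (auto simp: form_defs eval_nat_numeral)
  qed
  then show ?thesis using that by blast
qed

lemma bihom_4E: assumes "bihom 4 f" obtains a b c d e where "f = form4 a b c d e"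
proof -
  have "f = form4 (coeff (coeff f 4) 0) (coeff (coeff f 3) 1) (coeff (coeff f 2) 2) (coeff (coeff f 1) 3) (coeff (coeff f 0) 4)"
  proof (rule bihom_eqI[OF assms bihom_forms(4)])
    fix i :: nat assume "i \<le> 4"
    then have "i = 0 \<or> i = 1 \<or> i = 2 \<or> i = 3 \<or> i = 4" by linarith
    then show "coeff (coeff f i) (4 - i) = coeff (coeff (form4 (coeff (coeff f 4) 0) (coeff (coeff f 3) 1) (coeff (coeff f 2) 2) (coeff (coeff f 1) 3) (coeff (coeff f 0) 4)) i) (4 - i)"
      by (auto simp: form_defs eval_nat_numeral)
  qed
  then show ?thesis using that by blast
qed

section \<open>Dehomogenization and ternary quadratic forms\<close>

lemma coeff_dehom: "coeff (dehom F) i = poly (coeff F i) 1"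
  unfolding dehom_def by (rule coeff_map_poly) simp

lemma dehom_simps: "dehom (F + G) = dehom F + dehom G" "dehom (F - G) = dehom F - dehom G"
  "dehom (F * G) = dehom F * dehom G" "dehom (F ^ n) = dehom F ^ n" "dehom (numeral k) = numeral k"
proof -
  show "dehom (F + G) = dehom F + dehom G" "dehom (F - G) = dehom F - dehom G"
    by (auto intro!: poly_eqI simp: coeff_dehom)
  show mult: "dehom (F * G) = dehom F * dehom G" for F G
    by (auto intro!: poly_eqI simp: coeff_dehom coeff_mult poly_sum)
  have one: "dehom 1 = 1" by (auto intro!: poly_eqI simp: coeff_dehom one_pCons coeff_pCons split: nat.splits)
  show "dehom (F ^ n) = dehom F ^ n" by (induction n) (auto simp: mult one)
  show "dehom (numeral k) = numeral k"
    by (auto intro!: poly_eqI simp: coeff_dehom numeral_poly coeff_pCons split: nat.splits)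
qed

lemma dehom_forms: "dehom (form2 a b c) = [:c, b, a:]" "dehom (form3 a b c d) = [:d, c, b, a:]"
  "dehom (form4 a b c d e) = [:e, d, c, b, a:]"
  by (auto intro!: poly_eqI simp: coeff_dehom form_defs coeff_pCons split: nat.splits)

definition mk :: "real \<Rightarrow> real \<Rightarrow> real \<Rightarrow> real \<Rightarrow> real \<Rightarrow> real \<Rightarrow> tripoly" where
  "mk n w0 w1 k0 k1 k2 = [:form2 k0 k1 k2, form1 w0 w1, [:[:n:]:]:]"

lemma trihom_mk: "trihom 2 (mk n w0 w1 k0 k1 k2)"
  by (auto simp: trihom_def mk_def form_defs coeff_pCons split: nat.splits if_splits)

lemma trihom_2E:
  assumes "trihom 2 p"
  obtains n w0 w1 k0 k1 k2 where "p = mk n w0 w1 k0 k1 k2"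
proof -
  have b: "bihom (2 - k) (coeff p k)" if "k \<le> 2" for k
    unfolding bihom_def
  proof (intro allI impI)
    fix i j assume "coeff (coeff (coeff p k) i) j \<noteq> 0"
    then have "i + j + k = 2" using assms unfolding trihom_def by blast
    then show "i + j = 2 - k" by simp
  qed
  have z: "coeff p k = 0" if "k > 2" for k
  proof (intro poly_eqI)
    fix i j
    have "i + j + k \<noteq> 2" using that by simp
    then show "coeff (coeff (coeff p k) i) j = coeff (coeff 0 i) j" using assms unfolding trihom_def by auto
  qed
  obtain n where n: "coeff p 2 = [:[:n:]:]" using b[of 2] by (auto elim: bihom_0E)
  have "bihom 1 (coeff p 1)" using b[of 1] by simp
  then obtain w0 w1 where w: "coeff p 1 = form1 w0 w1" by (rule bihom_1E)
  obtain k0 k1 k2 where k: "coeff p 0 = form2 k0 k1 k2" using b[of 0] by (auto elim: bihom_2E)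
  have "p = [:coeff p 0, coeff p 1, coeff p 2:]"
  proof (rule poly_eqI)
    fix i :: nat
    consider "i = 0" | "i = 1" | "i = 2" | "i > 2" by linarith
    then show "coeff p i = coeff [:coeff p 0, coeff p 1, coeff p 2:] i"
      by cases (auto simp: z coeff_pCons numeral_2_eq_2 split: nat.splits)
  qed
  then have "p = mk n w0 w1 k0 k1 k2" unfolding n w k mk_def .
  then show ?thesis using that by blast
qed

lemma mk_eq_iff: "mk n w0 w1 k0 k1 k2 = mk n' w0' w1' k0' k1' k2' \<longleftrightarrow>
    n = n' \<and> w0 = w0' \<and> w1 = w1' \<and> k0 = k0' \<and> k1 = k1' \<and> k2 = k2'"
  by (auto simp: mk_def form_defs)

lemma mk_add: "mk n w0 w1 k0 k1 k2 + mk n' w0' w1' k0' k1' k2' = mk (n + n') (w0 + w0') (w1 + w1') (k0 + k0') (k1 + k1') (k2 + k2')"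
  by (simp add: mk_def form_defs)

lemma mk_scale: "const3 s * mk n w0 w1 k0 k1 k2 = mk (s * n) (s * w0) (s * w1) (s * k0) (s * k1) (s * k2)"
  by (simp add: mk_def form_defs const3_def)

lemma mk_square: "(mk n w0 w1 k0 k1 k2)\<^sup>2 =
  [:form4 (k0\<^sup>2) (2 * (k0 * k1)) (2 * (k0 * k2) + k1\<^sup>2) (2 * (k1 * k2)) (k2\<^sup>2),
    form3 (2 * (w0 * k0)) (2 * (w0 * k1 + w1 * k0)) (2 * (w0 * k2 + w1 * k1)) (2 * (w1 * k2)),
    form2 (w0\<^sup>2 + 2 * (n * k0)) (2 * (w0 * w1) + 2 * (n * k1)) (w1\<^sup>2 + 2 * (n * k2)),
    form1 (2 * (n * w0)) (2 * (n * w1)), [:[:n\<^sup>2:]:]:]"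
  by (simp add: mk_def form_defs power2_eq_square algebra_simps)

lemma form_add: "form1 a b + form1 a' b' = form1 (a + a') (b + b')"
  "form2 a b c + form2 a' b' c' = form2 (a + a') (b + b') (c + c')"
  "form3 a b c d + form3 a' b' c' d' = form3 (a + a') (b + b') (c + c') (d + d')"
  "form4 a b c d e + form4 a' b' c' d' e' = form4 (a + a') (b + b') (c + c') (d + d') (e + e')"
  by (simp_all add: form_defs)

lemma form_eq_iff: "form1 a b = form1 a' b' \<longleftrightarrow> a = a' \<and> b = b'"
  "form2 a b c = form2 a' b' c' \<longleftrightarrow> a = a' \<and> b = b' \<and> c = c'"
  "form3 a b c d = form3 a' b' c' d' \<longleftrightarrow> a = a' \<and> b = b' \<and> c = c' \<and> d = d'"
  "form4 a b c d e = form4 a' b' c' d' e' \<longleftrightarrow> a = a' \<and> b = b' \<and> c = c' \<and> d = d' \<and> e = e'"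
  by (auto simp: form_defs)

text \<open>Three quadratic forms are stored as six vectors, one per monomial. An orthogonal change
  of the representation acts on all six by one orthogonal map.\<close>

type_synonym vecs = "(real ^ 3) \<times> (real ^ 3) \<times> (real ^ 3) \<times> (real ^ 3) \<times> (real ^ 3) \<times> (real ^ 3)"

definition MK :: "vecs \<Rightarrow> tripoly ^ 3" where
  "MK T = (case T of (n, w0, w1, k0, k1, k2) \<Rightarrow> \<chi> i. mk (n $ i) (w0 $ i) (w1 $ i) (k0 $ i) (k1 $ i) (k2 $ i))"

definition map6 :: "(real ^ 3 \<Rightarrow> real ^ 3) \<Rightarrow> vecs \<Rightarrow> vecs" where
  "map6 g T = (case T of (n, w0, w1, k0, k1, k2) \<Rightarrow> (g n, g w0, g w1, g k0, g k1, g k2))"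

text \<open>A sum of squares depends only on inner products of the coefficient vectors. The absent
  z^3 term says that n is orthogonal to w0 and w1.\<close>

definition gram :: "real \<Rightarrow> rhs \<Rightarrow> vecs \<Rightarrow> bool" where
  "gram e t T \<longleftrightarrow> (case T of (n, w0, w1, k0, k1, k2) \<Rightarrow>
     n \<bullet> n = e \<and> n \<bullet> w0 = 0 \<and> n \<bullet> w1 = 0 \<and>
     t = (w0 \<bullet> w0 + 2 * (n \<bullet> k0), 2 * (w0 \<bullet> w1) + 2 * (n \<bullet> k1), w1 \<bullet> w1 + 2 * (n \<bullet> k2),
      2 * (w0 \<bullet> k0), 2 * (w0 \<bullet> k1 + w1 \<bullet> k0), 2 * (w0 \<bullet> k2 + w1 \<bullet> k1), 2 * (w1 \<bullet> k2),
      k0 \<bullet> k0, 2 * (k0 \<bullet> k1), 2 * (k0 \<bullet> k2) + k1 \<bullet> k1, 2 * (k1 \<bullet> k2), k2 \<bullet> k2))"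

lemma inner_3: "x \<bullet> y = x $ 1 * y $ 1 + x $ 2 * y $ 2 + x $ 3 * (y $ 3 :: real)" for x y :: "real ^ 3"
  by (simp add: inner_vec_def sum_3)

lemma MK_inj: "MK T = MK T' \<longleftrightarrow> T = T'"
  by (cases T; cases T') (auto simp: MK_def vec_eq_iff mk_eq_iff)

lemma sum_squares_MK:
  "(\<Sum>i\<in>UNIV. (MK T $ i)\<^sup>2) = [:form4 f40 f41 f42 f43 f44, form3 f30 f31 f32 f33, form2 f20 f21 f22, 0, [:[:e:]:]:]
   \<longleftrightarrow> gram e (f20, f21, f22, f30, f31, f32, f33, f40, f41, f42, f43, f44) T"
proof -
  obtain n w0 w1 k0 k1 k2 where T: "T = (n, w0, w1, k0, k1, k2)" by (metis prod.exhaust)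
  have z: "form1 a b = 0 \<longleftrightarrow> a = 0 \<and> b = 0" for a b by (auto simp: form_defs)
  have s: "(\<Sum>i\<in>UNIV. (MK T $ i)\<^sup>2) = [:form4 (k0 \<bullet> k0) (2 * (k0 \<bullet> k1)) (2 * (k0 \<bullet> k2) + k1 \<bullet> k1) (2 * (k1 \<bullet> k2)) (k2 \<bullet> k2),
    form3 (2 * (w0 \<bullet> k0)) (2 * (w0 \<bullet> k1 + w1 \<bullet> k0)) (2 * (w0 \<bullet> k2 + w1 \<bullet> k1)) (2 * (w1 \<bullet> k2)),
    form2 (w0 \<bullet> w0 + 2 * (n \<bullet> k0)) (2 * (w0 \<bullet> w1) + 2 * (n \<bullet> k1)) (w1 \<bullet> w1 + 2 * (n \<bullet> k2)),
    form1 (2 * (n \<bullet> w0)) (2 * (n \<bullet> w1)), [:[:n \<bullet> n:]:]:]"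
    unfolding T MK_def
    by (simp add: sum_3 mk_square form_add form_eq_iff inner_3) (simp add: power2_eq_square algebra_simps)
  show ?thesis unfolding s unfolding T gram_def by (auto simp: form_eq_iff z)
qed

lemma sos3_reps_eq:
  "sos3_reps [:form4 f40 f41 f42 f43 f44, form3 f30 f31 f32 f33, form2 f20 f21 f22, 0, [:[:e:]:]:]
   = MK ` {T. gram e (f20, f21, f22, f30, f31, f32, f33, f40, f41, f42, f43, f44) T}"
  (is "sos3_reps ?f = _")
proof (intro equalityI subsetI)
  fix p assume "p \<in> sos3_reps ?f"
  then have p: "\<And>i. trihom 2 (p $ i)" "(\<Sum>i\<in>UNIV. (p $ i)\<^sup>2) = ?f" by (auto simp: sos3_reps_def)
  have "\<forall>i. \<exists>n w0 w1 k0 k1 k2. p $ i = mk n w0 w1 k0 k1 k2"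
    by (rule allI, rule trihom_2E[OF p(1)]) blast
  then obtain n w0 w1 k0 k1 k2 where "\<forall>i. p $ i = mk (n i) (w0 i) (w1 i) (k0 i) (k1 i) (k2 i)" by metis
  then have pT: "p = MK (\<chi> i. n i, \<chi> i. w0 i, \<chi> i. w1 i, \<chi> i. k0 i, \<chi> i. k1 i, \<chi> i. k2 i)"
    by (simp add: MK_def vec_eq_iff)
  show "p \<in> MK ` {T. gram e (f20, f21, f22, f30, f31, f32, f33, f40, f41, f42, f43, f44) T}"
    using p(2) unfolding pT sum_squares_MK by blast
next
  fix p assume "p \<in> MK ` {T. gram e (f20, f21, f22, f30, f31, f32, f33, f40, f41, f42, f43, f44) T}"
  then obtain T where T: "p = MK T" "gram e (f20, f21, f22, f30, f31, f32, f33, f40, f41, f42, f43, f44) T" by blast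
  have "trihom 2 (MK T $ i)" for i by (cases T) (simp add: MK_def trihom_mk)
  then show "p \<in> sos3_reps ?f" using T(2)[folded sum_squares_MK] unfolding sos3_reps_def T(1) by simp
qed

lemma orth_equiv_MK:
  "(MK T, MK T') \<in> orth_equiv \<longleftrightarrow> (\<exists>g. orthogonal_transformation g \<and> T' = map6 g T)"
proof -
  have eq: "(\<forall>j. MK T' $ j = (\<Sum>i\<in>UNIV. const3 (S $ i $ j) * MK T $ i)) \<longleftrightarrow> T' = map6 ((*v) (transpose S)) T" for S
  proof -
    obtain n w0 w1 k0 k1 k2 where T: "T = (n, w0, w1, k0, k1, k2)" by (metis prod.exhaust)
    have "(\<chi> j. \<Sum>i\<in>UNIV. const3 (S $ i $ j) * MK T $ i) = MK (map6 ((*v) (transpose S)) T)"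
      by (simp add: T MK_def map6_def vec_eq_iff mk_scale mk_add sum_3 matrix_vector_mult_def transpose_def)
    then have "(\<forall>j. MK T' $ j = (\<Sum>i\<in>UNIV. const3 (S $ i $ j) * MK T $ i)) \<longleftrightarrow> MK T' = MK (map6 ((*v) (transpose S)) T)"
      by (metis (no_types, lifting) vec_eq_iff vec_lambda_beta)
    then show ?thesis by (simp add: MK_inj)
  qed
  show ?thesis
  proof
    assume "(MK T, MK T') \<in> orth_equiv"
    then obtain S where S: "orthogonal_matrix S" "T' = map6 ((*v) (transpose S)) T" unfolding orth_equiv_def mem_Collect_eq prod.case eq by blast
    have "orthogonal_transformation ((*v) (transpose S))"
      using S(1) by (simp add: orthogonal_transformation_matrix)
    then show "\<exists>g. orthogonal_transformation g \<and> T' = map6 g T" using S(2) by blast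
  next
    assume "\<exists>g. orthogonal_transformation g \<and> T' = map6 g T"
    then obtain g where g: "orthogonal_transformation g" "T' = map6 g T" by blast
    have "(*v) (matrix g) = g" using g(1) by (simp add: orthogonal_transformation_matrix matrix_works fun_eq_iff)
    moreover have "orthogonal_matrix (transpose (matrix g))" using g(1) by (simp add: orthogonal_transformation_matrix)
    ultimately show "(MK T, MK T') \<in> orth_equiv" unfolding orth_equiv_def mem_Collect_eq prod.case eq
      using g(2) by (auto intro!: exI[of _ "transpose (matrix g)"])
  qed
qed

text \<open>Splits three-space into an axis for the form s z^2 + a and a plane, written as the
  complex numbers, for the other two forms.\<close>

definition J :: "real \<Rightarrow> complex \<Rightarrow> real ^ 3" where "J a c = vector [a, Re c, Im c]"

lemma J_nth [simp]: "J a c $ 1 = a" "J a c $ 2 = Re c" "J a c $ 3 = Im c"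
  by (simp_all add: J_def vector_3)

lemma inner_J: "J a c \<bullet> J b d = a * b + c \<bullet> d"
  by (simp add: inner_3 inner_complex_def)

lemma vec3_eq_iff: "x = y \<longleftrightarrow> x $ 1 = y $ 1 \<and> x $ 2 = y $ 2 \<and> x $ 3 = y $ 3" for x y :: "'a ^ 3"
  by (simp add: vec_eq_iff forall_3)

lemma J_eq_iff: "J a c = J b d \<longleftrightarrow> a = b \<and> c = d"
  by (auto simp: vec3_eq_iff complex_eq_iff)

lemma J_surj: "J (x $ 1) (Complex (x $ 2) (x $ 3)) = x"
  by (simp add: vec3_eq_iff)

lemma J_add: "J a c + J b d = J (a + b) (c + d)" and J_scale: "r *\<^sub>R J a c = J (r * a) (r *\<^sub>R c)"
  by (simp_all add: vec3_eq_iff)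

definition encode :: "real \<Rightarrow> sol \<Rightarrow> vecs" where
  "encode s z = (J s 0, J 0 (su0 z), J 0 (su1 z), J (sa0 z) (sv0 z), J (sa1 z) (sv1 z), J (sa2 z) (sv2 z))"

lemma gram_encode: "gram (s\<^sup>2) t (encode s z) \<longleftrightarrow> bil (s, z) (s, z) = t"
proof -
  have 2: "2 * (a \<bullet> b) = a \<bullet> b + b \<bullet> a" for a b :: complex by (simp add: inner_commute)
  show ?thesis
    unfolding gram_def encode_def bil_def Let_def prod.case fst_conv snd_conv inner_J
    by (auto simp: inner_commute power2_eq_square algebra_simps)
qed

definition lift :: "real \<Rightarrow> (complex \<Rightarrow> complex) \<Rightarrow> real ^ 3 \<Rightarrow> real ^ 3" where
  "lift \<sigma> h x = J (\<sigma> * x $ 1) (h (Complex (x $ 2) (x $ 3)))"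

lemma lift_J: "lift \<sigma> h (J a c) = J (\<sigma> * a) (h c)"
  by (simp add: lift_def)

lemma orthogonal_lift:
  assumes "\<sigma>\<^sup>2 = 1" "linear h" "\<And>c. norm (h c) = norm c"
  shows "orthogonal_transformation (lift \<sigma> h)"
proof (rule orthogonal_transformation[THEN iffD2], intro conjI allI)
  show "linear (lift \<sigma> h)"
  proof (rule linearI)
    fix x y :: "real ^ 3"
    have "Complex (x $ 2 + y $ 2) (x $ 3 + y $ 3) = Complex (x $ 2) (x $ 3) + Complex (y $ 2) (y $ 3)"
      by (simp add: complex_eq_iff)
    then show "lift \<sigma> h (x + y) = lift \<sigma> h x + lift \<sigma> h y"
      by (simp add: lift_def J_add linear_add[OF assms(2)] distrib_left)
  next
    fix r and x :: "real ^ 3"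
    have "Complex (r * x $ 2) (r * x $ 3) = r *\<^sub>R Complex (x $ 2) (x $ 3)" by (simp add: complex_eq_iff)
    then show "lift \<sigma> h (r *\<^sub>R x) = r *\<^sub>R lift \<sigma> h x"
      by (simp only: lift_def J_scale linear_scale[OF assms(2)] vector_scaleR_component real_scaleR_def mult.left_commute)
  qed
  fix v :: "real ^ 3"
  define c where "c = Complex (v $ 2) (v $ 3)"
  have "(norm (lift \<sigma> h v))\<^sup>2 = \<sigma>\<^sup>2 * (v $ 1)\<^sup>2 + (norm (h c))\<^sup>2"
    unfolding power2_norm_eq_inner lift_def inner_J c_def by (simp add: power2_eq_square)
  also have "\<dots> = (v $ 1)\<^sup>2 + (norm c)\<^sup>2" using assms by simp
  also have "\<dots> = (norm v)\<^sup>2"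
    unfolding power2_norm_eq_inner inner_3 by (simp add: c_def inner_complex_def power2_eq_square)
  finally show "norm (lift \<sigma> h v) = norm v" by simp
qed

definition flip :: "sol \<Rightarrow> sol" where
  "flip z = (- sa0 z, - sa1 z, - sa2 z, su0 z, su1 z, sv0 z, sv1 z, sv2 z)"

lemma flip_flip: "flip (flip z) = z" by (simp add: flip_def)

text \<open>The image of 1 is a unit e. After division by e, the image of \<i> is a unit d with |1 +
  d| = |1 + \<i>|, hence perpendicular to 1 and equal to \<i> or - \<i>.\<close>

lemma complex_isometry_cases:
  fixes h :: "complex \<Rightarrow> complex"
  assumes h: "linear h" "\<And>c. norm (h c) = norm c"
  obtains e where "cmod e = 1" "(\<forall>c. h c = e * c) \<or> (\<forall>c. h c = e * cnj c)"
proof -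
  define e where "e = h 1"
  define d where "d = cnj e * h \<i>"
  have e: "cmod e = 1" using h(2)[of 1] by (simp add: e_def)
  have hd: "h \<i> = e * d" using cnj_unit[OF e] by (simp add: d_def mult.assoc[symmetric])
  have hc: "h c = of_real (Re c) * e + of_real (Im c) * (e * d)" for c
  proof -
    have "c = Re c *\<^sub>R 1 + Im c *\<^sub>R \<i>" by (simp add: complex_eq_iff)
    then have "h c = h (Re c *\<^sub>R 1 + Im c *\<^sub>R \<i>)" by simp
    then show ?thesis unfolding linear_add[OF h(1)] linear_scale[OF h(1)] hd e_def[symmetric]
      by (simp add: scaleR_conv_of_real)
  qed
  have n1: "cmod d = 1" using h(2)[of \<i>] unfolding hd by (simp add: norm_mult e)
  have "cmod (h (1 + \<i>)) = cmod (e * (1 + d))" unfolding hc by (simp add: algebra_simps)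
  then have "cmod (1 + d) = cmod (1 + \<i>)" using h(2)[of "1 + \<i>"] by (simp add: norm_mult e)
  then have "(cmod (1 + d))\<^sup>2 = (cmod (1 + \<i>))\<^sup>2" by simp
  then have r: "Re d = 0" using arg_cong[OF n1, of power2] by (simp add: cmod_power2) (simp add: power2_eq_square algebra_simps)
  then have "(Im d)\<^sup>2 = 1" using arg_cong[OF n1, of power2] by (simp add: cmod_power2)
  then have "d = \<i> \<or> d = - \<i>" using r by (auto simp: complex_eq_iff power2_eq_1_iff)
  then have "(\<forall>c. h c = e * c) \<or> (\<forall>c. h c = e * cnj c)"
  proof
    assume d: "d = \<i>"
    have "h c = e * c" for c unfolding hc d by (simp add: complex_eq_iff algebra_simps)
    then show ?thesis by blast
  next
    assume d: "d = - \<i>"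
    have "h c = e * cnj c" for c unfolding hc d by (simp add: complex_eq_iff algebra_simps)
    then show ?thesis by blast
  qed
  then show ?thesis using that e by blast
qed

lemma orth2_encode:
  assumes "orth2 z z'"
  shows "\<exists>g. orthogonal_transformation g \<and> encode s z' = map6 g (encode s z)"
proof -
  obtain e where e: "cmod e = 1" "z' = rot e z \<or> z' = rot e (cj z)" using assms by (auto simp: orth2_def)
  from e(2) show ?thesis
  proof
    assume z': "z' = rot e z"
    have "orthogonal_transformation (lift 1 (\<lambda>c. e * c))"
      by (rule orthogonal_lift) (use e(1) in \<open>auto simp: norm_mult algebra_simps intro!: linearI\<close>)
    moreover have "encode s z' = map6 (lift 1 (\<lambda>c. e * c)) (encode s z)"
      by (simp add: z' encode_def map6_def rot_def lift_J)
    ultimately show ?thesis by blast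
  next
    assume z': "z' = rot e (cj z)"
    have "orthogonal_transformation (lift 1 (\<lambda>c. e * cnj c))"
      by (rule orthogonal_lift) (use e(1) in \<open>auto simp: norm_mult algebra_simps scaleR_conv_of_real intro!: linearI\<close>)
    moreover have "encode s z' = map6 (lift 1 (\<lambda>c. e * cnj c)) (encode s z)"
      by (simp add: z' encode_def map6_def rot_def cj_def lift_J)
    ultimately show ?thesis by blast
  qed
qed

lemma flip_encode: "\<exists>g. orthogonal_transformation g \<and> encode 0 (flip z) = map6 g (encode 0 z)"
proof -
  have "orthogonal_transformation (lift (- 1) (\<lambda>c. c))"
    by (rule orthogonal_lift) (auto intro!: linearI)
  moreover have "encode 0 (flip z) = map6 (lift (- 1) (\<lambda>c. c)) (encode 0 z)"
    by (simp add: encode_def map6_def flip_def lift_J)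
  ultimately show ?thesis by blast
qed

text \<open>An orthogonal transformation preserving the axis splits as a sign on the axis and an isometry of the plane.\<close>
lemma encode_orth:
  assumes g: "orthogonal_transformation g" "encode s z' = map6 g (encode s z)"
    and axis: "g (J 1 0) = J \<sigma> 0" "\<sigma> = 1 \<or> \<sigma> = - 1"
  shows "\<sigma> * s = s \<and> (if \<sigma> = 1 then orth2 z z' else orth2 (flip z) z')"
proof -
  have lin: "linear g" using g(1) by (simp add: orthogonal_transformation_def)
  have inn: "g x \<bullet> g y = x \<bullet> y" for x y using g(1) by (simp add: orthogonal_transformation_def)
  define h where "h = (\<lambda>c. Complex (g (J 0 c) $ 2) (g (J 0 c) $ 3))"
  have gJ0: "g (J 0 c) = J 0 (h c)" for c
  proof -
    have "J \<sigma> 0 \<bullet> g (J 0 c) = 0" unfolding axis(1)[symmetric] inn by (simp add: inner_J)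
    then have "g (J 0 c) $ 1 = 0" using axis(2) by (auto simp: inner_3)
    then show ?thesis using J_surj[of "g (J 0 c)"] by (simp add: h_def)
  qed
  have hl: "linear h"
  proof (rule linearI)
    fix c d
    have "J 0 (h (c + d)) = J 0 (h c + h d)"
      unfolding gJ0[symmetric] using linear_add[OF lin, of "J 0 c" "J 0 d"] by (simp add: J_add gJ0)
    then show "h (c + d) = h c + h d" by (simp add: J_eq_iff)
  next
    fix r c
    have "J 0 (h (r *\<^sub>R c)) = J 0 (r *\<^sub>R h c)"
      unfolding gJ0[symmetric] using linear_scale[OF lin, of r "J 0 c"] by (simp add: J_scale gJ0)
    then show "h (r *\<^sub>R c) = r *\<^sub>R h c" by (simp add: J_eq_iff)
  qed
  have hn: "norm (h c) = norm c" for c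
  proof -
    have "J 0 (h c) \<bullet> J 0 (h c) = J 0 c \<bullet> J 0 c" unfolding gJ0[symmetric] inn ..
    then show ?thesis by (simp add: inner_J norm_eq_sqrt_inner)
  qed
  have gJ: "g (J a c) = J (\<sigma> * a) (h c)" for a c
  proof -
    have "J a c = a *\<^sub>R J 1 0 + J 0 c" by (simp add: vec3_eq_iff)
    then have "g (J a c) = a *\<^sub>R g (J 1 0) + g (J 0 c)" by (simp add: linear_add[OF lin] linear_scale[OF lin])
    then show ?thesis unfolding axis gJ0 by (simp add: J_scale J_add mult.commute)
  qed
  have eqs: "s = \<sigma> * s" "su0 z' = h (su0 z)" "su1 z' = h (su1 z)" "sa0 z' = \<sigma> * sa0 z" "sv0 z' = h (sv0 z)"
    "sa1 z' = \<sigma> * sa1 z" "sv1 z' = h (sv1 z)" "sa2 z' = \<sigma> * sa2 z" "sv2 z' = h (sv2 z)"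
    using g(2) unfolding encode_def map6_def prod.case gJ prod.inject J_eq_iff by simp_all
  obtain e where e: "cmod e = 1" "(\<forall>c. h c = e * c) \<or> (\<forall>c. h c = e * cnj c)"
    using complex_isometry_cases[OF hl hn] by blast
  have "z' = rot e (if \<sigma> = 1 then z else flip z) \<or> z' = rot e (cj (if \<sigma> = 1 then z else flip z))"
    using axis(2) e(2) eqs by (auto simp: rot_def cj_def flip_def prod_eq_iff)
  then have "orth2 (if \<sigma> = 1 then z else flip z) z'" using e(1) unfolding orth2_def by blast
  then show ?thesis using eqs(1) by (auto split: if_splits)
qed

text \<open>The vector of z^2 is the axis itself, so an equivalence fixes the axis
  pointwise.\<close>

lemma encode_equiv_one:
  "(\<exists>g. orthogonal_transformation g \<and> encode 1 z' = map6 g (encode 1 z)) \<longleftrightarrow> orth2 z z'"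
proof
  assume "\<exists>g. orthogonal_transformation g \<and> encode 1 z' = map6 g (encode 1 z)"
  then obtain g where g: "orthogonal_transformation g" "encode 1 z' = map6 g (encode 1 z)" by blast
  have "g (J 1 0) = J 1 0" using g(2) by (simp add: encode_def map6_def)
  from encode_orth[OF g this] show "orth2 z z'" by simp
qed (rule orth2_encode)

text \<open>The vector of z^2 is 0 and no longer marks the axis. It is recovered as the orthogonal
  complement of the plane spanned by the vectors of xz and yz, but only up to sign; the sign is
  \<open>flip\<close>.\<close>

lemma encode_equiv_zero:
  assumes ind: "Re (su0 z) * Im (su1 z) - Im (su0 z) * Re (su1 z) \<noteq> 0"
  shows "(\<exists>g. orthogonal_transformation g \<and> encode 0 z' = map6 g (encode 0 z)) \<longleftrightarrow> orth2 z z' \<or> orth2 (flip z) z'"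
proof
  assume "\<exists>g. orthogonal_transformation g \<and> encode 0 z' = map6 g (encode 0 z)"
  then obtain g where g: "orthogonal_transformation g" "encode 0 z' = map6 g (encode 0 z)" by blast
  have lin: "linear g" using g(1) by (simp add: orthogonal_transformation_def)
  have inn: "g x \<bullet> g y = x \<bullet> y" for x y using g(1) by (simp add: orthogonal_transformation_def)
  obtain x where x: "g x = J 1 0" using orthogonal_transformation_surj[OF g(1)] unfolding surj_def by metis
  have "x \<bullet> J 0 (su0 z) = 0" "x \<bullet> J 0 (su1 z) = 0"
  proof -
    have e: "g (J 0 (su0 z)) = J 0 (su0 z')" "g (J 0 (su1 z)) = J 0 (su1 z')"
      using g(2) unfolding encode_def map6_def prod.case prod.inject by simp_all
    show "x \<bullet> J 0 (su0 z) = 0" "x \<bullet> J 0 (su1 z) = 0"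
      using inn[of x "J 0 (su0 z)"] inn[of x "J 0 (su1 z)"] unfolding x e inner_J by simp_all
  qed
  then have e: "x $ 2 * Re (su0 z) + x $ 3 * Im (su0 z) = 0" "x $ 2 * Re (su1 z) + x $ 3 * Im (su1 z) = 0"
    by (auto simp: inner_3)
  have "x $ 2 * (Re (su0 z) * Im (su1 z) - Im (su0 z) * Re (su1 z)) =
      Im (su1 z) * (x $ 2 * Re (su0 z) + x $ 3 * Im (su0 z)) - Im (su0 z) * (x $ 2 * Re (su1 z) + x $ 3 * Im (su1 z))"
    "x $ 3 * (Re (su0 z) * Im (su1 z) - Im (su0 z) * Re (su1 z)) =
      Re (su0 z) * (x $ 2 * Re (su1 z) + x $ 3 * Im (su1 z)) - Re (su1 z) * (x $ 2 * Re (su0 z) + x $ 3 * Im (su0 z))"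
    by (simp_all add: algebra_simps)
  then have x23: "x $ 2 = 0" "x $ 3 = 0" unfolding e using ind by simp_all
  have "x \<bullet> x = 1" using inn[of x x] unfolding x by (simp add: inner_J)
  then have "(x $ 1)\<^sup>2 = 1" using x23 by (simp add: inner_3 power2_eq_square)
  then have s: "x $ 1 = 1 \<or> x $ 1 = - 1" by (simp add: power2_eq_1_iff)
  have "x = x $ 1 *\<^sub>R J 1 0" using x23 by (simp add: vec3_eq_iff)
  then have "x $ 1 *\<^sub>R g (J 1 0) = J 1 0" using x by (metis linear_scale[OF lin])
  then have "g (J 1 0) = J (x $ 1) 0" using s by (auto simp: vec3_eq_iff)
  from encode_orth[OF g this s] show "orth2 z z' \<or> orth2 (flip z) z'" by (auto split: if_splits)
next
  assume "orth2 z z' \<or> orth2 (flip z) z'"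
  then show "\<exists>g. orthogonal_transformation g \<and> encode 0 z' = map6 g (encode 0 z)"
  proof
    assume "orth2 z z'" then show ?thesis by (rule orth2_encode)
  next
    assume "orth2 (flip z) z'"
    then obtain g where g: "orthogonal_transformation g" "encode 0 z' = map6 g (encode 0 (flip z))"
      using orth2_encode by blast
    obtain k where k: "orthogonal_transformation k" "encode 0 (flip z) = map6 k (encode 0 z)" using flip_encode by blast
    have "orthogonal_transformation (g \<circ> k)" by (rule orthogonal_transformation_compose[OF g(1) k(1)])
    moreover have "encode 0 z' = map6 (g \<circ> k) (encode 0 z)"
      unfolding g(2) k(2) by (simp add: map6_def encode_def)
    ultimately show ?thesis by blast
  qed
qed

lemma axis_from_unit_vector:
  assumes "norm (m :: real ^ 3) = 1"
  obtains g where "orthogonal_transformation g" "g m = J 1 0"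
proof -
  have "norm (J 1 0) = 1" by (simp add: norm_eq_sqrt_inner inner_J)
  then show ?thesis using orthogonal_transformation_exists[of m "J 1 0"] assms that by metis
qed

text \<open>A unit vector m orthogonal to w0 and w1 with n = s m is moved to the axis. For s = 1 it
  is n itself; for s = 0, where n = 0, any unit normal of the span of w0 and w1 serves.\<close>

lemma normal_form:
  assumes gr: "gram (s\<^sup>2) t T" and s: "s = 0 \<or> s = 1"
  obtains g z where "orthogonal_transformation g" "map6 g T = encode s z" "bil (s, z) (s, z) = t"
proof -
  obtain n w0 w1 k0 k1 k2 where T: "T = (n, w0, w1, k0, k1, k2)" by (metis prod.exhaust)
  have n: "n \<bullet> n = s\<^sup>2" "n \<bullet> w0 = 0" "n \<bullet> w1 = 0" using gr by (auto simp: gram_def T)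
  obtain m where m: "norm m = 1" "m \<bullet> w0 = 0" "m \<bullet> w1 = 0" "n = s *\<^sub>R m"
    using s
  proof
    assume "s = 1"
    then show ?thesis using that[of n] n by (simp add: norm_eq_sqrt_inner)
  next
    assume s0: "s = 0"
    have "dim (span {w0, w1}) \<le> card {w0, w1}" by (simp add: dim_span dim_le_card')
    also have "\<dots> < DIM(real ^ 3)" by (simp add: card_insert_if)
    finally obtain x where x: "x \<noteq> 0" "\<And>y. y \<in> span {w0, w1} \<Longrightarrow> orthogonal x y"
      using orthogonal_to_subspace_exists[of "{w0, w1}"] by (metis dim_span)
    have "x \<bullet> w0 = 0" "x \<bullet> w1 = 0" using x(2)[of w0] x(2)[of w1] by (auto simp: orthogonal_def span_base)
    moreover have "n = 0" using n(1) s0 by simp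
    ultimately show ?thesis using that[of "x /\<^sub>R norm x"] x(1) s0 by simp
  qed
  obtain g where g: "orthogonal_transformation g" "g m = J 1 0" using axis_from_unit_vector[OF m(1)] by blast
  have lin: "linear g" using g(1) by (simp add: orthogonal_transformation_def)
  have inn: "g x \<bullet> g y = x \<bullet> y" for x y using g(1) by (simp add: orthogonal_transformation_def)
  define C where "C = (\<lambda>x :: real ^ 3. Complex (x $ 2) (x $ 3))"
  have flat: "g w = J 0 (C (g w))" if "m \<bullet> w = 0" for w
  proof -
    have "J 1 0 \<bullet> g w = 0" unfolding g(2)[symmetric] inn using that by simp
    then have "g w $ 1 = 0" by (simp add: inner_3)
    then show ?thesis using J_surj[of "g w"] by (simp add: C_def)
  qed
  define z where "z = (g k0 $ 1, g k1 $ 1, g k2 $ 1, C (g w0), C (g w1), C (g k0), C (g k1), C (g k2))"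
  have "g n = J s 0" unfolding m(4) linear_scale[OF lin] g(2) by (simp add: J_scale)
  then have enc: "map6 g T = encode s z"
    using flat[OF m(2)] flat[OF m(3)] J_surj by (simp add: T map6_def encode_def z_def C_def)
  have "gram (s\<^sup>2) t (map6 g T)" using gr by (simp add: T gram_def map6_def inn)
  then have "bil (s, z) (s, z) = t" unfolding enc gram_encode .
  then show ?thesis using that g(1) enc by blast
qed

lemma orth_equiv_equivalence:
  "(MK T, MK T) \<in> orth_equiv"
  "(MK T, MK T') \<in> orth_equiv \<Longrightarrow> (MK T', MK T) \<in> orth_equiv"
  "(MK T, MK T') \<in> orth_equiv \<Longrightarrow> (MK T', MK T'') \<in> orth_equiv \<Longrightarrow> (MK T, MK T'') \<in> orth_equiv"
proof -
  show "(MK T, MK T) \<in> orth_equiv"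
    unfolding orth_equiv_MK by (rule exI[of _ id]) (cases T; simp add: map6_def orthogonal_transformation_id[unfolded id_def] id_def)
  show "(MK T', MK T) \<in> orth_equiv" if a: "(MK T, MK T') \<in> orth_equiv"
  proof -
    obtain g where g: "orthogonal_transformation g" "T' = map6 g T" using a unfolding orth_equiv_MK by blast
    have "inv g (g x) = x" for x using orthogonal_transformation_inj[OF g(1)] by simp
    then have "T = map6 (inv g) T'" unfolding g(2) by (cases T) (simp add: map6_def)
    then show ?thesis unfolding orth_equiv_MK using orthogonal_transformation_inv[OF g(1)] by blast
  qed
  show "(MK T, MK T'') \<in> orth_equiv" if a: "(MK T, MK T') \<in> orth_equiv" "(MK T', MK T'') \<in> orth_equiv"
  proof -
    obtain g k where g: "orthogonal_transformation g" "T' = map6 g T" "orthogonal_transformation k" "T'' = map6 k T'"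
      using a unfolding orth_equiv_MK by blast
    have "T'' = map6 (k \<circ> g) T" unfolding g(2,4) by (cases T) (simp add: map6_def)
    then show ?thesis unfolding orth_equiv_MK using orthogonal_transformation_compose[OF g(3,1)] by blast
  qed
qed

text \<open>Every class meets the normal forms, so classes can be counted by any complete invariant
  c of the induced relation R on solutions.\<close>

lemma card_classes:
  assumes s: "s = 0 \<or> s = 1"
    and f: "f = [:form4 f40 f41 f42 f43 f44, form3 f30 f31 f32 f33, form2 f20 f21 f22, 0, [:[:s\<^sup>2:]:]:]"
    and t: "t = (f20, f21, f22, f30, f31, f32, f33, f40, f41, f42, f43, f44)"
    and R: "\<And>z z'. bil (s, z) (s, z) = t \<Longrightarrow> bil (s, z') (s, z') = t \<Longrightarrow>
      (\<exists>g. orthogonal_transformation g \<and> encode s z' = map6 g (encode s z)) \<longleftrightarrow> R z z'"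
    and Rc: "\<And>z z'. bil (s, z) (s, z) = t \<Longrightarrow> bil (s, z') (s, z') = t \<Longrightarrow> c z = c z' \<longleftrightarrow> R z z'"
  shows "num_sos3_classes f = card (c ` {z. bil (s, z) (s, z) = t})"
proof -
  let ?X = "sos3_reps f"
  let ?r = "orth_equiv \<inter> (?X \<times> ?X)"
  let ?Z = "{z. bil (s, z) (s, z) = t}"
  have X: "?X = MK ` {T. gram (s\<^sup>2) t T}" unfolding f t by (rule sos3_reps_eq)
  have ZX: "MK (encode s z) \<in> ?X" if "z \<in> ?Z" for z using that unfolding X gram_encode[symmetric] by blast
  have cls: "?r `` {p} = ?r `` {q} \<longleftrightarrow> (p, q) \<in> ?r" if "p \<in> ?X" "q \<in> ?X" for p q
  proof -
    obtain T T' where T: "p = MK T" "q = MK T'" using \<open>p \<in> ?X\<close> \<open>q \<in> ?X\<close> unfolding X by blast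
    show ?thesis
    proof
      assume "?r `` {p} = ?r `` {q}"
      moreover have "(q, q) \<in> ?r" using that(2) orth_equiv_equivalence(1)[of T'] unfolding T by blast
      ultimately show "(p, q) \<in> ?r" by blast
    next
      assume pq: "(p, q) \<in> ?r"
      have "(p, y) \<in> ?r \<longleftrightarrow> (q, y) \<in> ?r" for y
      proof
        assume a: "(p, y) \<in> ?r"
        then obtain T'' where y: "y = MK T''" unfolding X by blast
        show "(q, y) \<in> ?r" using a pq that orth_equiv_equivalence(2)[of T T'] orth_equiv_equivalence(3)[of T' T T''] unfolding T y by blast
      next
        assume a: "(q, y) \<in> ?r"
        then obtain T'' where y: "y = MK T''" unfolding X by blast
        show "(p, y) \<in> ?r" using a pq that orth_equiv_equivalence(3)[of T T' T''] unfolding T y by blast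
      qed
      then show "?r `` {p} = ?r `` {q}" by blast
    qed
  qed
  have "?X // ?r = (\<lambda>z. ?r `` {MK (encode s z)}) ` ?Z"
  proof (intro equalityI subsetI)
    fix k assume "k \<in> ?X // ?r"
    then obtain p where p: "p \<in> ?X" "k = ?r `` {p}" unfolding quotient_def by blast
    obtain T where T: "p = MK T" "gram (s\<^sup>2) t T" using p(1) unfolding X by blast
    obtain g z where g: "orthogonal_transformation g" "map6 g T = encode s z" "bil (s, z) (s, z) = t"
      using normal_form[OF T(2) s] by blast
    have "(p, MK (encode s z)) \<in> orth_equiv" unfolding T(1) orth_equiv_MK using g by metis
    moreover have z: "z \<in> ?Z" using g(3) by simp
    ultimately have "(p, MK (encode s z)) \<in> ?r" using p(1) ZX[OF z] by (intro IntI SigmaI)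
    then have "?r `` {p} = ?r `` {MK (encode s z)}" by (rule cls[OF p(1) ZX[OF z], THEN iffD2])
    then show "k \<in> (\<lambda>z. ?r `` {MK (encode s z)}) ` ?Z" unfolding p(2) using z by (rule image_eqI)
  next
    fix k assume "k \<in> (\<lambda>z. ?r `` {MK (encode s z)}) ` ?Z"
    then obtain z where z: "z \<in> ?Z" "k = ?r `` {MK (encode s z)}" by (rule imageE)
    show "k \<in> ?X // ?r" unfolding z(2) by (rule quotientI[OF ZX[OF z(1)]])
  qed
  then have "num_sos3_classes f = card ((\<lambda>z. ?r `` {MK (encode s z)}) ` ?Z)" unfolding num_sos3_classes_def by simp
  also have "\<dots> = card (c ` ?Z)"
  proof (rule card_image_eq)
    fix z z' assume z: "z \<in> ?Z" "z' \<in> ?Z"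
    have "?r `` {MK (encode s z)} = ?r `` {MK (encode s z')} \<longleftrightarrow> (MK (encode s z), MK (encode s z')) \<in> orth_equiv"
      using cls[OF ZX[OF z(1)] ZX[OF z(2)]] ZX[OF z(1)] ZX[OF z(2)] by blast
    also have "\<dots> \<longleftrightarrow> c z = c z'" unfolding orth_equiv_MK using R Rc z by simp
    finally show "?r `` {MK (encode s z)} = ?r `` {MK (encode s z')} \<longleftrightarrow> c z = c z'" .
  qed
  finally show ?thesis .
qed

section \<open>Counting the representations\<close>

lemma nonneg_quadratic:
  fixes a b c :: real
  assumes "\<And>z. a * z\<^sup>2 + b * z + c \<ge> 0"
  shows "a \<ge> 0" "b\<^sup>2 \<le> 4 * a * c"
proof -
  have c: "c \<ge> 0" using assms[of 0] by simp
  show a: "a \<ge> 0"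
  proof (rule ccontr)
    assume "\<not> a \<ge> 0"
    then have a: "a < 0" by simp
    \<comment> \<open>Chosen with a t = a - c and t \<ge> 1. Averaging the values at t and - t
      removes b and leaves a t^2 + c \<le> a t + c = a < 0.\<close>
    define t where "t = 1 - c / a"
    have t: "t \<ge> 1" "a * t = a - c" using a c by (auto simp: t_def divide_le_0_iff field_simps)
    have "t * 1 \<le> t * t" using t(1) by (intro mult_left_mono) auto
    then have "a * t\<^sup>2 \<le> a * t" using a by (intro mult_left_mono_neg) (auto simp: power2_eq_square)
    moreover have "a * t\<^sup>2 + b * t + c \<ge> 0" "a * t\<^sup>2 - b * t + c \<ge> 0" using assms[of t] assms[of "- t"] by simp_all
    ultimately show False using t(2) a by linarith
  qed
  show "b\<^sup>2 \<le> 4 * a * c"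
  proof (cases "a = 0")
    case True
    have "b = 0"
    proof (rule ccontr)
      assume "b \<noteq> 0"
      then have "b * (- (c + 1) / b) = - (c + 1)" by simp
      then show False using assms[of "- (c + 1) / b"] True by simp
    qed
    then show ?thesis using True by simp
  next
    case False
    then have pos: "a > 0" using a by simp
    define w where "w = b / (2 * a)"
    have b: "b = 2 * a * w" using False by (simp add: w_def)
    have "a * (c - a * w\<^sup>2) \<ge> 0" using assms[of "- w"] pos unfolding b
      by (intro mult_nonneg_nonneg) (simp_all add: power2_eq_square algebra_simps)
    then show ?thesis unfolding b by (simp add: power2_eq_square algebra_simps)
  qed
qed

lemma nonneg_poly_root:
  fixes p :: "real poly"
  assumes "\<And>x. poly p x \<ge> 0" "poly p a = 0"
  shows "poly (pderiv p) a = 0"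
  by (rule DERIV_local_min[OF poly_DERIV[of p a], of 1]) (use assms in auto)

lemma eval3_quadratic:
  "eval3 [:form4 f40 f41 f42 f43 f44, form3 f30 f31 f32 f33, form2 f20 f21 f22:] x y z =
    (f20 * x\<^sup>2 + f21 * x * y + f22 * y\<^sup>2) * z\<^sup>2 + (f30 * x ^ 3 + f31 * x\<^sup>2 * y + f32 * x * y\<^sup>2 + f33 * y ^ 3) * z
    + (f40 * x ^ 4 + f41 * x ^ 3 * y + f42 * x\<^sup>2 * y\<^sup>2 + f43 * x * y ^ 3 + f44 * y ^ 4)"
  by (simp add: eval3_def eval2_def form_defs) (simp add: algebra_simps eval_nat_numeral)

lemma eval3_quartic:
  "eval3 [:form4 f40 f41 f42 f43 f44, form3 f30 f31 f32 f33, form2 f20 f21 f22, 0, 1:] x y z =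
    z ^ 4 + eval3 [:form4 f40 f41 f42 f43 f44, form3 f30 f31 f32 f33, form2 f20 f21 f22:] x y z"
  by (simp add: eval3_def eval2_def form_defs one_pCons) (simp add: algebra_simps eval_nat_numeral)

lemma orth2_flip:
  assumes "orth2 x y"
  shows "orth2 (flip x) (flip y)"
proof -
  obtain e where e: "cmod e = 1" "y = rot e x \<or> y = rot e (cj x)" using assms by (auto simp: orth2_def)
  have "flip (rot e x) = rot e (flip x)" "flip (rot e (cj x)) = rot e (cj (flip x))" by (simp_all add: flip_def rot_def cj_def)
  then show ?thesis using e unfolding orth2_def by metis
qed

lemma flip_class_eq_iff:
  "{w. orth2 x w \<or> orth2 (flip x) w} = {w. orth2 y w \<or> orth2 (flip y) w} \<longleftrightarrow> orth2 x y \<or> orth2 (flip x) y" (is "?c x = ?c y \<longleftrightarrow> _")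
proof
  assume "?c x = ?c y"
  moreover have "y \<in> ?c y" using orth2_refl by blast
  ultimately show "orth2 x y \<or> orth2 (flip x) y" by blast
next
  assume "orth2 x y \<or> orth2 (flip x) y"
  then show "?c x = ?c y"
  proof
    assume xy: "orth2 x y"
    then show ?thesis using orth2_flip[OF xy] orth2_sym orth2_trans by blast
  next
    assume xy: "orth2 (flip x) y"
    then have "orth2 x (flip y)" using orth2_flip[OF xy] by (simp add: flip_flip)
    then show ?thesis using xy orth2_sym orth2_trans by blast
  qed
qed

section \<open>Forms given by their coefficients\<close>

locale coefficients =
  fixes f20 f21 f22 f30 f31 f32 f33 f40 f41 f42 f43 f44 :: real
begin

abbreviation "f2 \<equiv> form2 f20 f21 f22"
abbreviation "f3 \<equiv> form3 f30 f31 f32 f33"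
abbreviation "f4 \<equiv> form4 f40 f41 f42 f43 f44"

definition F2 where "F2 = [:f22, f21, f20:]"
definition F3 where "F3 = [:f33, f32, f31, f30:]"
definition F4 where "F4 = [:f44, f43, f42, f41, f40:]"
definition T :: rhs where "T = (f20, f21, f22, f30, f31, f32, f33, f40, f41, f42, f43, f44)"

lemma dehom_f: "dehom f2 = F2" "dehom f3 = F3" "dehom f4 = F4"
  by (simp_all add: dehom_forms F2_def F3_def F4_def)

lemma degree_F: "degree F2 \<le> 2" "degree F3 \<le> 3" "degree F4 \<le> 4"
  unfolding F2_def F3_def F4_def by (auto intro!: order_trans[OF degree_pCons_le])

lemma coeff_F2: "coeff F2 2 = f20" "coeff F2 (2 - 1) = f21"
  by (simp_all add: F2_def numeral_2_eq_2)

lemma bil_T_iff: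
  "bil (s, z) (s, z) = T \<longleftrightarrow>
    F2 = smult (2 * s) (pA z) + (pL2 z)\<^sup>2 + (pL3 z)\<^sup>2 \<and>
    F3 = smult 2 (pL2 z * pQ2 z + pL3 z * pQ3 z) \<and>
    F4 = (pA z)\<^sup>2 + (pQ2 z)\<^sup>2 + (pQ3 z)\<^sup>2"
proof -
  have 1: "smult s (pA z) + smult s (pA z) + pL2 z * pL2 z + pL3 z * pL3 z = smult (2 * s) (pA z) + (pL2 z)\<^sup>2 + (pL3 z)\<^sup>2"
    by (simp add: power2_eq_square flip: smult_add_left)
  have 2: "pL2 z * pQ2 z + pL3 z * pQ3 z + pQ2 z * pL2 z + pQ3 z * pL3 z = smult 2 (pL2 z * pQ2 z + pL3 z * pQ3 z)"
  proof -
    have "smult 2 p = p + p" for p :: "real poly" using smult_add_left[of 1 1 p] by simp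
    then show ?thesis by (simp add: algebra_simps)
  qed
  show ?thesis unfolding T_def bil_eq_iff 1 2 F2_def F3_def F4_def
    by (auto simp: power2_eq_square)
qed

text \<open>As F2 has exact degree 2, a quotient has degree at most 1 and homogenizes to a linear
  form, so divisibility would lift to the binary forms.\<close>

lemma not_dvd:
  assumes "\<not> f2 dvd f3" "f20 \<noteq> 0"
  shows "\<not> F2 dvd F3"
proof
  assume "F2 dvd F3"
  then obtain G where G: "F3 = F2 * G" unfolding dvd_def by blast
  have "degree G \<le> 1"
  proof (cases "G = 0")
    case False
    have "degree F2 = 2" "F2 \<noteq> 0" using assms(2) by (auto simp: F2_def)
    then have "degree F3 = 2 + degree G" unfolding G using False by (simp add: degree_mult_eq)
    then show ?thesis using degree_F(2) by simp
  qed simp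
  then obtain g0 g1 where g: "G = [:g1, g0:]"
    by (cases G rule: pCons_cases) (metis One_nat_def degree_eq_zeroE degree_pCons_eq_if le_zero_eq not_less_eq_eq pCons_0_0)
  have "f3 = f2 * form1 g0 g1" using G unfolding g F2_def F3_def by (simp add: form_defs algebra_simps)
  then show False using assms(1) by simp
qed

end

section \<open>Quartics without a z^4 term\<close>

locale generic_coefficients = coefficients +
  assumes psd: "psd3 [:f4, f3, f2:]"
    and d2: "bidisc 2 f2 \<noteq> 0" and nd: "\<not> f2 dvd f3" and d6: "bidisc 6 (4 * f2 * f4 - f3 ^ 2) \<noteq> 0"
begin

definition q2 where "q2 x y = f20 * x\<^sup>2 + f21 * x * y + f22 * y\<^sup>2"
definition q3 where "q3 x y = f30 * x ^ 3 + f31 * x\<^sup>2 * y + f32 * x * y\<^sup>2 + f33 * y ^ 3"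
definition q4 where "q4 x y = f40 * x ^ 4 + f41 * x ^ 3 * y + f42 * x\<^sup>2 * y\<^sup>2 + f43 * x * y ^ 3 + f44 * y ^ 4"

lemma psd_q: "q2 x y * z\<^sup>2 + q3 x y * z + q4 x y \<ge> 0"
  using psd unfolding psd3_def eval3_quadratic q2_def q3_def q4_def by blast

lemma disc2: "disc 2 F2 \<noteq> 0" and disc6: "disc 6 (4 * F2 * F4 - F3\<^sup>2) \<noteq> 0"
  using d2 d6 unfolding bidisc_def dehom_simps dehom_f by auto

lemma q_poly: "q2 x 1 = poly F2 x" "q3 x 1 = poly F3 x" "q4 x 1 = poly F4 x"
  by (simp_all add: q2_def q3_def q4_def F2_def F3_def F4_def algebra_simps eval_nat_numeral)

text \<open>Nonnegativity in z for fixed x, y makes f2 psd. A psd binary quadratic that is not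
  definite has a double root, at infinity if f20 = 0 and at a real point otherwise, and its
  discriminant vanishes.\<close>

lemma f20_pos: "f20 > 0" and f2_definite: "f21\<^sup>2 < 4 * f20 * f22"
proof -
  have "f22 * y\<^sup>2 + f21 * y + f20 \<ge> 0" for y
    using nonneg_quadratic(1)[OF psd_q[of 1 y]] by (simp add: q2_def algebra_simps)
  note n = nonneg_quadratic(2)[OF this] this[of 0]
  show p: "f20 > 0"
  proof (rule ccontr)
    assume "\<not> f20 > 0"
    then have z: "f20 = 0" using n(2) by simp
    then have "f21 = 0" using n(1) by simp
    have "disc 2 F2 = 0"
      by (rule disc_eq_0_degenerate[OF degree_F(1)]) (unfold coeff_F2, fact+, simp)
    then show False using disc2 by blast
  qed
  show "f21\<^sup>2 < 4 * f20 * f22"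
  proof (rule ccontr)
    assume "\<not> f21\<^sup>2 < 4 * f20 * f22"
    then have eq: "f21\<^sup>2 = 4 * f20 * f22" using n(1) by (simp add: mult_ac)
    define x where "x = - f21 / (2 * f20)"
    have x: "f21 = - 2 * f20 * x" using p by (simp add: x_def)
    have "f20 * (f20 * x\<^sup>2) = f20 * f22" using eq unfolding x by (simp add: power_mult_distrib) (auto simp: power2_eq_square)
    then have f22: "f22 = f20 * x\<^sup>2" using p by simp
    have "poly F2 x = 0" "poly (pderiv F2) x = 0"
      unfolding F2_def by (simp_all add: pderiv_pCons x f22 power2_eq_square algebra_simps)
    then have "poly (cx F2) (of_real x) = 0" "poly (cx (pderiv F2)) (of_real x) = 0" by (simp_all only: poly_cx_of_real of_real_0)
    then have "disc 2 F2 = 0" using p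
      by (intro disc_eq_0_double_root[OF degree_F(1), of "of_real x"]) (simp_all add: coeff_F2 )
    then show False using disc2 by blast
  qed
qed

definition D where "D = 4 * F2 * F4 - F3\<^sup>2"

lemma D_nonneg: "(q3 x y)\<^sup>2 \<le> 4 * q2 x y * q4 x y"
  by (rule nonneg_quadratic(2)[OF psd_q])

lemma poly_D_nonneg: "poly D x \<ge> 0"
  using D_nonneg[of x 1] unfolding q_poly D_def by simp

lemma degree_D_le: "degree D \<le> 6"
proof -
  have "degree (4 * F2 * F4) \<le> 6" unfolding mult.assoc
    by (rule order_trans[OF degree_num], rule order_trans[OF degree_mult_le]) (use degree_F in linarith)
  moreover have "degree (F3\<^sup>2) \<le> 6" unfolding power2_eq_square
    by (rule order_trans[OF degree_mult_le]) (use degree_F in linarith)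
  ultimately show ?thesis unfolding D_def by (rule degree_diff_le)
qed

lemma coeff_D_6: "coeff D 6 = 4 * f20 * f40 - f30\<^sup>2" "coeff D 5 = 4 * (f20 * f41 + f21 * f40) - 2 * f30 * f31"
proof -
  have four: "4 * p = smult 4 p" for p :: "real poly" by (simp add: numeral_poly)
  show "coeff D 6 = 4 * f20 * f40 - f30\<^sup>2" "coeff D 5 = 4 * (f20 * f41 + f21 * f40) - 2 * f30 * f31"
    unfolding D_def F2_def F3_def F4_def power2_eq_square mult.assoc four
    by (simp_all add: eval_nat_numeral algebra_simps)
qed

text \<open>The reversed polynomial \<open>pr\<close> is nonnegative, so if its value at 0, the
  coefficient of x^6 in D, vanished, its derivative there, the coefficient of x^5, would vanish too.
  This is a double root at infinity.\<close>

lemma degree_D: "degree D = 6"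
proof -
  have "coeff D 6 \<noteq> 0"
  proof
    assume z: "coeff D 6 = 0"
    define pr where "pr = smult 4 ([:f20, f21, f22:] * [:f40, f41, f42, f43, f44:]) - [:f30, f31, f32, f33:]\<^sup>2"
    have "poly pr y = 4 * q2 1 y * q4 1 y - (q3 1 y)\<^sup>2" for y
      by (simp add: pr_def q2_def q3_def q4_def algebra_simps eval_nat_numeral)
    then have n: "poly pr y \<ge> 0" for y using D_nonneg[of 1 y] by simp
    have "poly pr 0 = 0" using z unfolding coeff_D_6 by (simp add: pr_def mult_ac)
    then have "poly (pderiv pr) 0 = 0" by (rule nonneg_poly_root[OF n])
    moreover have "poly (pderiv pr) 0 = coeff D 5"
      unfolding coeff_D_6 pr_def pderiv_diff pderiv_smult power2_eq_square pderiv_mult poly_add poly_diff poly_smult poly_mult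
      by (simp add: pderiv_pCons)
    ultimately have "disc 6 D = 0" using z degree_D_le by (intro disc_eq_0_degenerate) auto
    then show False using disc6 unfolding D_def by blast
  qed
  then have "6 \<le> degree D" by (rule le_degree)
  then show ?thesis using degree_D_le by simp
qed

lemma D_simple: "poly (cx D) z = 0 \<Longrightarrow> poly (pderiv (cx D)) z \<noteq> 0"
proof
  assume "poly (cx D) z = 0" "poly (pderiv (cx D)) z = 0"
  moreover have "coeff D 6 \<noteq> 0" using leading_coeff_0_iff[of D] degree_D by (metis degree_0 zero_neq_numeral)
  ultimately have "disc 6 D = 0" by (intro disc_eq_0_double_root[OF degree_D_le])
  then show False using disc6 unfolding D_def by blast
qed

text \<open>A real zero of a nonnegative polynomial is a double root.\<close>

lemma D_pos: "poly D x > 0"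
proof (rule ccontr)
  assume "\<not> poly D x > 0"
  then have z: "poly D x = 0" using poly_D_nonneg[of x] by simp
  have "poly (pderiv D) x = 0" by (rule nonneg_poly_root[OF poly_D_nonneg z])
  then have "poly (cx D) (of_real x) = 0" "poly (cx (pderiv D)) (of_real x) = 0" using z by (simp_all only: poly_cx_of_real of_real_0)
  then show False using D_simple[of "of_real x"] by simp
qed

text \<open>Completing the square: f2 = (r x + m y)^2 + (\<mu> y)^2.\<close>

definition r where "r = sqrt f20"
definition m where "m = f21 / (2 * r)"
definition \<mu> where "\<mu> = sqrt (f22 - m\<^sup>2)"

lemma r_pos: "r > 0" and r2: "r\<^sup>2 = f20" and rm: "2 * m * r = f21" and \<mu>_pos: "\<mu> > 0" and m\<mu>: "m\<^sup>2 + \<mu>\<^sup>2 = f22"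
proof -
  show r: "r > 0" and r2: "r\<^sup>2 = f20" using f20_pos by (simp_all add: r_def)
  show rm: "2 * m * r = f21" using r by (simp add: m_def)
  have "4 * f20 * m\<^sup>2 = f21\<^sup>2" using arg_cong[OF rm, of "\<lambda>v. v\<^sup>2"] r2 by (simp add: power_mult_distrib mult_ac)
  then have "4 * f20 * m\<^sup>2 < 4 * f20 * f22" using f2_definite by simp
  then have "m\<^sup>2 < f22" using f20_pos by simp
  then show "\<mu> > 0" "m\<^sup>2 + \<mu>\<^sup>2 = f22" by (simp_all add: \<mu>_def)
qed

sublocale G: gauge_fixed F2 F3 F4 "[:m, r:]" "[:\<mu>:]" m r \<mu>
proof unfold_locales
  show "r > 0" "\<mu> > 0" by (rule r_pos, rule \<mu>_pos)
  show "F2 = [:m, r:]\<^sup>2 + [:\<mu>:]\<^sup>2"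
    unfolding F2_def using r2 rm m\<mu> by (simp add: power2_eq_square algebra_simps)
  show "\<not> F2 dvd F3" using not_dvd[OF nd] f20_pos by simp
  show "degree (4 * F2 * F4 - F3\<^sup>2) = 6" using degree_D unfolding D_def .
  show "poly (4 * F2 * F4 - F3\<^sup>2) x > 0" for x using D_pos unfolding D_def .
  show "poly (cx (4 * F2 * F4 - F3\<^sup>2)) z = 0 \<Longrightarrow> poly (pderiv (cx (4 * F2 * F4 - F3\<^sup>2))) z \<noteq> 0" for z
    using D_simple unfolding D_def .
qed simp_all

definition emb :: "real poly \<times> real poly \<times> real poly \<Rightarrow> sol" where
  "emb \<tau> = (case \<tau> of (A, Q2, Q3) \<Rightarrow> (coeff A 2, coeff A 1, coeff A 0, of_real r, Complex m \<mu>,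
     Complex (coeff Q2 2) (coeff Q3 2), Complex (coeff Q2 1) (coeff Q3 1), Complex (coeff Q2 0) (coeff Q3 0)))"

lemma quadratic_eq: "degree p \<le> 2 \<Longrightarrow> [:coeff p 0, coeff p 1, coeff p 2:] = p"
  by (intro poly_eqI) (auto simp: coeff_pCons coeff_eq_0 numeral_2_eq_2 split: nat.splits)

lemma emb_polys:
  assumes "(A, Q2, Q3) \<in> G.triples"
  shows "pA (emb (A, Q2, Q3)) = A" "pL2 (emb (A, Q2, Q3)) = [:m, r:]" "pL3 (emb (A, Q2, Q3)) = [:\<mu>:]"
    "pQ2 (emb (A, Q2, Q3)) = Q2" "pQ3 (emb (A, Q2, Q3)) = Q3"
proof -
  note d = G.degree_triples[OF assms degree_F(3)]
  show "pA (emb (A, Q2, Q3)) = A" "pQ2 (emb (A, Q2, Q3)) = Q2" "pQ3 (emb (A, Q2, Q3)) = Q3"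
    using d[THEN quadratic_eq] by (simp_all add: emb_def sol_polys)
  show "pL2 (emb (A, Q2, Q3)) = [:m, r:]" "pL3 (emb (A, Q2, Q3)) = [:\<mu>:]"
    by (simp_all add: emb_def sol_polys)
qed

abbreviation "Z0 \<equiv> {z. bil (0, z) (0, z) = T}"

lemma emb_Z0: "\<tau> \<in> G.triples \<Longrightarrow> emb \<tau> \<in> Z0"
proof -
  assume a: "\<tau> \<in> G.triples"
  obtain A Q2 Q3 where \<tau>: "\<tau> = (A, Q2, Q3)" by (cases \<tau>)
  have h: "F3 = smult 2 ([:m, r:] * Q2 + [:\<mu>:] * Q3)" "F4 = A\<^sup>2 + Q2\<^sup>2 + Q3\<^sup>2" using a unfolding \<tau> G.triples_def by auto
  have "bil (0, emb \<tau>) (0, emb \<tau>) = T"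
    unfolding bil_T_iff \<tau> emb_polys[OF a[unfolded \<tau>]] using h G.F2 by simp
  then show ?thesis by simp
qed

text \<open>A rotation makes \<open>su0 z\<close> equal to the positive real r. The equations for f2
  then fix the real part of the rotated \<open>su1 z\<close> as m and its imaginary part as \<mu> up
  to sign, and a conjugation corrects the sign.\<close>

lemma Z0_emb:
  assumes "z \<in> Z0"
  obtains \<tau> where "\<tau> \<in> G.triples" "orth2 z (emb \<tau>)"
proof -
  have b: "bil (0, z) (0, z) = T" using assms by simp
  then have e: "su0 z \<bullet> su0 z = f20" "2 * (su0 z \<bullet> su1 z) = f21" "su1 z \<bullet> su1 z = f22"
    unfolding T_def bil_def Let_def fst_conv snd_conv prod.inject by (auto simp: inner_commute)
  have "norm (su0 z) = r" using e(1) by (simp add: r_def norm_eq_sqrt_inner)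
  define c where "c = cnj (su0 z) / of_real r"
  have c: "cmod c = 1" using r_pos \<open>norm (su0 z) = r\<close> by (simp add: c_def norm_divide)
  have cu: "c * su0 z = of_real r"
    using r_pos complex_norm_square[of "su0 z"] \<open>norm (su0 z) = r\<close>
    by (simp add: c_def divide_eq_eq power2_eq_square mult.commute)
  define v where "v = c * su1 z"
  have "of_real r \<bullet> v = su0 z \<bullet> su1 z" unfolding v_def cu[symmetric] by (rule inner_rot[OF c])
  then have "2 * (r * Re v) = 2 * m * r" using e(2) rm by (simp add: inner_complex_def)
  then have rev: "Re v = m" using r_pos by simp
  have "v \<bullet> v = f22" unfolding v_def inner_rot[OF c] by (rule e(3))
  then have "(Im v)\<^sup>2 = \<mu>\<^sup>2" using m\<mu> rev by (simp add: inner_complex_def power2_eq_square)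
  then have imv: "Im v = \<mu> \<or> Im v = - \<mu>" by (simp add: power2_eq_iff)
  from imv have "\<exists>y. orth2 z y \<and> su0 y = of_real r \<and> su1 y = Complex m \<mu>"
  proof
    assume "Im v = \<mu>"
    then have "su1 (rot c z) = Complex m \<mu>" using rev by (simp add: rot_def v_def complex_eq_iff)
    moreover have "su0 (rot c z) = of_real r" by (simp add: rot_def cu)
    ultimately show ?thesis using c unfolding orth2_def by blast
  next
    assume i: "Im v = - \<mu>"
    have "cnj c * cnj (su1 z) = cnj v" by (simp add: v_def)
    then have "su1 (rot (cnj c) (cj z)) = Complex m \<mu>" using rev i by (simp add: rot_def cj_def complex_eq_iff)
    moreover have "su0 (rot (cnj c) (cj z)) = of_real r" using arg_cong[OF cu, of cnj] by (simp add: rot_def cj_def)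
    moreover have "cmod (cnj c) = 1" using c by simp
    ultimately show ?thesis unfolding orth2_def by blast
  qed
  then obtain y where y: "orth2 z y" "su0 y = of_real r" "su1 y = Complex m \<mu>" by blast
  have yT: "bil (0, y) (0, y) = T" using bil_orth2[OF y(1)] b by simp
  have L: "pL2 y = [:m, r:]" "pL3 y = [:\<mu>:]" using y by (simp_all add: sol_polys)
  have "(pA y, pQ2 y, pQ3 y) \<in> G.triples" using yT unfolding bil_T_iff L G.triples_def by auto
  moreover have "emb (pA y, pQ2 y, pQ3 y) = y"
    using y by (simp add: emb_def sol_polys prod_eq_iff numeral_2_eq_2)
  ultimately show ?thesis using that[of "(pA y, pQ2 y, pQ3 y)"] y(1) by simp
qed

text \<open>The normalized linear forms have trivial stabilizer: r > 0 forces the rotation to be 1,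
  and \<mu> > 0 excludes the conjugation.\<close>

lemma orth2_fixed:
  assumes "orth2 y y'" "su0 y = of_real r" "su1 y = Complex m \<mu>" "su0 y' = of_real r" "su1 y' = Complex m \<mu>"
  shows "y' = y"
proof -
  obtain e where e: "cmod e = 1" "y' = rot e y \<or> y' = rot e (cj y)" using assms(1) by (auto simp: orth2_def)
  have "e * of_real r = of_real r" using e(2) assms(2,4) by (auto simp: rot_def cj_def)
  then have e1: "e = 1" using r_pos by simp
  from e(2) show ?thesis
  proof
    assume "y' = rot e y" then show ?thesis by (simp add: e1 rot_1)
  next
    assume "y' = rot e (cj y)"
    then have "Complex m \<mu> = cnj (Complex m \<mu>)" using assms(3,5) by (simp add: e1 rot_1 cj_def)
    then show ?thesis using \<mu>_pos by (simp add: complex_eq_iff)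
  qed
qed

lemma emb_u: "su0 (emb \<tau>) = of_real r" "su1 (emb \<tau>) = Complex m \<mu>"
  by (cases \<tau>; simp add: emb_def)+

lemma orth2_emb_iff: "\<tau> \<in> G.triples \<Longrightarrow> \<tau>' \<in> G.triples \<Longrightarrow> orth2 (emb \<tau>) (emb \<tau>') \<longleftrightarrow> \<tau> = \<tau>'"
proof
  assume a: "\<tau> \<in> G.triples" "\<tau>' \<in> G.triples" "orth2 (emb \<tau>) (emb \<tau>')"
  have eq: "emb \<tau>' = emb \<tau>" by (rule orth2_fixed[OF a(3) emb_u emb_u])
  obtain A Q2 Q3 A' Q2' Q3' where t: "\<tau> = (A, Q2, Q3)" "\<tau>' = (A', Q2', Q3')" by (metis prod.exhaust)
  show "\<tau> = \<tau>'" using emb_polys[OF a(1)[unfolded t]] emb_polys[OF a(2)[unfolded t]] eq unfolding t by simp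
qed (simp add: orth2_refl)

lemma card_orbits_Z0: "card ((\<lambda>z. {w. orth2 z w}) ` Z0) = 8"
proof -
  have oe: "{w. orth2 x w} = {w. orth2 y w} \<longleftrightarrow> orth2 x y" for x y
    using orth2_refl orth2_sym orth2_trans by blast
  have "(\<lambda>z. {w. orth2 z w}) ` Z0 = (\<lambda>\<tau>. {w. orth2 (emb \<tau>) w}) ` G.triples"
  proof (intro equalityI subsetI)
    fix c assume "c \<in> (\<lambda>z. {w. orth2 z w}) ` Z0"
    then obtain z where z: "z \<in> Z0" "c = {w. orth2 z w}" by blast
    obtain \<tau> where \<tau>: "\<tau> \<in> G.triples" "orth2 z (emb \<tau>)" by (rule Z0_emb[OF z(1)])
    then show "c \<in> (\<lambda>\<tau>. {w. orth2 (emb \<tau>) w}) ` G.triples" using z(2) oe by blast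
  next
    fix c assume "c \<in> (\<lambda>\<tau>. {w. orth2 (emb \<tau>) w}) ` G.triples"
    then show "c \<in> (\<lambda>z. {w. orth2 z w}) ` Z0" using emb_Z0 by blast
  qed
  moreover have "inj_on (\<lambda>\<tau>. {w. orth2 (emb \<tau>) w}) G.triples"
    by (rule inj_onI) (simp only: oe orth2_emb_iff)
  ultimately show ?thesis using G.card_triples by (simp add: card_image)
qed

lemma card_image_involution:
  assumes "finite S" "\<And>x. x \<in> S \<Longrightarrow> i x \<in> S \<and> i x \<noteq> x" "\<And>x y. x \<in> S \<Longrightarrow> y \<in> S \<Longrightarrow> g x = g y \<longleftrightarrow> y = x \<or> y = i x"
  shows "2 * card (g ` S) = card S"
proof -
  have "card S = (\<Sum>x\<in>S. 1)" by simp
  also have "\<dots> = (\<Sum>c\<in>g ` S. \<Sum>x\<in>{x \<in> S. g x = c}. 1)" by (rule sum.image_gen[OF assms(1)])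
  also have "\<dots> = (\<Sum>c\<in>g ` S. 2)"
  proof (rule sum.cong[OF refl])
    fix c assume "c \<in> g ` S"
    then obtain x where x: "x \<in> S" "c = g x" by blast
    have "{y \<in> S. g y = c} = {x, i x}"
      using assms(2)[OF x(1)] assms(3)[OF x(1)] x by (auto dest: sym)
    then show "(\<Sum>x\<in>{x \<in> S. g x = c}. 1) = (2::nat)" using assms(2)[OF x(1)] by (simp add: eq_commute[of x])
  qed
  finally show ?thesis by simp
qed

text \<open>The quantity 4 f20 f22 - f21^2 is four times a Gram determinant, hence four times the
  square of this determinant.\<close>

lemma independent_Z0:
  assumes "z \<in> Z0"
  shows "Re (su0 z) * Im (su1 z) - Im (su0 z) * Re (su1 z) \<noteq> 0"
proof
  assume z: "Re (su0 z) * Im (su1 z) - Im (su0 z) * Re (su1 z) = 0"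
  have e: "su0 z \<bullet> su0 z = f20" "2 * (su0 z \<bullet> su1 z) = f21" "su1 z \<bullet> su1 z = f22"
    using assms unfolding mem_Collect_eq T_def bil_def Let_def fst_conv snd_conv prod.inject by (auto simp: inner_commute)
  have "4 * f20 * f22 - f21\<^sup>2 = 4 * (Re (su0 z) * Im (su1 z) - Im (su0 z) * Re (su1 z))\<^sup>2"
    unfolding e[symmetric] by (simp add: inner_complex_def power2_eq_square algebra_simps)
  then show False using z f2_definite by simp
qed

lemma flip_emb: "flip (emb (A, Q2, Q3)) = emb (- A, Q2, Q3)"
  by (simp add: emb_def flip_def)

lemma card_flip_orbits_Z0: "card ((\<lambda>z. {w. orth2 z w \<or> orth2 (flip z) w}) ` Z0) = 4"
proof -
  let ?c = "\<lambda>z. {w. orth2 z w \<or> orth2 (flip z) w}"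
  have "?c ` Z0 = (\<lambda>\<tau>. ?c (emb \<tau>)) ` G.triples"
  proof (intro equalityI subsetI)
    fix c assume "c \<in> ?c ` Z0"
    then obtain z where z: "z \<in> Z0" "c = ?c z" by blast
    obtain \<tau> where \<tau>: "\<tau> \<in> G.triples" "orth2 z (emb \<tau>)" by (rule Z0_emb[OF z(1)])
    have "c = ?c (emb \<tau>)" unfolding z(2) flip_class_eq_iff using \<tau>(2) by blast
    then show "c \<in> (\<lambda>\<tau>. ?c (emb \<tau>)) ` G.triples" using \<tau>(1) by blast
  next
    fix c assume "c \<in> (\<lambda>\<tau>. ?c (emb \<tau>)) ` G.triples"
    then show "c \<in> ?c ` Z0" using emb_Z0 by blast
  qed
  moreover have "2 * card ((\<lambda>\<tau>. ?c (emb \<tau>)) ` G.triples) = card G.triples"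
  proof (rule card_image_involution[where i = "\<lambda>\<tau>. (- fst \<tau>, snd \<tau>)"])
    show "finite G.triples" using G.card_triples by blast
    fix \<tau> assume \<tau>: "\<tau> \<in> G.triples"
    obtain A Q2 Q3 where t: "\<tau> = (A, Q2, Q3)" by (cases \<tau>)
    have i: "(- A, Q2, Q3) \<in> G.triples" using \<tau> unfolding t G.triples_def by simp
    have "A \<noteq> 0" using G.A_nonzero \<tau> unfolding t by blast
    then have "- A \<noteq> A" by (auto simp: poly_eq_iff)
    then show "(- fst \<tau>, snd \<tau>) \<in> G.triples \<and> (- fst \<tau>, snd \<tau>) \<noteq> \<tau>" using i unfolding t by simp
    fix \<tau>' assume \<tau>': "\<tau>' \<in> G.triples"
    have "?c (emb \<tau>) = ?c (emb \<tau>') \<longleftrightarrow> orth2 (emb \<tau>) (emb \<tau>') \<or> orth2 (emb (- A, Q2, Q3)) (emb \<tau>')"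
      unfolding flip_class_eq_iff unfolding t flip_emb ..
    then show "?c (emb \<tau>) = ?c (emb \<tau>') \<longleftrightarrow> \<tau>' = \<tau> \<or> \<tau>' = (- fst \<tau>, snd \<tau>)"
      using orth2_emb_iff[OF \<tau> \<tau>'] orth2_emb_iff[OF i \<tau>'] unfolding t by auto
  qed
  ultimately show ?thesis using G.card_triples by simp
qed

theorem count_with_zero: "num_sos3_classes [:f4, f3, f2:] = 4"
proof -
  have "num_sos3_classes [:f4, f3, f2:] = card ((\<lambda>z. {w. orth2 z w \<or> orth2 (flip z) w}) ` Z0)"
  proof (rule card_classes[where s = 0 and R = "\<lambda>z z'. orth2 z z' \<or> orth2 (flip z) z'"])
    show "[:f4, f3, f2:] = [:f4, f3, f2, 0, [:[:0\<^sup>2:]:]:]" by simp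
    show "T = (f20, f21, f22, f30, f31, f32, f33, f40, f41, f42, f43, f44)" by (rule T_def)
    fix z z' assume z: "bil (0, z) (0, z) = T" "bil (0, z') (0, z') = T"
    show r: "(\<exists>g. orthogonal_transformation g \<and> encode 0 z' = map6 g (encode 0 z)) \<longleftrightarrow> orth2 z z' \<or> orth2 (flip z) z'"
      by (rule encode_equiv_zero[OF independent_Z0]) (use z in simp)
    show "{w. orth2 z w \<or> orth2 (flip z) w} = {w. orth2 z' w \<or> orth2 (flip z') w} \<longleftrightarrow> orth2 z z' \<or> orth2 (flip z) z'"
      by (rule flip_class_eq_iff)
  qed simp
  then show ?thesis using card_flip_orbits_Z0 by simp
qed

end

section \<open>Quartics with leading term z^4\<close>

locale generic_quartic = generic_coefficients +
  assumes pd: "pd3 [:f4, f3, f2, 0, 1:]"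
    and cop: "coprime (gfun 2 3 F2 F3) (gfun 2 4 F2 F4)"
    and E9: "disc 8 (gfun 2 3 F2 F3 * gfun 3 4 F3 F4 - (gfun 2 4 F2 F4)\<^sup>2) \<noteq> 0"
    and E10: "Phi 8 18 (gfun 2 3 F2 F3 * gfun 3 4 F3 F4 - (gfun 2 4 F2 F4)\<^sup>2)
      (F4\<^sup>2 * gfun 2 3 F2 F3 * (2 * F4 * gfun 2 3 F2 F3 - F3 * gfun 2 4 F2 F4))
      (((8 * F2 * F4 - 3 * F3\<^sup>2) * gfun 2 3 F2 F3 + 2 * F2 * F3 * gfun 2 4 F2 F4)\<^sup>2) \<noteq> 0"
begin

sublocale N: nonsingular_pencil F2 F3 F4
  by unfold_locales (rule degree_F)+

lemma pencil_conditions: "coprime N.g23 N.g24" "disc 8 N.P \<noteq> 0" "Phi 8 18 N.P N.Q (N.R\<^sup>2) \<noteq> 0"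
  using cop E9 E10 unfolding N.P_def N.Q_def N.R_def N.g23_def N.g24_def N.g34_def by blast+

text \<open>The form is t f + (1 - t)(f - z^4), with f strictly positive and f - z^4 psd. It is
  applied with t = s^2.\<close>

lemma pencil_pos:
  assumes "0 < t" "t \<le> 1" "(x, y) \<noteq> (0, 0)"
  shows "t * z ^ 4 + (q2 x y * z\<^sup>2 + q3 x y * z + q4 x y) > 0"
proof -
  have "eval3 [:f4, f3, f2, 0, 1:] x y z > 0" using pd assms(3) unfolding pd3_def by auto
  then have "z ^ 4 + (q2 x y * z\<^sup>2 + q3 x y * z + q4 x y) > 0"
    unfolding eval3_quartic eval3_quadratic q2_def q3_def q4_def .
  then have "t * (z ^ 4 + (q2 x y * z\<^sup>2 + q3 x y * z + q4 x y)) > 0" using assms(1) by simp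
  moreover have "(1 - t) * (q2 x y * z\<^sup>2 + q3 x y * z + q4 x y) \<ge> 0" using assms(2) psd_q by simp
  ultimately show ?thesis by (simp add: algebra_simps)
qed

lemma pencil_pos_affine:
  assumes "0 < t" "t \<le> 1"
  shows "t * y ^ 4 + poly F2 x * y\<^sup>2 + poly F3 x * y + poly F4 x > 0"
  using pencil_pos[OF assms, of x 1 y] unfolding q_poly by simp

lemma coeff_F_leading: "coeff F2 2 = f20" "coeff F2 1 = f21" "coeff F3 3 = f30" "coeff F3 2 = f31" "coeff F4 4 = f40" "coeff F4 3 = f41"
  by (simp_all add: F2_def F3_def F4_def eval_nat_numeral)

lemma pencil_pos_infinity:
  assumes "0 < t" "t \<le> 1"
  shows "t * y ^ 4 + f20 * y\<^sup>2 + f30 * y + f40 > 0"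
  using pencil_pos[OF assms, of 1 0 y] by (simp add: q2_def q3_def q4_def)

text \<open>At a common zero of three forms the sum of their squares vanishes together with all its
  partial derivatives; these are the equations excluded by \<open>N.no_singular_point\<close> for t
  = s^2.\<close>

lemma no_common_zero_sol:
  assumes s: "0 < s" "s \<le> 1" and z: "bil (s, z) (s, z) = T"
  shows "no_common_zero s z"
  unfolding no_common_zero_def
proof (intro allI notI, elim conjE)
  fix \<alpha> \<zeta> :: complex
  assume h: "of_real s * \<zeta>\<^sup>2 + poly (cx (pA z)) \<alpha> = 0"
    "poly (cx (pL2 z)) \<alpha> * \<zeta> + poly (cx (pQ2 z)) \<alpha> = 0" "poly (cx (pL3 z)) \<alpha> * \<zeta> + poly (cx (pQ3 z)) \<alpha> = 0"
  note F = z[unfolded bil_T_iff, THEN conjunct1] z[unfolded bil_T_iff, THEN conjunct2, THEN conjunct1]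
    z[unfolded bil_T_iff, THEN conjunct2, THEN conjunct2]
  define A L2 L3 Q2 Q3 where v: "A = poly (cx (pA z)) \<alpha>" "L2 = poly (cx (pL2 z)) \<alpha>" "L3 = poly (cx (pL3 z)) \<alpha>"
    "Q2 = poly (cx (pQ2 z)) \<alpha>" "Q3 = poly (cx (pQ3 z)) \<alpha>"
  define A' L2' L3' Q2' Q3' where v': "A' = poly (pderiv (cx (pA z))) \<alpha>" "L2' = poly (pderiv (cx (pL2 z))) \<alpha>"
    "L3' = poly (pderiv (cx (pL3 z))) \<alpha>" "Q2' = poly (pderiv (cx (pQ2 z))) \<alpha>" "Q3' = poly (pderiv (cx (pQ3 z))) \<alpha>"
  have f: "poly (cx F2) \<alpha> = 2 * of_real s * A + L2\<^sup>2 + L3\<^sup>2" "poly (cx F3) \<alpha> = 2 * (L2 * Q2 + L3 * Q3)"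
    "poly (cx F4) \<alpha> = A\<^sup>2 + Q2\<^sup>2 + Q3\<^sup>2"
    unfolding v by (subst F; simp)+
  have d: "poly (pderiv (cx F2)) \<alpha> = 2 * of_real s * A' + 2 * L2 * L2' + 2 * L3 * L3'"
    "poly (pderiv (cx F3)) \<alpha> = 2 * (L2 * Q2' + L2' * Q2 + L3 * Q3' + L3' * Q3)"
    "poly (pderiv (cx F4)) \<alpha> = 2 * A * A' + 2 * Q2 * Q2' + 2 * Q3 * Q3'"
    unfolding v v' by (subst F; simp add: pderiv_add pderiv_smult pderiv_mult power2_eq_square algebra_simps)+
  have e: "A = - of_real s * \<zeta>\<^sup>2" "Q2 = - L2 * \<zeta>" "Q3 = - L3 * \<zeta>"
    using h unfolding v[symmetric] by (simp_all add: eq_neg_iff_add_eq_0 add.commute)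
  have s2: "0 < s\<^sup>2" "s\<^sup>2 \<le> 1" using s by (simp_all add: power_le_one)
  show False
    by (rule N.no_singular_point[OF pencil_conditions s2(1) pencil_pos_affine[OF s2], where \<alpha> = \<alpha> and \<zeta> = \<zeta>])
      (simp_all add: f d e algebra_simps eval_nat_numeral)
qed

text \<open>The same at (1, 0, \<zeta>). The y-derivative there involves f21, f31 and f41, the
  coefficients of the next lower power of x.\<close>

lemma no_zero_at_infinity_sol:
  assumes s: "0 < s" "s \<le> 1" and z: "bil (s, z) (s, z) = T"
  shows "no_zero_at_infinity s z"
  unfolding no_zero_at_infinity_def
proof (intro allI notI, elim conjE)
  fix \<zeta> :: complex
  assume h: "of_real s * \<zeta>\<^sup>2 + of_real (sa0 z) = 0" "of_real (Re (su0 z)) * \<zeta> + of_real (Re (sv0 z)) = 0"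
    "of_real (Im (su0 z)) * \<zeta> + of_real (Im (sv0 z)) = 0"
  have F: "f20 = 2 * s * sa0 z + (Re (su0 z))\<^sup>2 + (Im (su0 z))\<^sup>2" "f30 = 2 * (Re (su0 z) * Re (sv0 z) + Im (su0 z) * Im (sv0 z))"
    "f40 = (sa0 z)\<^sup>2 + (Re (sv0 z))\<^sup>2 + (Im (sv0 z))\<^sup>2"
    "f21 = 2 * s * sa1 z + 2 * (Re (su0 z) * Re (su1 z) + Im (su0 z) * Im (su1 z))"
    "f31 = 2 * (Re (su0 z) * Re (sv1 z) + Im (su0 z) * Im (sv1 z) + Re (su1 z) * Re (sv0 z) + Im (su1 z) * Im (sv0 z))"
    "f41 = 2 * sa0 z * sa1 z + 2 * (Re (sv0 z) * Re (sv1 z) + Im (sv0 z) * Im (sv1 z))"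
    using z unfolding T_def bil_def Let_def fst_conv snd_conv prod.inject
    by (auto simp: inner_complex_def power2_eq_square algebra_simps)
  have e: "complex_of_real (sa0 z) = - of_real s * \<zeta>\<^sup>2" "complex_of_real (Re (sv0 z)) = - of_real (Re (su0 z)) * \<zeta>"
    "complex_of_real (Im (sv0 z)) = - of_real (Im (su0 z)) * \<zeta>"
    using h by (simp_all add: eq_neg_iff_add_eq_0 add.commute)
  have s2: "0 < s\<^sup>2" "s\<^sup>2 \<le> 1" using s by (simp_all add: power_le_one)
  show False
    by (rule N.no_singular_point_at_infinity[unfolded coeff_F_leading, OF pencil_conditions(2) pencil_pos_infinity[OF s2], where \<zeta> = \<zeta>])
      (simp_all only: F of_real_add of_real_mult of_real_power of_real_numeral e, simp_all add: algebra_simps eval_nat_numeral)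
qed

lemma kernel_T:
  assumes s: "s \<in> {0..1}" and z: "bil (s, z) (s, z) = T" and w: "bil (s, z) (0, w) = 0" "Im (herm z w) = 0"
  shows "w = 0"
proof (cases "s = 0")
  case False
  then have s': "0 < s" "s \<le> 1" using s by auto
  \<comment> \<open>If both linear forms vanished, F3 would be 0 and divisible by F2.\<close>
  have u: "su0 z \<noteq> 0 \<or> su1 z \<noteq> 0"
  proof (rule ccontr)
    assume "\<not> (su0 z \<noteq> 0 \<or> su1 z \<noteq> 0)"
    then have "F3 = 0" using z unfolding bil_T_iff by (simp add: sol_polys)
    then show False using not_dvd[OF nd] f20_pos by simp
  qed
  show ?thesis
    by (rule kernel_pos[OF False no_common_zero_sol[OF s' z] no_zero_at_infinity_sol[OF s' z] u w])
next
  case True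
  then have z0: "bil (0, z) (0, z) = T" using z by simp
  note F = z0[unfolded bil_T_iff, THEN conjunct1] z0[unfolded bil_T_iff, THEN conjunct2, THEN conjunct1]
    z0[unfolded bil_T_iff, THEN conjunct2, THEN conjunct2]
  \<comment> \<open>This identity turns the genericity of D into that of \<open>pA z\<close> and
    \<open>pE z\<close>: a common affine root would be a double root of D, and a common root at
    infinity would lower its degree to at most 4.\<close>
  have D: "D = smult 4 ((pE z)\<^sup>2 + F2 * (pA z)\<^sup>2)"
  proof -
    have 4: "4 * p = smult 4 p" for p :: "real poly" by (simp add: numeral_poly)
    have "F2 = (pL2 z)\<^sup>2 + (pL3 z)\<^sup>2" using F(1) by simp
    then show ?thesis unfolding D_def mult.assoc 4 F(2,3) pE_def by (simp add: power2_eq_square algebra_simps smult_add_right smult_diff_right)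
  qed
  show ?thesis
  proof (rule kernel_zero)
    show "Re (su0 z) * Im (su1 z) - Im (su0 z) * Re (su1 z) \<noteq> 0" by (rule independent_Z0) (use z0 in simp)
    show "\<not> (poly (cx (pA z)) \<alpha> = 0 \<and> poly (cx (pE z)) \<alpha> = 0)" for \<alpha>
    proof
      assume h: "poly (cx (pA z)) \<alpha> = 0 \<and> poly (cx (pE z)) \<alpha> = 0"
      have "poly (cx D) \<alpha> = 0" unfolding D using h by simp
      moreover have "poly (pderiv (cx D)) \<alpha> = 0"
        unfolding D using h by (simp add: pderiv_smult pderiv_add pderiv_mult power2_eq_square)
      ultimately show False using D_simple by blast
    qed
    show "degree (pE z) = 3 \<or> degree (pA z) = 2"
    proof (rule ccontr)
      assume "\<not> (degree (pE z) = 3 \<or> degree (pA z) = 2)"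
      then have d: "degree (pE z) \<le> 2" "degree (pA z) \<le> 1" using degree_pE[of z] degree_sol_polys(1)[of z] by auto
      have "degree ((pE z)\<^sup>2) \<le> 4" unfolding power2_eq_square by (rule degree_mult_le_add[OF d(1) d(1)]) simp
      moreover have "degree (F2 * (pA z)\<^sup>2) \<le> 4" unfolding power2_eq_square
        by (rule degree_mult_le_add[OF degree_F(1) degree_mult_le_add[OF d(2) d(2) order_refl]]) simp
      ultimately have "degree ((pE z)\<^sup>2 + F2 * (pA z)\<^sup>2) \<le> 4" by (rule degree_add_le)
      then have "degree D \<le> 4" unfolding D by simp
      then show False using degree_D by simp
    qed
  qed (use True w in simp_all)
qed

sublocale S: sol_family T
  by unfold_locales (rule kernel_T)

theorem count_positive: "num_sos3_classes [:f4, f3, f2, 0, 1:] = 8"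
proof -
  have "num_sos3_classes [:f4, f3, f2, 0, 1:] = card ((\<lambda>z. {w. orth2 z w}) ` {z. bil (1, z) (1, z) = T})"
  proof (rule card_classes[where R = orth2])
    show "[:f4, f3, f2, 0, 1:] = [:f4, f3, f2, 0, [:[:1\<^sup>2:]:]:]" by (simp add: one_pCons)
    show "(\<exists>g. orthogonal_transformation g \<and> encode 1 z' = map6 g (encode 1 z)) \<longleftrightarrow> orth2 z z'" for z z'
      by (rule encode_equiv_one)
    show "{w. orth2 z w} = {w. orth2 z' w} \<longleftrightarrow> orth2 z z'" for z z' by (rule S.orbit_eq_iff)
  qed (simp_all add: T_def)
  also have "\<dots> = card ((\<lambda>z. {w. orth2 z w}) ` Z0)"
    using S.card_orbits_constant unfolding S.orbits_def S.Z_def .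
  finally show ?thesis using card_orbits_Z0 by simp
qed

end

theorem theorem9p5:
  shows
  "(\<forall>f2 f3 f4 :: bipoly.
      bihom 2 f2 \<and> bihom 3 f3 \<and> bihom 4 f4 \<and>
      psd3 [:f4, f3, f2:] \<and>
      bidisc 2 f2 \<noteq> 0 \<and> \<not> f2 dvd f3 \<and> bidisc 6 (4 * f2 * f4 - f3 ^ 2) \<noteq> 0
      \<longrightarrow> num_sos3_classes [:f4, f3, f2:] = 4)
 \<and> (\<forall>f2 f3 f4 :: bipoly.
      let F2 = dehom f2; F3 = dehom f3; F4 = dehom f4;
          g23 = gfun 2 3 F2 F3; g24 = gfun 2 4 F2 F4; g34 = gfun 3 4 F3 F4;
          P = g23 * g34 - g24 ^ 2;
          Q = F4 ^ 2 * g23 * (2 * F4 * g23 - F3 * g24);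
          R = (8 * F2 * F4 - 3 * F3 ^ 2) * g23 + 2 * F2 * F3 * g24
      in
      bihom 2 f2 \<and> bihom 3 f3 \<and> bihom 4 f4 \<and>
      pd3 [:f4, f3, f2, 0, 1:] \<and> psd3 [:f4, f3, f2:] \<and>
      \<not> (bidisc 2 f2 = 0) \<and>
      \<not> (f2 dvd f3) \<and>
      \<not> (bidisc 6 (4 * f2 * f4 - f3 ^ 2) = 0) \<and>
      \<not> (bidisc 3 f3 = 0) \<and>
      coprime f3 f4 \<and>
      coprime g23 g24 \<and>
      coprime g24 g34 \<and>
      \<not> (Phi 3 4 F3 (F2 ^ 2) F4 = 0) \<and>
      \<not> (disc 8 P = 0) \<and>
      \<not> (Phi 8 18 P Q (R ^ 2) = 0) \<and>
      coprime f3 (4 * f4 - f2 ^ 2)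
      \<longrightarrow> num_sos3_classes [:f4, f3, f2, 0, 1:] = 8)"
proof (intro conjI allI)
  fix f2 f3 f4 :: bipoly
  show "bihom 2 f2 \<and> bihom 3 f3 \<and> bihom 4 f4 \<and> psd3 [:f4, f3, f2:] \<and>
      bidisc 2 f2 \<noteq> 0 \<and> \<not> f2 dvd f3 \<and> bidisc 6 (4 * f2 * f4 - f3 ^ 2) \<noteq> 0
      \<longrightarrow> num_sos3_classes [:f4, f3, f2:] = 4"
  proof (intro impI, elim conjE)
    assume h: "bihom 2 f2" "bihom 3 f3" "bihom 4 f4"
      and g: "psd3 [:f4, f3, f2:]" "bidisc 2 f2 \<noteq> 0" "\<not> f2 dvd f3" "bidisc 6 (4 * f2 * f4 - f3 ^ 2) \<noteq> 0"
    obtain f20 f21 f22 where f2: "f2 = form2 f20 f21 f22" by (rule bihom_2E[OF h(1)])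
    obtain f30 f31 f32 f33 where f3: "f3 = form3 f30 f31 f32 f33" by (rule bihom_3E[OF h(2)])
    obtain f40 f41 f42 f43 f44 where f4: "f4 = form4 f40 f41 f42 f43 f44" by (rule bihom_4E[OF h(3)])
    interpret generic_coefficients f20 f21 f22 f30 f31 f32 f33 f40 f41 f42 f43 f44
      by unfold_locales (fact g[unfolded f2 f3 f4])+
    show "num_sos3_classes [:f4, f3, f2:] = 4" using count_with_zero unfolding f2 f3 f4 .
  qed
next
  fix f2 f3 f4 :: bipoly
  show "let F2 = dehom f2; F3 = dehom f3; F4 = dehom f4;
          g23 = gfun 2 3 F2 F3; g24 = gfun 2 4 F2 F4; g34 = gfun 3 4 F3 F4;
          P = g23 * g34 - g24 ^ 2;
          Q = F4 ^ 2 * g23 * (2 * F4 * g23 - F3 * g24);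
          R = (8 * F2 * F4 - 3 * F3 ^ 2) * g23 + 2 * F2 * F3 * g24
      in
      bihom 2 f2 \<and> bihom 3 f3 \<and> bihom 4 f4 \<and>
      pd3 [:f4, f3, f2, 0, 1:] \<and> psd3 [:f4, f3, f2:] \<and>
      \<not> (bidisc 2 f2 = 0) \<and>
      \<not> (f2 dvd f3) \<and>
      \<not> (bidisc 6 (4 * f2 * f4 - f3 ^ 2) = 0) \<and>
      \<not> (bidisc 3 f3 = 0) \<and>
      coprime f3 f4 \<and>
      coprime g23 g24 \<and>
      coprime g24 g34 \<and>
      \<not> (Phi 3 4 F3 (F2 ^ 2) F4 = 0) \<and>
      \<not> (disc 8 P = 0) \<and>
      \<not> (Phi 8 18 P Q (R ^ 2) = 0) \<and>
      coprime f3 (4 * f4 - f2 ^ 2)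
      \<longrightarrow> num_sos3_classes [:f4, f3, f2, 0, 1:] = 8"
    unfolding Let_def
  proof (intro impI, elim conjE)
    assume h: "bihom 2 f2" "bihom 3 f3" "bihom 4 f4"
      and g: "psd3 [:f4, f3, f2:]" "\<not> (bidisc 2 f2 = 0)" "\<not> f2 dvd f3" "\<not> (bidisc 6 (4 * f2 * f4 - f3 ^ 2) = 0)"
        "pd3 [:f4, f3, f2, 0, 1:]"
      and e: "coprime (gfun 2 3 (dehom f2) (dehom f3)) (gfun 2 4 (dehom f2) (dehom f4))"
        "\<not> (disc 8 (gfun 2 3 (dehom f2) (dehom f3) * gfun 3 4 (dehom f3) (dehom f4) - (gfun 2 4 (dehom f2) (dehom f4))\<^sup>2) = 0)"
        "\<not> (Phi 8 18 (gfun 2 3 (dehom f2) (dehom f3) * gfun 3 4 (dehom f3) (dehom f4) - (gfun 2 4 (dehom f2) (dehom f4))\<^sup>2)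
          ((dehom f4)\<^sup>2 * gfun 2 3 (dehom f2) (dehom f3) * (2 * dehom f4 * gfun 2 3 (dehom f2) (dehom f3) - dehom f3 * gfun 2 4 (dehom f2) (dehom f4)))
          (((8 * dehom f2 * dehom f4 - 3 * (dehom f3)\<^sup>2) * gfun 2 3 (dehom f2) (dehom f3) + 2 * dehom f2 * dehom f3 * gfun 2 4 (dehom f2) (dehom f4))\<^sup>2) = 0)"
    obtain f20 f21 f22 where f2: "f2 = form2 f20 f21 f22" by (rule bihom_2E[OF h(1)])
    obtain f30 f31 f32 f33 where f3: "f3 = form3 f30 f31 f32 f33" by (rule bihom_3E[OF h(2)])
    obtain f40 f41 f42 f43 f44 where f4: "f4 = form4 f40 f41 f42 f43 f44" by (rule bihom_4E[OF h(3)])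
    note dh = coefficients.dehom_f
    interpret generic_quartic f20 f21 f22 f30 f31 f32 f33 f40 f41 f42 f43 f44
      by unfold_locales (fact g[unfolded f2 f3 f4] e[unfolded f2 f3 f4 dh])+
    show "num_sos3_classes [:f4, f3, f2, 0, 1:] = 8" using count_positive unfolding f2 f3 f4 .
  qed
qed

end
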